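(* Let $\mathbb G$ be the Gurariĭ space, let $\mathcal B(\mathbb G)$ be the space of all nonexpansive operators $\mathbb G\to\mathbb G$ endowed with the strong operator topology, and let $\mathcal G(\mathbb G)\subseteq\mathcal B(\mathbb G)$ be the set of all Gurariĭ operators from $\mathbb G$ to $\mathbb G$. Then $\mathcal G(\mathbb G)$ is a dense $G_\delta$-subset of $\mathcal B(\mathbb G)$.
   Context: All Banach spaces are real and separable; all operators are bounded linear operators between such spaces. An operator $T:X\to Y$ is nonexpansive if $\|T\|\le 1$. An isometric embedding is an injective operator $T:X\to Y$ with $\|T(x)\|=\|x\|$ for all $x\in X$. For $\varepsilon>0$, an $\varepsilon$-isometric embedding is an injective operator $T:X\to Y$ with $(1-\varepsilon)\|x\|<\|T(x)\|<(1+\varepsilon)\|x\|$ for every nonzero $x\in X$. Embeddings are not assumed surjective. Gurariĭ space: a Banach space $X$ is Gurariĭ if for any finite-dimensional Banach spaces $A\subseteq B$ and any $\varepsilon>0$, every isometric embedding $A\to X$ extends to an $\varepsilon$-isometric embedding $B\to X$. Such a (separable) space exists and is unique up to linear isometric isomorphism; it is denoted $\mathbb G$. Gurariĭ operator: an operator $G:X\to Y$ between Banach spaces is Gurariĭ if $G$ is nonexpansive and for any $\varepsilon>0$, any nonexpansive operator $T:A\to B$ between finite-dimensional Banach spaces, any linear subspaces $A_0\subseteq A$, $B_0\subseteq B$ with $T[A_0]\subseteq B_0$, and any isometric embeddings $i_0:A_0\to X$, $j_0:B_0\to Y$ with $G\circ i_0=j_0\circ T{\restriction}_{A_0}$, there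 exist $\varepsilon$-isometric embeddings $i:A\to X$ and $j:B\to Y$ such that $i{\restriction}_{A_0}=i_0$, $j{\restriction}_{B_0}=j_0$ and $G\circ i=j\circ T$. The strong operator topology on $\mathcal B(\mathbb G)$ is the smallest topology for which, for every $x\in\mathbb G$, the map $\mathcal B(\mathbb G)\to\mathbb G$, $T\mapsto T(x)$, is continuous (with $\mathbb G$ carrying its norm topology). *)

theory Defs
  imports "HOL-Analysis.Analysis" "HOL-Analysis.Finite_Function_Topology"
begin

text \<open>
  One cannot quantify over types inside a formula, so a finite-dimensional Banach space is a pair of
  a finite-dimensional linear subspace \<open>V\<close> of an ambient vector space and a norm \<open>N\<close> on \<open>V\<close>;
  the values of \<open>N\<close> outside \<open>V\<close> are irrelevant, and completeness is automatic.
  Below, the ambient space is always \<open>nat \<Rightarrow>\<^sub>0 real\<close> (finitely supported real sequences), of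
  which only the vector space structure is used, not the norm that the library puts on it.
  It contains an isometric copy of every finite-dimensional normed space
  (lemma \<open>fd_normed_space_universal\<close>).
\<close>

type_synonym fseq = "nat \<Rightarrow>\<^sub>0 real"

definition fd_normed_space :: "'v::real_vector set \<Rightarrow> ('v \<Rightarrow> real) \<Rightarrow> bool" where
  "fd_normed_space V N \<longleftrightarrow>
     (\<exists>S. finite S \<and> V = span S) \<and>
     (\<forall>x\<in>V. 0 \<le> N x) \<and>
     (\<forall>x\<in>V. N x = 0 \<longleftrightarrow> x = 0) \<and>
     (\<forall>c. \<forall>x\<in>V. N (c *\<^sub>R x) = \<bar>c\<bar> * N x) \<and>
     (\<forall>x\<in>V. \<forall>y\<in>V. N (x + y) \<le> N x + N y)"

text \<open>
  Counterparts of \<open>bounded_linear\<close> and \<open>onorm\<close> for maps from \<open>V\<close> with norm \<open>N\<close>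
  to \<open>W\<close> with norm \<open>M\<close>; the values of the map outside \<open>V\<close> are irrelevant.
\<close>

definition operator_on ::
  "'v::real_vector set \<Rightarrow> ('v \<Rightarrow> real) \<Rightarrow> 'w::real_vector set \<Rightarrow> ('w \<Rightarrow> real) \<Rightarrow> ('v \<Rightarrow> 'w) \<Rightarrow> bool" where
  "operator_on V N W M T \<longleftrightarrow>
     (\<forall>x\<in>V. T x \<in> W) \<and>
     (\<forall>x\<in>V. \<forall>y\<in>V. T (x + y) = T x + T y) \<and>
     (\<forall>c. \<forall>x\<in>V. T (c *\<^sub>R x) = c *\<^sub>R T x) \<and>
     (\<exists>K. \<forall>x\<in>V. M (T x) \<le> N x * K)"

definition operator_norm_on ::
  "'v::real_vector set \<Rightarrow> ('v \<Rightarrow> real) \<Rightarrow> ('w::real_vector \<Rightarrow> real) \<Rightarrow> ('v \<Rightarrow> 'w) \<Rightarrow> real" where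
  "operator_norm_on V N M T = (SUP x\<in>V. M (T x) / N x)"

definition nonexpansive_on ::
  "'v::real_vector set \<Rightarrow> ('v \<Rightarrow> real) \<Rightarrow> 'w::real_vector set \<Rightarrow> ('w \<Rightarrow> real) \<Rightarrow> ('v \<Rightarrow> 'w) \<Rightarrow> bool" where
  "nonexpansive_on V N W M T \<longleftrightarrow> operator_on V N W M T \<and> operator_norm_on V N M T \<le> 1"

definition isometric_embedding_on ::
  "'v::real_vector set \<Rightarrow> ('v \<Rightarrow> real) \<Rightarrow> ('v \<Rightarrow> 'x::real_normed_vector) \<Rightarrow> bool" where
  "isometric_embedding_on V N T \<longleftrightarrow>
     operator_on V N UNIV norm T \<and> inj_on T V \<and> (\<forall>x\<in>V. norm (T x) = N x)"

definition eps_isometric_embedding_on ::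
  "real \<Rightarrow> 'v::real_vector set \<Rightarrow> ('v \<Rightarrow> real) \<Rightarrow> ('v \<Rightarrow> 'x::real_normed_vector) \<Rightarrow> bool" where
  "eps_isometric_embedding_on e V N T \<longleftrightarrow>
     operator_on V N UNIV norm T \<and> inj_on T V \<and>
     (\<forall>x\<in>V. x \<noteq> 0 \<longrightarrow> (1 - e) * N x < norm (T x) \<and> norm (T x) < (1 + e) * N x)"

definition gurarii_space :: "'x::banach itself \<Rightarrow> bool" where
  "gurarii_space (_ :: 'x itself) \<longleftrightarrow>
     (\<forall>(A :: fseq set) B N (e :: real) (f :: fseq \<Rightarrow> 'x).
        fd_normed_space B N \<and> subspace A \<and> A \<subseteq> B \<and> 0 < e \<and> isometric_embedding_on A N f \<longrightarrow>
        (\<exists>g :: fseq \<Rightarrow> 'x. eps_isometric_embedding_on e B N g \<and> (\<forall>x\<in>A. g x = f x)))"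

definition gurarii_operator :: "('x::banach \<Rightarrow>\<^sub>L 'y::banach) \<Rightarrow> bool" where
  "gurarii_operator G \<longleftrightarrow>
     norm G \<le> 1 \<and>
     (\<forall>(e :: real) (A :: fseq set) N (B :: fseq set) M T A\<^sub>0 B\<^sub>0
        (i\<^sub>0 :: fseq \<Rightarrow> 'x) (j\<^sub>0 :: fseq \<Rightarrow> 'y).
        0 < e \<and> fd_normed_space A N \<and> fd_normed_space B M \<and> nonexpansive_on A N B M T \<and>
        subspace A\<^sub>0 \<and> A\<^sub>0 \<subseteq> A \<and> subspace B\<^sub>0 \<and> B\<^sub>0 \<subseteq> B \<and> T ` A\<^sub>0 \<subseteq> B\<^sub>0 \<and>
        isometric_embedding_on A\<^sub>0 N i\<^sub>0 \<and> isometric_embedding_on B\<^sub>0 M j\<^sub>0 \<and>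
        (\<forall>a\<in>A\<^sub>0. blinfun_apply G (i\<^sub>0 a) = j\<^sub>0 (T a)) \<longrightarrow>
        (\<exists>(i :: fseq \<Rightarrow> 'x) (j :: fseq \<Rightarrow> 'y).
           eps_isometric_embedding_on e A N i \<and> eps_isometric_embedding_on e B M j \<and>
           (\<forall>a\<in>A\<^sub>0. i a = i\<^sub>0 a) \<and> (\<forall>b\<in>B\<^sub>0. j b = j\<^sub>0 b) \<and>
           (\<forall>a\<in>A. blinfun_apply G (i a) = j (T a))))"

definition nonexpansive_sot :: "('x::real_normed_vector \<Rightarrow>\<^sub>L 'x) topology" where
  "nonexpansive_sot = subtopology strong_operator_topology {T. norm T \<le> 1}"

lemma nonexpansive_on_iff:
  assumes "fd_normed_space V N"
  shows "nonexpansive_on V N W M T \<longleftrightarrow>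
     operator_on V N W M T \<and> (\<forall>x\<in>V. M (T x) \<le> N x)"
proof -
  obtain S where "V = span S"
    using assms unfolding fd_normed_space_def by (elim conjE exE)
  then have ne: "V \<noteq> {}"
    using span_zero[of S] by force
  have pos: "\<And>x. x \<in> V \<Longrightarrow> 0 \<le> N x"
    using assms unfolding fd_normed_space_def by (elim conjE) (rule bspec)
  show ?thesis
  proof (cases "operator_on V N W M T")
    case True
    obtain K where "\<forall>x\<in>V. M (T x) \<le> N x * K"
      using True unfolding operator_on_def by (elim conjE exE)
    then have K: "\<And>x. x \<in> V \<Longrightarrow> M (T x) \<le> N x * K"
      by (rule bspec)
    have b: "bdd_above ((\<lambda>x. M (T x) / N x) ` V)"
    proof (rule bdd_aboveI2)
      fix x assume x: "x \<in> V"
      show "M (T x) / N x \<le> max K 0"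
      proof (cases "N x = 0")
        case False
        then have "0 < N x" using pos[OF x] by simp
        then have "M (T x) / N x \<le> K"
          using K[OF x] by (simp add: pos_divide_le_eq mult.commute)
        then show ?thesis by simp
      qed simp
    qed
    have q: "M (T x) / N x \<le> 1 \<longleftrightarrow> M (T x) \<le> N x" if x: "x \<in> V" for x
    proof (cases "N x = 0")
      case True
      then show ?thesis using K[OF x] by simp
    next
      case False
      then have "0 < N x" using pos[OF x] by simp
      then show ?thesis by (simp add: pos_divide_le_eq)
    qed
    have "operator_norm_on V N M T \<le> 1 \<longleftrightarrow> (\<forall>x\<in>V. M (T x) / N x \<le> 1)"
      unfolding operator_norm_on_def by (rule cSUP_le_iff[OF ne b])
    also have "\<dots> \<longleftrightarrow> (\<forall>x\<in>V. M (T x) \<le> N x)"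
      by (rule ball_cong[OF refl q])
    finally show ?thesis
      using True by (simp only: nonexpansive_on_def)
  qed (simp add: nonexpansive_on_def)
qed

lemma fd_normed_space_universal:
  fixes V :: "'v::real_vector set"
  assumes V: "fd_normed_space V N"
  shows "\<exists>(A :: fseq set) L f. fd_normed_space A L \<and> operator_on A L V N f \<and>
           bij_betw f A V \<and> (\<forall>a\<in>A. N (f a) = L a)"
proof -
  obtain S where S: "finite S" "V = span S"
    using V unfolding fd_normed_space_def by (elim conjE exE)
  obtain B where B: "B \<subseteq> S" "independent B" "S \<subseteq> span B"
    using maximal_independent_subset[of S] by blast
  have fB: "finite B"
    using B(1) S(1) by (rule finite_subset)
  have VB: "V = span B"
    unfolding S(2) using span_mono[OF B(1)] span_minimal[OF B(3) subspace_span] by (rule subset_antisym[rotated])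
  obtain b :: "nat \<Rightarrow> 'v" where b: "bij_betw b {..<card B} B"
    using ex_bij_betw_nat_finite[OF fB] by (auto simp: lessThan_atLeast0)
  define f :: "fseq \<Rightarrow> 'v" where
    "f p = (\<Sum>n<card B. Poly_Mapping.lookup p n *\<^sub>R b n)" for p
  have look: "Poly_Mapping.lookup (c *\<^sub>R p) n = c * Poly_Mapping.lookup p n"
    for c and p :: fseq and n
  proof -
    have "finite {i. c *\<^sub>R Poly_Mapping.lookup p i \<noteq> 0}"
      by (rule finite_subset[OF _ finite_lookup[of p]]) auto
    then show ?thesis
      by (simp add: scaleR_poly_mapping_def Abs_poly_mapping_inverse)
  qed
  have lin: "linear f"
    by (rule linearI)
      (simp_all add: f_def lookup_add look scaleR_add_left sum.distrib scaleR_sum_right)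
  define E where "E = (\<lambda>n. Poly_Mapping.single n (1::real)) ` {..<card B}"
  have fE: "f (Poly_Mapping.single n 1) = b n" if "n < card B" for n
  proof -
    have "f (Poly_Mapping.single n 1) = (\<Sum>m<card B. if n = m then b m else 0)"
      unfolding f_def by (rule sum.cong) (simp_all add: lookup_single when_def)
    then show ?thesis using that by simp
  qed
  have img: "f ` E = B"
  proof -
    have "f ` E = b ` {..<card B}"
      unfolding E_def image_image by (rule image_cong) (simp_all add: fE)
    then show ?thesis using b by (simp add: bij_betw_def)
  qed
  have injE: "inj_on f E"
  proof (rule inj_onI)
    fix x y assume "x \<in> E" "y \<in> E" and e: "f x = f y"
    then obtain m n where *: "m < card B" "n < card B"
        "x = Poly_Mapping.single m 1" "y = Poly_Mapping.single n 1"
      unfolding E_def by blast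
    then have "b m = b n" using e fE by metis
    then have "m = n" using b * unfolding bij_betw_def inj_on_def by blast
    then show "x = y" using * by simp
  qed
  define A where "A = span E"
  have injA: "inj_on f A"
    unfolding A_def
    by (rule linear_inj_on_span_independent_image[OF lin _ injE]) (simp add: img B(2))
  have imA: "f ` A = V"
    unfolding A_def VB using linear_span_image[OF lin, of E] img by simp
  have sub: "subspace A" "finite E"
    by (auto simp: A_def E_def)
  have f0: "x \<in> A \<Longrightarrow> f x = 0 \<longleftrightarrow> x = 0" for x
    using inj_onD[OF injA _ _ subspace_0[OF sub(1)], of x] linear_0[OF lin] by auto
  have inV: "f x \<in> V" if "x \<in> A" for x
    using that imA by blast
  have N: "\<And>x. x \<in> V \<Longrightarrow> 0 \<le> N x" "\<And>x. x \<in> V \<Longrightarrow> N x = 0 \<longleftrightarrow> x = 0"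
    "\<And>c x. x \<in> V \<Longrightarrow> N (c *\<^sub>R x) = \<bar>c\<bar> * N x"
    "\<And>x y. x \<in> V \<Longrightarrow> y \<in> V \<Longrightarrow> N (x + y) \<le> N x + N y"
    using V[unfolded fd_normed_space_def] by metis+
  have "\<exists>S. finite S \<and> A = span S"
    using sub(2) A_def by blast
  then have "fd_normed_space A (\<lambda>a. N (f a))"
    unfolding fd_normed_space_def
    by (simp add: N inV f0 linear_add[OF lin] linear_scale[OF lin])
  moreover have "operator_on A (\<lambda>a. N (f a)) V N f"
    unfolding operator_on_def
    by (intro conjI exI[of _ 1]) (simp_all add: inV linear_add[OF lin] linear_scale[OF lin])
  moreover have "bij_betw f A V"
    using injA imA by (simp add: bij_betw_def)
  ultimately show ?thesis
    by (intro exI[of _ A] exI[of _ "\<lambda>a. N (f a)"] exI[of _ f] conjI ballI refl)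
qed

end

theory Submission
  imports Defs
begin

text \<open>
  The Gurarii property of an operator \<open>G\<close> is equivalent to approximate solvability of extension
  problems for finite families of vectors of the space. Allowing small errors, the families may be
  taken from a countable dense set, so that there are countably many conditions, each of them open
  in the strong operator topology. Approximate solvability makes \<open>G\<close> an open map; this allows to
  correct an approximate solution to an exact one.

  Each of the conditions is dense. Given a nonexpansive operator and a finite-dimensional subspace,
  form the amalgam of the operator restricted to this subspace with the given extension problem and
  embed it almost isometrically into the Gurarii space. This gives an operator between
  finite-dimensional subspaces of almost the right norm. It extends to the whole space with almost
  the same norm by adding the vectors of a dense sequence one by one. Since the nonexpansive
  operators form a completely metrizable space, Baire's theorem applies.
\<close>

section \<open>Finite families of vectors and operators given by their graphs\<close>

text \<open>For approximate data the map from \<open>x i\<close> to \<open>w i\<close> need not be a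
  well-defined linear map, and the marked vectors commute with \<open>G\<close> only approximately,
  so no amalgam reproduces the data exactly. The remedy is to measure every defect additively
  against the l1 norm of the coefficients and to charge a matching amount in the amalgam norm. New
  copies of marked vectors are then only close to the old ones, but the map between the amalgams is
  nonexpansive. Additive l1 errors do not presuppose linear independence, so families may be
  perturbed freely and one \<open>\<eta>\<close> serves families of every size. Data with defect
  \<open>\<eta>\<close> are solved with error \<open>10 * \<eta>\<close>, while the conditions ask
  for an error strictly below \<open>11 * \<eta>\<close>: this room makes them open and lets nearby
  operators reach them. The same pair of amalgams serves twice. A Gurarii operator embeds the pair
  with exact commutation; for a general operator both amalgams are embedded independently and a new
  operator is defined to connect the images.\<close>

lemma span_family:
  fixes x :: "'i \<Rightarrow> 'v::real_vector"
  assumes "finite I"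
  shows "span (x ` I) = range (\<lambda>a. \<Sum>i\<in>I. a i *\<^sub>R x i)"
proof
  have "subspace (range (\<lambda>a. \<Sum>i\<in>I. a i *\<^sub>R x i))"
  proof (rule subspaceI)
    show "0 \<in> range (\<lambda>a. \<Sum>i\<in>I. a i *\<^sub>R x i)"
      by (rule range_eqI[of _ _ "\<lambda>_. 0"]) simp
  next
    fix v w assume "v \<in> range (\<lambda>a. \<Sum>i\<in>I. a i *\<^sub>R x i)" "w \<in> range (\<lambda>a. \<Sum>i\<in>I. a i *\<^sub>R x i)"
    then obtain a b where "v = (\<Sum>i\<in>I. a i *\<^sub>R x i)" "w = (\<Sum>i\<in>I. b i *\<^sub>R x i)" by blast
    then have "v + w = (\<Sum>i\<in>I. (a i + b i) *\<^sub>R x i)"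
      by (simp add: scaleR_add_left sum.distrib)
    then show "v + w \<in> range (\<lambda>a. \<Sum>i\<in>I. a i *\<^sub>R x i)"
      by (rule range_eqI[of _ _ "\<lambda>i. a i + b i"])
  next
    fix c v assume "v \<in> range (\<lambda>a. \<Sum>i\<in>I. a i *\<^sub>R x i)"
    then obtain a where "v = (\<Sum>i\<in>I. a i *\<^sub>R x i)" by blast
    then have "c *\<^sub>R v = (\<Sum>i\<in>I. (c * a i) *\<^sub>R x i)"
      by (simp add: scaleR_sum_right)
    then show "c *\<^sub>R v \<in> range (\<lambda>a. \<Sum>i\<in>I. a i *\<^sub>R x i)"
      by (rule range_eqI[of _ _ "\<lambda>i. c * a i"])
  qed
  moreover have "x j \<in> range (\<lambda>a. \<Sum>i\<in>I. a i *\<^sub>R x i)" if "j \<in> I" for j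
  proof -
    have "(\<Sum>i\<in>I. (if i = j then 1 else 0) *\<^sub>R x i) = (\<Sum>i\<in>I. if i = j then x i else 0)"
      by (rule sum.cong) auto
    then have "x j = (\<Sum>i\<in>I. (if i = j then 1 else 0) *\<^sub>R x i)"
      using assms that by simp
    then show ?thesis by (rule range_eqI[of _ _ "\<lambda>i. if i = j then 1 else 0"])
  qed
  ultimately show "span (x ` I) \<subseteq> range (\<lambda>a. \<Sum>i\<in>I. a i *\<^sub>R x i)"
    by (intro span_minimal) auto
  show "range (\<lambda>a. \<Sum>i\<in>I. a i *\<^sub>R x i) \<subseteq> span (x ` I)"
    by (intro image_subsetI span_sum span_scale span_base) auto
qed

lemma sum_scaleR_if:
  fixes x :: "'i \<Rightarrow> 'v::real_vector"
  assumes "finite I" "j \<in> I"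
  shows "(\<Sum>i\<in>I. (if i = j then c else 0) *\<^sub>R x i) = c *\<^sub>R x j"
proof -
  have "(\<Sum>i\<in>I. (if i = j then c else 0) *\<^sub>R x i) = (\<Sum>i\<in>I. if i = j then c *\<^sub>R x i else 0)"
    by (rule sum.cong) auto
  then show ?thesis using assms by simp
qed

text \<open>Equivalence of norms in finite dimension: the norm of the combination is continuous in
  the coefficients and, by independence, positive on the compact l1 unit sphere. Its minimum
  \<open>m\<close> there gives \<open>C = 1 / m\<close> by homogeneity.\<close>

lemma coefficient_bound:
  fixes x :: "'i \<Rightarrow> 'v::real_normed_vector"
  assumes I: "finite I"
    and ind: "\<And>a. (\<Sum>i\<in>I. a i *\<^sub>R x i) = 0 \<Longrightarrow> \<forall>i\<in>I. a i = 0"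
  shows "\<exists>C>0. \<forall>a. (\<Sum>i\<in>I. \<bar>a i\<bar>) \<le> C * norm (\<Sum>i\<in>I. a i *\<^sub>R x i)"
proof (cases "I = {}")
  case True
  then show ?thesis by (intro exI[of _ 1]) simp
next
  case False
  \<comment> \<open>Coefficient vectors are functions on the whole index type, pinned to 0 outside
    \<open>I\<close>; Tychonoff gives compactness even if that type is infinite.\<close>
  define Q where "Q = PiE UNIV (\<lambda>i. if i \<in> I then {-1..1::real} else {0})"
  have "compact Q"
    unfolding Q_def
    by (simp add: compactin_PiE compactin_euclidean_iff[symmetric] euclidean_product_topology[symmetric] del: compactin_euclidean_iff) (simp add: compactin_euclidean_iff)
  moreover have "closed {a::'i \<Rightarrow> real. (\<Sum>i\<in>I. \<bar>a i\<bar>) = 1}"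
    by (intro closed_Collect_eq continuous_intros) auto
  ultimately have c: "compact (Q \<inter> {a. (\<Sum>i\<in>I. \<bar>a i\<bar>) = 1})"
    by (rule compact_Int_closed)
  obtain j where j: "j \<in> I" using False by blast
  have ne: "Q \<inter> {a. (\<Sum>i\<in>I. \<bar>a i\<bar>) = 1} \<noteq> {}"
  proof -
    have "(\<Sum>i\<in>I. \<bar>if i = j then 1 else 0 :: real\<bar>) = (\<Sum>i\<in>I. if i = j then 1 else 0)"
      by (rule sum.cong) auto
    then have "(\<lambda>i. if i = j then 1 else 0) \<in> Q \<inter> {a. (\<Sum>i\<in>I. \<bar>a i\<bar>) = 1}"
      using I j by (auto simp: Q_def)
    then show ?thesis by blast
  qed
  have "continuous_on (Q \<inter> {a. (\<Sum>i\<in>I. \<bar>a i\<bar>) = 1}) (\<lambda>a. norm (\<Sum>i\<in>I. a i *\<^sub>R x i))"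
    by (intro continuous_intros continuous_on_subset[OF continuous_on_product_coordinates]) auto
  from continuous_attains_inf[OF c ne this]
  obtain a where a: "(\<Sum>i\<in>I. \<bar>a i\<bar>) = 1"
    and min: "\<And>b. b \<in> Q \<Longrightarrow> (\<Sum>i\<in>I. \<bar>b i\<bar>) = 1 \<Longrightarrow>
      norm (\<Sum>i\<in>I. a i *\<^sub>R x i) \<le> norm (\<Sum>i\<in>I. b i *\<^sub>R x i)"
    by auto
  define m where "m = norm (\<Sum>i\<in>I. a i *\<^sub>R x i)"
  have m: "m > 0"
  proof (rule ccontr)
    assume "\<not> m > 0"
    then have "(\<Sum>i\<in>I. a i *\<^sub>R x i) = 0" by (simp add: m_def)
    then have "\<forall>i\<in>I. a i = 0" by (rule ind)
    then have "(\<Sum>i\<in>I. \<bar>a i\<bar>) = 0" by simp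
    with a show False by simp
  qed
  have "(\<Sum>i\<in>I. \<bar>b i\<bar>) \<le> (1 / m) * norm (\<Sum>i\<in>I. b i *\<^sub>R x i)" for b
  proof (cases "(\<Sum>i\<in>I. \<bar>b i\<bar>) = 0")
    case True
    then show ?thesis using m by simp
  next
    case False
    define s where "s = (\<Sum>i\<in>I. \<bar>b i\<bar>)"
    have s: "s > 0" using False by (simp add: s_def sum_nonneg less_le)
    define b' where "b' = (\<lambda>i. if i \<in> I then b i / s else 0)"
    have le: "\<bar>b i\<bar> \<le> s" if "i \<in> I" for i
      unfolding s_def using that I by (intro member_le_sum) auto
    have "b' \<in> Q"
      using le s by (auto simp: Q_def b'_def abs_le_iff field_simps minus_le_iff)
    moreover have "(\<Sum>i\<in>I. \<bar>b' i\<bar>) = 1"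
    proof -
      have "(\<Sum>i\<in>I. \<bar>b' i\<bar>) = (\<Sum>i\<in>I. \<bar>b i\<bar> / s)"
        using s by (intro sum.cong) (auto simp: b'_def)
      also have "\<dots> = 1" using s by (simp add: s_def flip: sum_divide_distrib)
      finally show ?thesis .
    qed
    ultimately have "m \<le> norm (\<Sum>i\<in>I. b' i *\<^sub>R x i)"
      unfolding m_def by (rule min)
    also have "(\<Sum>i\<in>I. b' i *\<^sub>R x i) = (1 / s) *\<^sub>R (\<Sum>i\<in>I. b i *\<^sub>R x i)"
      unfolding scaleR_sum_right by (intro sum.cong) (auto simp: b'_def)
    also have "norm \<dots> = norm (\<Sum>i\<in>I. b i *\<^sub>R x i) / s"
      using s by simp
    finally show ?thesis using s m by (simp add: s_def[symmetric] field_simps)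
  qed
  then show ?thesis using m by (intro exI[of _ "1 / m"]) auto
qed

lemma subspace_closure:
  fixes Z :: "'v::real_normed_vector set"
  assumes "subspace Z"
  shows "subspace (closure Z)"
proof (rule subspaceI)
  show "0 \<in> closure Z" using assms closure_subset subspace_0 by blast
next
  fix v w assume "v \<in> closure Z" "w \<in> closure Z"
  then obtain s t where "\<And>n. s n \<in> Z" "s \<longlonglongrightarrow> v" "\<And>n. t n \<in> Z" "t \<longlonglongrightarrow> w"
    unfolding closure_sequential by metis
  then show "v + w \<in> closure Z" unfolding closure_sequential
    by (intro exI[of _ "\<lambda>n. s n + t n"]) (simp add: tendsto_add subspace_add[OF assms])
next
  fix c v assume "v \<in> closure Z"
  then obtain s where "\<And>n. s n \<in> Z" "s \<longlonglongrightarrow> v" unfolding closure_sequential by metis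
  then show "c *\<^sub>R v \<in> closure Z" unfolding closure_sequential
    by (intro exI[of _ "\<lambda>n. c *\<^sub>R s n"]) (simp add: tendsto_scaleR subspace_scale[OF assms])
qed

text \<open>The bound passes to the closure of \<open>Z\<close>. Applied to differences of points it
  makes the closure single-valued, and together with completeness of the target it makes every
  vector of the source a first component.\<close>

lemma graph_blinfun:
  fixes Z :: "('a::real_normed_vector \<times> 'b::banach) set"
  assumes Z: "subspace Z" and le: "\<And>z. z \<in> Z \<Longrightarrow> norm (snd z) \<le> c * norm (fst z)"
    and dense: "closure (fst ` Z) = UNIV" and c: "0 \<le> c"
  shows "\<exists>G :: 'a \<Rightarrow>\<^sub>L 'b. norm G \<le> c \<and> (\<forall>z\<in>Z. blinfun_apply G (fst z) = snd z)"
proof -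
  define R where "R v y \<longleftrightarrow> (v, y) \<in> closure Z" for v y
  have le': "norm (snd z) \<le> c * norm (fst z)" if "z \<in> closure Z" for z
  proof -
    have "closed {z::'a \<times> 'b. norm (snd z) \<le> c * norm (fst z)}"
      by (intro closed_Collect_le continuous_intros)
    then have "closure Z \<subseteq> {z. norm (snd z) \<le> c * norm (fst z)}"
      using le by (intro closure_minimal) auto
    with that show ?thesis by blast
  qed
  have sub: "subspace (closure Z)"
    by (rule subspace_closure[OF Z])
  have ex: "\<exists>y. R v y" for v
  proof -
    have "v \<in> closure (fst ` Z)" using dense by simp
    then obtain s where s: "\<And>n. s n \<in> fst ` Z" "s \<longlonglongrightarrow> v"
      unfolding closure_sequential by blast
    have "\<forall>n. \<exists>y. (s n, y) \<in> Z" using s(1) by force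
    then obtain t where t: "\<And>n. (s n, t n) \<in> Z" by metis
    have "norm (t m - t n) \<le> c * norm (s m - s n)" for m n
      using le[OF subspace_diff[OF Z t[of m] t[of n]]] by simp
    moreover have "Cauchy s" using s(2) by (rule LIMSEQ_imp_Cauchy)
    ultimately have "Cauchy t"
    proof -
      assume l: "\<And>m n. norm (t m - t n) \<le> c * norm (s m - s n)" and s: "Cauchy s"
      show "Cauchy t"
      proof (rule CauchyI)
        fix e :: real assume e: "0 < e"
        then have "0 < e / (c + 1)" using c by simp
        from CauchyD[OF s this] obtain M where M: "\<And>m n. m \<ge> M \<Longrightarrow> n \<ge> M \<Longrightarrow> norm (s m - s n) < e / (c + 1)"
          by blast
        have "norm (t m - t n) < e" if "m \<ge> M" "n \<ge> M" for m n
        proof -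
          have "norm (t m - t n) \<le> c * norm (s m - s n)" by (rule l)
          also have "\<dots> \<le> c * (e / (c + 1))" using M[OF that] c by (intro mult_left_mono) auto
          also have "\<dots> < e" using c e by (simp add: field_simps)
          finally show ?thesis .
        qed
        then show "\<exists>M. \<forall>m\<ge>M. \<forall>n\<ge>M. norm (t m - t n) < e" by blast
      qed
    qed
    then obtain y where "t \<longlonglongrightarrow> y" using Cauchy_convergent convergent_def by blast
    then have "(\<lambda>n. (s n, t n)) \<longlonglongrightarrow> (v, y)" using s(2) by (intro tendsto_Pair)
    then show ?thesis unfolding R_def closure_sequential
      using t by (intro exI[of _ y] exI[of _ "\<lambda>n. (s n, t n)"]) simp
  qed
  have uniq: "y = y'" if "R v y" "R v y'" for v y y'
    using le'[OF subspace_diff[OF sub that[unfolded R_def]]] by simp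
  define g where "g v = (THE y. R v y)" for v
  have gR: "R v (g v)" for v
    unfolding g_def using ex uniq by (metis the_equality)
  have geq: "g v = y" if "R v y" for v y
    using uniq[OF gR that] .
  have "bounded_linear g"
  proof (rule bounded_linear_intro)
    fix v w show "g (v + w) = g v + g w"
      using subspace_add[OF sub gR[unfolded R_def] gR[unfolded R_def]] by (intro geq) (simp add: R_def)
  next
    fix r v show "g (r *\<^sub>R v) = r *\<^sub>R g v"
      using subspace_scale[OF sub gR[unfolded R_def]] by (intro geq) (simp add: R_def)
  next
    fix v show "norm (g v) \<le> norm v * c"
      using le'[OF gR[unfolded R_def]] by (simp add: mult.commute)
  qed
  moreover have "norm (g v) \<le> c * norm v" for v
    using le'[OF gR[unfolded R_def]] by simp
  moreover have "g (fst z) = snd z" if "z \<in> Z" for z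
    using that closure_subset[of Z] by (intro geq) (auto simp: R_def)
  ultimately show ?thesis
    by (intro exI[of _ "Blinfun g"])
      (auto simp: bounded_linear_Blinfun_apply intro!: norm_blinfun_bound c)
qed

section \<open>Transfer to arbitrary ambient spaces\<close>

lemma fd_normed_spaceD:
  assumes "fd_normed_space V N"
  shows "subspace V" "\<And>x. x \<in> V \<Longrightarrow> 0 \<le> N x" "\<And>x. x \<in> V \<Longrightarrow> N x = 0 \<longleftrightarrow> x = 0"
    "\<And>c x. x \<in> V \<Longrightarrow> N (c *\<^sub>R x) = \<bar>c\<bar> * N x"
    "\<And>x y. x \<in> V \<Longrightarrow> y \<in> V \<Longrightarrow> N (x + y) \<le> N x + N y"
    "\<exists>S. finite S \<and> V = span S"
  using assms unfolding fd_normed_space_def by auto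

lemma operator_onD:
  assumes "operator_on V N W M T"
  shows "\<And>x. x \<in> V \<Longrightarrow> T x \<in> W" "\<And>x y. x \<in> V \<Longrightarrow> y \<in> V \<Longrightarrow> T (x + y) = T x + T y"
    "\<And>c x. x \<in> V \<Longrightarrow> T (c *\<^sub>R x) = c *\<^sub>R T x"
  using assms unfolding operator_on_def by auto

lemma operator_on_sum:
  assumes T: "operator_on V N W M T" and V: "subspace V" and x: "\<And>i. i \<in> I \<Longrightarrow> x i \<in> V"
  shows "T (\<Sum>i\<in>I. a i *\<^sub>R x i) = (\<Sum>i\<in>I. a i *\<^sub>R T (x i))"
  using x
proof (induction I rule: infinite_finite_induct)
  have 0: "T 0 = 0" using operator_onD(3)[OF T subspace_0[OF V], of 0] by simp
  case (infinite A)
  then show ?case using 0 by simp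
next
  case empty
  show ?case using operator_onD(3)[OF T subspace_0[OF V], of 0] by simp
next
  case (insert i I)
  then have "x i \<in> V" "(\<Sum>i\<in>I. a i *\<^sub>R x i) \<in> V"
    using V by (auto intro!: subspace_sum subspace_scale)
  then show ?case
    using insert by (simp add: operator_onD[OF T] subspace_scale[OF V])
qed

text \<open>Unlike in \<open>isometric_embedding_on\<close>, the target is again a subspace with its
  own norm, so that changes of coordinates between two such pairs are covered.\<close>

definition isometric_map where
  "isometric_map V N W M k \<longleftrightarrow>
     operator_on V N W M k \<and> inj_on k V \<and> (\<forall>x\<in>V. M (k x) = N x)"

lemma isometric_map_embedding:
  "isometric_embedding_on V N k \<longleftrightarrow> isometric_map V N UNIV norm k"
  by (simp add: isometric_embedding_on_def isometric_map_def)

lemma isometric_map_comp: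
  assumes "isometric_map U N V M k" "isometric_map V M W L h"
  shows "isometric_map U N W L (\<lambda>x. h (k x))"
  using assms unfolding isometric_map_def operator_on_def inj_on_def
  by (auto intro: exI[of _ 1])

lemma isometric_map_subset:
  assumes "isometric_map U N V M k" "U' \<subseteq> U" "\<And>x. x \<in> U' \<Longrightarrow> k x \<in> V'"
  shows "isometric_map U' N V' M k"
  using assms unfolding isometric_map_def operator_on_def inj_on_def
  by (auto 4 3 simp: subset_iff intro: exI[of _ 1])

lemma eps_isometric_comp:
  assumes k: "isometric_map U N V M k" and h: "eps_isometric_embedding_on e V M h" and U: "subspace U"
  shows "eps_isometric_embedding_on e U N (\<lambda>x. h (k x))"
proof -
  have k0: "k 0 = 0"
    using k subspace_0[OF U] unfolding isometric_map_def operator_on_def by (metis scaleR_zero_left)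
  have "k x \<noteq> 0" if "x \<in> U" "x \<noteq> 0" for x
    using k k0 that subspace_0[OF U] unfolding isometric_map_def inj_on_def by metis
  moreover obtain C where "\<forall>x\<in>V. norm (h x) \<le> M x * C"
    using h unfolding eps_isometric_embedding_on_def operator_on_def by blast
  then have "\<exists>C. \<forall>x\<in>U. norm (h (k x)) \<le> N x * C"
    using k unfolding isometric_map_def operator_on_def by (intro exI[of _ C]) metis
  ultimately show ?thesis
    using k h unfolding isometric_map_def eps_isometric_embedding_on_def operator_on_def inj_on_def
    by simp metis
qed

text \<open>The Gurarii definitions quantify over spaces inside \<open>fseq\<close>, while the
  amalgams below live in other types. The mutually inverse isometries \<open>h\<close> and
  \<open>k\<close> carry an extension problem into \<open>fseq\<close> and its solution
  back.\<close>

lemma fd_coordinates: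
  fixes V :: "'v::real_vector set"
  assumes "fd_normed_space V N"
  shows "\<exists>(A :: fseq set) L h k. fd_normed_space A L \<and> isometric_map A L V N h \<and> isometric_map V N A L k \<and>
     (\<forall>v\<in>V. h (k v) = v) \<and> (\<forall>a\<in>A. k (h a) = a)"
proof -
  obtain A :: "fseq set" and L h where *: "fd_normed_space A L" "operator_on A L V N h"
    "bij_betw h A V" "\<forall>a\<in>A. N (h a) = L a"
    using fd_normed_space_universal[OF assms] by blast
  define k where "k = inv_into A h"
  have hk: "h (k v) = v" "k v \<in> A" if "v \<in> V" for v
    using that *(3) by (auto simp: k_def bij_betw_def f_inv_into_f inv_into_into)
  have kh: "k (h a) = a" if "a \<in> A" for a
    using that *(3) by (simp add: k_def bij_betw_def)
  note A = fd_normed_spaceD[OF *(1)] and h = operator_onD[OF *(2)] and V = fd_normed_spaceD(1)[OF assms]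
  have "k (v + w) = k v + k w" if "v \<in> V" "w \<in> V" for v w
  proof -
    have "h (k v + k w) = v + w" using that by (simp add: h hk)
    then show ?thesis using that kh[of "k v + k w"] subspace_add[OF A(1)] hk by metis
  qed
  moreover have "k (c *\<^sub>R v) = c *\<^sub>R k v" if "v \<in> V" for v c
  proof -
    have "h (c *\<^sub>R k v) = c *\<^sub>R v" using that by (simp add: h hk)
    then show ?thesis using that kh[of "c *\<^sub>R k v"] subspace_scale[OF A(1)] hk by metis
  qed
  moreover have "inj_on k V" using hk by (metis inj_onI)
  moreover have "L (k v) = N v" if "v \<in> V" for v using that hk *(4) by metis
  ultimately have "isometric_map V N A L k"
    unfolding isometric_map_def operator_on_def using hk by (auto intro: exI[of _ 1])
  moreover have "isometric_map A L V N h"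
    using * by (simp add: isometric_map_def bij_betw_def)
  ultimately show ?thesis using *(1) hk kh by blast
qed

lemma isometric_map_vimage:
  assumes h: "isometric_map A L V N h" and W: "subspace W" "W \<subseteq> V" and A: "subspace A"
  shows "subspace {a \<in> A. h a \<in> W}" "isometric_map {a \<in> A. h a \<in> W} L W N h"
proof -
  have o: "operator_on A L V N h" using h by (simp add: isometric_map_def)
  have "h 0 = 0" using operator_onD(3)[OF o subspace_0[OF A], of 0] by simp
  then show "subspace {a \<in> A. h a \<in> W}"
    using W(1) A operator_onD[OF o] by (auto intro!: subspaceI simp: subspace_0 subspace_add subspace_scale)
  show "isometric_map {a \<in> A. h a \<in> W} L W N h"
    by (rule isometric_map_subset[OF h]) auto
qed

lemma gurarii_space_extend:
  fixes V :: "'v::real_vector set" and f :: "'v \<Rightarrow> 'g::banach"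
  assumes g: "gurarii_space TYPE('g)" and V: "fd_normed_space V N"
    and W: "subspace W" "W \<subseteq> V" and e: "0 < e" and f: "isometric_embedding_on W N f"
  shows "\<exists>g :: 'v \<Rightarrow> 'g. eps_isometric_embedding_on e V N g \<and> (\<forall>x\<in>W. g x = f x)"
proof -
  obtain A :: "fseq set" and L h k where A: "fd_normed_space A L" and h: "isometric_map A L V N h"
    and k: "isometric_map V N A L k" and hk: "\<forall>v\<in>V. h (k v) = v" and kh: "\<forall>a\<in>A. k (h a) = a"
    using fd_coordinates[OF V] by blast
  define A0 where "A0 = {a \<in> A. h a \<in> W}"
  note sub = isometric_map_vimage[OF h W fd_normed_spaceD(1)[OF A], folded A0_def]
  have "isometric_embedding_on A0 L (\<lambda>a. f (h a))"
    using isometric_map_comp[OF sub(2) f[unfolded isometric_map_embedding]] by (simp add: isometric_map_embedding)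
  then obtain g' where g': "eps_isometric_embedding_on e A L g'" "\<forall>a\<in>A0. g' a = f (h a)"
    using g A sub(1) e unfolding gurarii_space_def
    by (metis (no_types, lifting) A0_def mem_Collect_eq subsetI)
  have "k v \<in> A0" "h (k v) = v" if "v \<in> W" for v
    using that hk k W unfolding isometric_map_def operator_on_def A0_def by auto
  then show ?thesis
    using eps_isometric_comp[OF k g'(1) fd_normed_spaceD(1)[OF V]] g'(2)
    by (intro exI[of _ "\<lambda>x. g' (k x)"]) simp
qed

lemma gurarii_operator_extend:
  fixes V :: "'v::real_vector set" and W :: "'w::real_vector set" and G :: "'x::banach \<Rightarrow>\<^sub>L 'y::banach"
    and i0 :: "'v \<Rightarrow> 'x" and j0 :: "'w \<Rightarrow> 'y"
  assumes G: "gurarii_operator G" and V: "fd_normed_space V N" and W: "fd_normed_space W M"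
    and T: "operator_on V N W M T" "\<And>x. x \<in> V \<Longrightarrow> M (T x) \<le> N x"
    and V0: "subspace V0" "V0 \<subseteq> V" and W0: "subspace W0" "W0 \<subseteq> W" and TV0: "T ` V0 \<subseteq> W0"
    and i0: "isometric_embedding_on V0 N i0" and j0: "isometric_embedding_on W0 M j0"
    and comm: "\<And>v. v \<in> V0 \<Longrightarrow> blinfun_apply G (i0 v) = j0 (T v)" and e: "0 < e"
  shows "\<exists>i j. eps_isometric_embedding_on e V N i \<and> eps_isometric_embedding_on e W M j \<and>
     (\<forall>v\<in>V0. i v = i0 v) \<and> (\<forall>w\<in>W0. j w = j0 w) \<and> (\<forall>v\<in>V. blinfun_apply G (i v) = j (T v))"
proof -
  obtain A :: "fseq set" and L h k where A: "fd_normed_space A L" and h: "isometric_map A L V N h"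
    and k: "isometric_map V N A L k" and hk: "\<forall>v\<in>V. h (k v) = v" and kh: "\<forall>a\<in>A. k (h a) = a"
    using fd_coordinates[OF V] by blast
  obtain B :: "fseq set" and L' h' k' where B: "fd_normed_space B L'" and h': "isometric_map B L' W M h'"
    and k': "isometric_map W M B L' k'" and hk': "\<forall>v\<in>W. h' (k' v) = v" and kh': "\<forall>a\<in>B. k' (h' a) = a"
    using fd_coordinates[OF W] by blast
  define A0 where "A0 = {a \<in> A. h a \<in> V0}"
  define B0 where "B0 = {a \<in> B. h' a \<in> W0}"
  note subA = isometric_map_vimage[OF h V0 fd_normed_spaceD(1)[OF A], folded A0_def]
  note subB = isometric_map_vimage[OF h' W0 fd_normed_spaceD(1)[OF B], folded B0_def]
  have iA: "isometric_embedding_on A0 L (\<lambda>a. i0 (h a))"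
    using isometric_map_comp[OF subA(2) i0[unfolded isometric_map_embedding]] by (simp add: isometric_map_embedding)
  have iB: "isometric_embedding_on B0 L' (\<lambda>a. j0 (h' a))"
    using isometric_map_comp[OF subB(2) j0[unfolded isometric_map_embedding]] by (simp add: isometric_map_embedding)
  define S where "S a = k' (T (h a))" for a
  have hD: "h a \<in> V" "N (h a) = L a" if "a \<in> A" for a
    using that h unfolding isometric_map_def operator_on_def by auto
  have k'D: "k' a \<in> B" "L' (k' a) = M a" if "a \<in> W" for a
    using that k' unfolding isometric_map_def operator_on_def by auto
  have "operator_on A L B L' S"
    unfolding operator_on_def S_def
    using h k' T unfolding isometric_map_def operator_on_def
    by (auto intro!: exI[of _ 1]) (metis T(2))
  moreover have "L' (S a) \<le> L a" if "a \<in> A" for a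
    using hD[OF that] T(2) operator_onD(1)[OF T(1)] k'D(2) unfolding S_def by metis
  ultimately have S: "nonexpansive_on A L B L' S"
    by (simp add: nonexpansive_on_iff[OF A])
  have h'S: "h' (S a) = T (h a)" if "a \<in> A" for a
    using hD(1)[OF that] operator_onD(1)[OF T(1)] hk' by (simp add: S_def)
  have "S ` A0 \<subseteq> B0"
  proof
    fix b assume "b \<in> S ` A0"
    then obtain a where a: "a \<in> A0" "b = S a" by blast
    then have "a \<in> A" "T (h a) \<in> W0" using TV0 by (auto simp: A0_def)
    then show "b \<in> B0" using a h'S[of a] operator_onD(1)[OF T(1)] hD(1) k'D(1) by (simp add: B0_def S_def)
  qed
  moreover have "\<forall>a\<in>A0. blinfun_apply G (i0 (h a)) = j0 (h' (S a))"
    using comm h'S by (simp add: A0_def)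
  moreover have "A0 \<subseteq> A" "B0 \<subseteq> B" by (auto simp: A0_def B0_def)
  ultimately have "\<exists>(i :: fseq \<Rightarrow> 'x) (j :: fseq \<Rightarrow> 'y).
           eps_isometric_embedding_on e A L i \<and> eps_isometric_embedding_on e B L' j \<and>
           (\<forall>a\<in>A0. i a = i0 (h a)) \<and> (\<forall>b\<in>B0. j b = j0 (h' b)) \<and>
           (\<forall>a\<in>A. blinfun_apply G (i a) = j (S a))"
    using G e A B S subA(1) subB(1) iA iB unfolding gurarii_operator_def by blast
  then obtain i j where ij: "eps_isometric_embedding_on e A L i" "eps_isometric_embedding_on e B L' j"
      "\<forall>a\<in>A0. i a = i0 (h a)" "\<forall>b\<in>B0. j b = j0 (h' b)" "\<forall>a\<in>A. blinfun_apply G (i a) = j (S a)"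
    by blast
  have kD: "k v \<in> A" if "v \<in> V" for v
    using that k unfolding isometric_map_def operator_on_def by auto
  have "i (k v) = i0 v" if "v \<in> V0" for v
    using that V0 hk kD ij(3) by (auto simp: A0_def)
  moreover have "j (k' v) = j0 v" if "v \<in> W0" for v
    using that W0 hk' k'D ij(4) by (auto simp: B0_def)
  moreover have "blinfun_apply G (i (k v)) = j (k' (T v))" if "v \<in> V" for v
    using ij(5) kD[OF that] that hk by (simp add: S_def)
  ultimately show ?thesis
    using eps_isometric_comp[OF k ij(1) fd_normed_spaceD(1)[OF V]]
      eps_isometric_comp[OF k' ij(2) fd_normed_spaceD(1)[OF W]]
    by (intro exI[of _ "\<lambda>x. i (k x)"] exI[of _ "\<lambda>x. j (k' x)"]) simp
qed

section \<open>Gluing norms and their realization\<close>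

text \<open>
  \<open>q v a\<close> is the quotient norm of the vector \<open>v + (\<Sum>i\<in>I. a i *\<^sub>R e i)\<close> in the amalgam of the given
  space with new vectors \<open>e i\<close>: the parameter \<open>b\<close> shifts a combination of the \<open>u k\<close> from the new
  part, whose size is measured by \<open>\<mu>\<close>, to the old one. The condition \<open>mu_zero\<close> keeps the old norm
  unchanged, and \<open>mu_ge\<close> makes \<open>q\<close> definite.
\<close>

locale gluing =
  fixes I :: "'i set" and K :: "'k set" and u :: "'k \<Rightarrow> 'g::real_normed_vector"
    and \<mu> :: "('i \<Rightarrow> real) \<Rightarrow> ('k \<Rightarrow> real) \<Rightarrow> real" and \<rho> :: real
  assumes finite_I: "finite I"
    and rho_pos: "0 < \<rho>"
    and mu_cong: "(\<And>i. i \<in> I \<Longrightarrow> a i = a' i) \<Longrightarrow> \<mu> a b = \<mu> a' b"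
    and mu_add: "\<mu> (\<lambda>i. a i + a' i) (\<lambda>k. b k + b' k) \<le> \<mu> a b + \<mu> a' b'"
    and mu_scale: "\<mu> (\<lambda>i. c * a i) (\<lambda>k. c * b k) = \<bar>c\<bar> * \<mu> a b"
    and mu_zero: "norm (\<Sum>k\<in>K. b k *\<^sub>R u k) \<le> \<mu> (\<lambda>_. 0) b"
    and mu_ge: "\<rho> * (\<Sum>i\<in>I. \<bar>a i\<bar>) \<le> \<mu> a b"
begin

definition q :: "'g \<Rightarrow> ('i \<Rightarrow> real) \<Rightarrow> real" where
  "q v a = (INF b. norm (v + (\<Sum>k\<in>K. b k *\<^sub>R u k)) + \<mu> a b)"

lemma mu_nonneg: "0 \<le> \<mu> a b"
  by (rule order_trans[OF _ mu_ge]) (use rho_pos in \<open>simp add: sum_nonneg\<close>)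

lemma q_le: "q v a \<le> norm (v + (\<Sum>k\<in>K. b k *\<^sub>R u k)) + \<mu> a b"
  unfolding q_def by (rule cINF_lower) (auto intro!: bdd_belowI[of _ 0] add_nonneg_nonneg mu_nonneg)

lemma q_greatest:
  "(\<And>b. x \<le> norm (v + (\<Sum>k\<in>K. b k *\<^sub>R u k)) + \<mu> a b) \<Longrightarrow> x \<le> q v a"
  unfolding q_def by (rule cINF_greatest) auto

lemma q_ge: "\<rho> * (\<Sum>i\<in>I. \<bar>a i\<bar>) \<le> q v a"
  by (intro q_greatest add_increasing mu_ge norm_ge_zero)

lemma q_nonneg: "0 \<le> q v a"
  by (rule order_trans[OF _ q_ge]) (use rho_pos in \<open>simp add: sum_nonneg\<close>)

lemma q_cong:
  assumes "\<And>i. i \<in> I \<Longrightarrow> a i = a' i"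
  shows "q v a = q v a'"
proof -
  have "\<mu> a b = \<mu> a' b" for b by (rule mu_cong[OF assms])
  then show ?thesis by (simp add: q_def)
qed

lemma q_zero: "q v (\<lambda>_. 0) = norm v"
proof (rule antisym)
  have "\<mu> (\<lambda>_. 0) (\<lambda>_. 0) = 0" using mu_scale[of 0 "\<lambda>_. 0" "\<lambda>_. 0"] by simp
  then show "q v (\<lambda>_. 0) \<le> norm v" using q_le[of v "\<lambda>_. 0" "\<lambda>_. 0"] by simp
  show "norm v \<le> q v (\<lambda>_. 0)"
  proof (rule q_greatest)
    fix b
    have "norm v \<le> norm (v + (\<Sum>k\<in>K. b k *\<^sub>R u k)) + norm (\<Sum>k\<in>K. b k *\<^sub>R u k)"
      using norm_triangle_ineq4[of "v + (\<Sum>k\<in>K. b k *\<^sub>R u k)" "\<Sum>k\<in>K. b k *\<^sub>R u k"] by simp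
    then show "norm v \<le> norm (v + (\<Sum>k\<in>K. b k *\<^sub>R u k)) + \<mu> (\<lambda>_. 0) b"
      using mu_zero[of b] by linarith
  qed
qed

lemma q_add: "q (v + w) (\<lambda>i. a i + a' i) \<le> q v a + q w a'"
proof -
  have "q (v + w) (\<lambda>i. a i + a' i) - q w a' \<le> q v a"
  proof (rule q_greatest)
    fix b
    have "q (v + w) (\<lambda>i. a i + a' i) - (norm (v + (\<Sum>k\<in>K. b k *\<^sub>R u k)) + \<mu> a b) \<le> q w a'"
    proof (rule q_greatest)
      fix b'
      have "q (v + w) (\<lambda>i. a i + a' i) \<le>
          norm (v + w + (\<Sum>k\<in>K. (b k + b' k) *\<^sub>R u k)) + \<mu> (\<lambda>i. a i + a' i) (\<lambda>k. b k + b' k)"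
        by (rule q_le)
      also have "v + w + (\<Sum>k\<in>K. (b k + b' k) *\<^sub>R u k) =
          (v + (\<Sum>k\<in>K. b k *\<^sub>R u k)) + (w + (\<Sum>k\<in>K. b' k *\<^sub>R u k))"
        by (simp add: scaleR_add_left sum.distrib)
      finally show "q (v + w) (\<lambda>i. a i + a' i) - (norm (v + (\<Sum>k\<in>K. b k *\<^sub>R u k)) + \<mu> a b)
          \<le> norm (w + (\<Sum>k\<in>K. b' k *\<^sub>R u k)) + \<mu> a' b'"
        using norm_triangle_ineq[of "v + (\<Sum>k\<in>K. b k *\<^sub>R u k)" "w + (\<Sum>k\<in>K. b' k *\<^sub>R u k)"]
          mu_add[of a a' b b'] by linarith
    qed
    then show "q (v + w) (\<lambda>i. a i + a' i) - q w a' \<le> norm (v + (\<Sum>k\<in>K. b k *\<^sub>R u k)) + \<mu> a b"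
      by linarith
  qed
  then show ?thesis by linarith
qed

lemma q_scale_le:
  assumes "c \<noteq> 0"
  shows "q (c *\<^sub>R v) (\<lambda>i. c * a i) \<le> \<bar>c\<bar> * q v a"
proof -
  have "q (c *\<^sub>R v) (\<lambda>i. c * a i) / \<bar>c\<bar> \<le> q v a"
  proof (rule q_greatest)
    fix b
    have "q (c *\<^sub>R v) (\<lambda>i. c * a i) \<le>
        norm (c *\<^sub>R v + (\<Sum>k\<in>K. (c * b k) *\<^sub>R u k)) + \<mu> (\<lambda>i. c * a i) (\<lambda>k. c * b k)"
      by (rule q_le)
    also have "c *\<^sub>R v + (\<Sum>k\<in>K. (c * b k) *\<^sub>R u k) = c *\<^sub>R (v + (\<Sum>k\<in>K. b k *\<^sub>R u k))"
      by (simp add: scaleR_add_right scaleR_sum_right)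
    finally have "q (c *\<^sub>R v) (\<lambda>i. c * a i) \<le> \<bar>c\<bar> * (norm (v + (\<Sum>k\<in>K. b k *\<^sub>R u k)) + \<mu> a b)"
      unfolding mu_scale norm_scaleR distrib_left .
    then show "q (c *\<^sub>R v) (\<lambda>i. c * a i) / \<bar>c\<bar> \<le> norm (v + (\<Sum>k\<in>K. b k *\<^sub>R u k)) + \<mu> a b"
      using assms by (simp add: pos_divide_le_eq mult.commute)
  qed
  then show ?thesis using assms by (simp add: field_simps)
qed

lemma q_scale: "q (c *\<^sub>R v) (\<lambda>i. c * a i) = \<bar>c\<bar> * q v a"
proof (cases "c = 0")
  case True
  then show ?thesis by (simp add: q_zero)
next
  case False
  have "q ((1 / c) *\<^sub>R (c *\<^sub>R v)) (\<lambda>i. (1 / c) * (c * a i)) \<le> \<bar>1 / c\<bar> * q (c *\<^sub>R v) (\<lambda>i. c * a i)"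
    using False by (intro q_scale_le) simp
  then have "\<bar>c\<bar> * q v a \<le> q (c *\<^sub>R v) (\<lambda>i. c * a i)"
    using False by (simp add: field_simps)
  with q_scale_le[OF False, of v a] show ?thesis by linarith
qed

end

lemma lookup_scaleR: "Poly_Mapping.lookup (c *\<^sub>R p) n = c * Poly_Mapping.lookup p n"
  for p :: "'i \<Rightarrow>\<^sub>0 real"
proof -
  have "finite {i. c *\<^sub>R Poly_Mapping.lookup p i \<noteq> 0}"
    by (rule finite_subset[OF _ finite_lookup[of p]]) auto
  then show ?thesis
    by (simp add: scaleR_poly_mapping_def Abs_poly_mapping_inverse)
qed

lemma lookup_sum_single:
  assumes "finite I"
  shows "Poly_Mapping.lookup (\<Sum>i\<in>I. a i *\<^sub>R Poly_Mapping.single i (1::real)) n = (if n \<in> I then a n else 0)"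
proof -
  have "Poly_Mapping.lookup (\<Sum>i\<in>I. a i *\<^sub>R Poly_Mapping.single i (1::real)) n
      = (\<Sum>i\<in>I. if n = i then a i else 0)"
    unfolding lookup_sum by (rule sum.cong) (auto simp: lookup_scaleR lookup_single when_def)
  then show ?thesis using assms by simp
qed

section \<open>The amalgam as a finite-dimensional normed space\<close>

context gluing
begin

definition base :: "'g set \<Rightarrow> ('g \<times> ('i \<Rightarrow>\<^sub>0 real)) set" where
  "base F = span ((\<lambda>v. (v, 0)) ` F)"

text \<open>No vectors are identified: the ambient space is a direct sum, and the position of the
  new vectors relative to the old ones is recorded in the norm \<open>N\<close> alone, which
  \<open>mu_ge\<close> makes definite.\<close>

definition amalgam :: "'g set \<Rightarrow> ('g \<times> ('i \<Rightarrow>\<^sub>0 real)) set" where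
  "amalgam F = span ((\<lambda>v. (v, 0)) ` F \<union> (\<lambda>i. (0, Poly_Mapping.single i 1)) ` I)"

definition N :: "'g \<times> ('i \<Rightarrow>\<^sub>0 real) \<Rightarrow> real" where
  "N x = q (fst x) (Poly_Mapping.lookup (snd x))"

lemma N_base: "N (v, 0) = norm v"
proof -
  have "Poly_Mapping.lookup (0 :: 'i \<Rightarrow>\<^sub>0 real) = (\<lambda>_. 0)" by (rule ext) simp
  then show ?thesis by (simp add: N_def q_zero)
qed

lemma fd_amalgam:
  assumes "finite F"
  shows "fd_normed_space (amalgam F) N"
proof -
  have "\<exists>S. finite S \<and> amalgam F = span S"
    unfolding amalgam_def
    by (rule exI, rule conjI[rotated], rule refl) (intro finite_UnI finite_imageI assms finite_I)
  moreover have "N (c *\<^sub>R x) = \<bar>c\<bar> * N x" for c x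
  proof -
    have "Poly_Mapping.lookup (c *\<^sub>R snd x) = (\<lambda>i. c * Poly_Mapping.lookup (snd x) i)"
      by (rule ext) (rule lookup_scaleR)
    then show ?thesis by (simp add: N_def q_scale)
  qed
  moreover have "N (x + y) \<le> N x + N y" for x y
  proof -
    have "Poly_Mapping.lookup (snd x + snd y) = (\<lambda>i. Poly_Mapping.lookup (snd x) i + Poly_Mapping.lookup (snd y) i)"
      by (rule ext) (rule lookup_add)
    then show ?thesis by (simp add: N_def q_add)
  qed
  moreover have "N x = 0 \<longleftrightarrow> x = 0" if "x \<in> amalgam F" for x
  proof
    assume 0: "N x = 0"
    have "\<rho> * (\<Sum>i\<in>I. \<bar>Poly_Mapping.lookup (snd x) i\<bar>) \<le> 0"
      using q_ge[of "Poly_Mapping.lookup (snd x)" "fst x"] 0 by (simp add: N_def)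
    then have "(\<Sum>i\<in>I. \<bar>Poly_Mapping.lookup (snd x) i\<bar>) \<le> 0"
      using rho_pos by (simp add: mult_le_0_iff)
    then have "(\<Sum>i\<in>I. \<bar>Poly_Mapping.lookup (snd x) i\<bar>) = 0"
      by (simp add: antisym sum_nonneg)
    then have in_I: "Poly_Mapping.lookup (snd x) i = 0" if "i \<in> I" for i
      using that finite_I by (simp add: sum_nonneg_eq_0_iff)
    \<comment> \<open>\<open>q_ge\<close> controls only coefficients with index in \<open>I\<close>;
      membership in the amalgam supplies that all others vanish.\<close>
    have "subspace {x :: 'g \<times> ('i \<Rightarrow>\<^sub>0 real). \<forall>i. i \<notin> I \<longrightarrow> Poly_Mapping.lookup (snd x) i = 0}"
      by (rule subspaceI) (auto simp: lookup_add lookup_scaleR)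
    then have "amalgam F \<subseteq> {x. \<forall>i. i \<notin> I \<longrightarrow> Poly_Mapping.lookup (snd x) i = 0}"
      unfolding amalgam_def by (rule span_minimal[rotated]) (auto simp: lookup_single when_def)
    with that in_I have "Poly_Mapping.lookup (snd x) i = 0" for i by blast
    then have s: "snd x = 0" by (intro poly_mapping_eqI) simp
    then have "x = (fst x, 0)" by (simp add: prod_eq_iff)
    then have "norm (fst x) = 0" using 0 N_base by metis
    with s show "x = 0" by (simp add: prod_eq_iff)
  next
    assume "x = 0"
    then show "N x = 0" using N_base[of 0] by (simp add: zero_prod_def)
  qed
  ultimately show ?thesis
    unfolding fd_normed_space_def using q_nonneg by (simp add: N_def)
qed

lemma base_eq: "base F = (\<lambda>v. (v, 0)) ` span F"
  unfolding base_def by (rule linear_span_image) (auto intro!: linearI)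

lemma base_subset: "base F \<subseteq> amalgam F"
  unfolding base_def amalgam_def by (rule span_mono) simp

lemma subspace_base: "subspace (base F)"
  by (simp add: base_def)

lemma fst_isometric_base: "isometric_embedding_on (base F) N fst"
  unfolding isometric_embedding_on_def operator_on_def base_eq inj_on_def
  by (auto simp: N_base intro!: exI[of _ 1])

lemma amalgam_mem:
  assumes "v \<in> span F"
  shows "(v, \<Sum>i\<in>I. a i *\<^sub>R Poly_Mapping.single i 1) \<in> amalgam F"
proof -
  have "(v, 0) \<in> amalgam F" using assms base_subset by (auto simp: base_eq)
  moreover have "(\<Sum>i\<in>I. a i *\<^sub>R (0 :: 'g, Poly_Mapping.single i (1::real))) \<in> amalgam F"
    unfolding amalgam_def by (intro span_sum span_scale span_base) auto
  ultimately have "(v, 0) + (\<Sum>i\<in>I. a i *\<^sub>R (0 :: 'g, Poly_Mapping.single i (1::real))) \<in> amalgam F"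
    unfolding amalgam_def by (rule span_add)
  also have "(v, 0) + (\<Sum>i\<in>I. a i *\<^sub>R (0 :: 'g, Poly_Mapping.single i (1::real))) =
      (v, \<Sum>i\<in>I. a i *\<^sub>R Poly_Mapping.single i 1)"
    by (simp add: prod_eq_iff fst_sum snd_sum)
  finally show ?thesis .
qed

lemma N_amalgam: "N (v, \<Sum>i\<in>I. a i *\<^sub>R Poly_Mapping.single i 1) = q v a"
  unfolding N_def fst_conv snd_conv by (rule q_cong) (simp add: lookup_sum_single finite_I)

lemma amalgam_cases:
  assumes "x \<in> amalgam F"
  obtains v a where "v \<in> span F" "x = (v, \<Sum>i\<in>I. a i *\<^sub>R Poly_Mapping.single i 1)"
    "\<And>i. i \<notin> I \<Longrightarrow> a i = 0"
proof -
  obtain y z where yz: "y \<in> base F" "z \<in> span ((\<lambda>i. (0, Poly_Mapping.single i 1)) ` I)" "x = y + z"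
    using assms unfolding amalgam_def base_def span_Un by blast
  obtain v where v: "v \<in> span F" "y = (v, 0)" using yz(1) by (auto simp: base_eq)
  obtain a where a: "z = (\<Sum>i\<in>I. a i *\<^sub>R (0, Poly_Mapping.single i 1))"
    using yz(2) unfolding span_family[OF finite_I] by blast
  have "x = (v, \<Sum>i\<in>I. (if i \<in> I then a i else 0) *\<^sub>R Poly_Mapping.single i 1)"
    by (simp add: yz(3) v a prod_eq_iff fst_sum snd_sum)
  from that[OF v(1) this] show thesis by simp
qed

text \<open>The vectors \<open>u' i\<close> are to be the images of the new vectors under an almost
  isometric embedding of the amalgam that fixes \<open>span F\<close>. Non-strict inequalities
  include the zero vector.\<close>

definition realizes :: "real \<Rightarrow> 'g set \<Rightarrow> ('i \<Rightarrow> 'g) \<Rightarrow> bool" where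
  "realizes e F u' \<longleftrightarrow> (\<forall>v\<in>span F. \<forall>a.
     (1 - e) * q v a \<le> norm (v + (\<Sum>i\<in>I. a i *\<^sub>R u' i)) \<and>
     norm (v + (\<Sum>i\<in>I. a i *\<^sub>R u' i)) \<le> (1 + e) * q v a)"

lemma realizes_lower:
  "realizes e F u' \<Longrightarrow> v \<in> span F \<Longrightarrow> (1 - e) * q v a \<le> norm (v + (\<Sum>i\<in>I. a i *\<^sub>R u' i))"
  and realizes_upper:
  "realizes e F u' \<Longrightarrow> v \<in> span F \<Longrightarrow> norm (v + (\<Sum>i\<in>I. a i *\<^sub>R u' i)) \<le> (1 + e) * q v a"
  by (simp_all add: realizes_def)

lemma embedding_apply:
  assumes g: "eps_isometric_embedding_on e (amalgam F) N g" "\<And>x. x \<in> base F \<Longrightarrow> g x = fst x"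
    and v: "v \<in> span F"
  shows "g (v, \<Sum>i\<in>I. a i *\<^sub>R Poly_Mapping.single i 1) =
    v + (\<Sum>i\<in>I. a i *\<^sub>R g (0, Poly_Mapping.single i 1))"
proof -
  have o: "operator_on (amalgam F) N UNIV norm g"
    using g by (simp add: eps_isometric_embedding_on_def)
  have s: "subspace (amalgam F)" by (simp add: amalgam_def)
  have m: "(0, Poly_Mapping.single i 1) \<in> amalgam F" if "i \<in> I" for i
    unfolding amalgam_def using that by (auto intro: span_base)
  have b: "(v, 0) \<in> base F" using v by (simp add: base_eq)
  have eq: "(v, \<Sum>i\<in>I. a i *\<^sub>R Poly_Mapping.single i 1) =
      (v, 0) + (\<Sum>i\<in>I. a i *\<^sub>R (0, Poly_Mapping.single i 1))"
    by (simp add: prod_eq_iff fst_sum snd_sum)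
  have "g (v, \<Sum>i\<in>I. a i *\<^sub>R Poly_Mapping.single i 1) = g (v, 0) + g (\<Sum>i\<in>I. a i *\<^sub>R (0, Poly_Mapping.single i 1))"
    unfolding eq using b base_subset
    by (intro operator_onD(2)[OF o] subspace_sum[OF s] subspace_scale[OF s] m) auto
  also have "g (\<Sum>i\<in>I. a i *\<^sub>R (0, Poly_Mapping.single i 1)) = (\<Sum>i\<in>I. a i *\<^sub>R g (0, Poly_Mapping.single i 1))"
    using m by (intro operator_on_sum[OF o s])
  finally show ?thesis unfolding g(2)[OF b] fst_conv .
qed

lemma embedding_realizes:
  assumes g: "eps_isometric_embedding_on e (amalgam F) N g" "\<And>x. x \<in> base F \<Longrightarrow> g x = fst x"
  shows "realizes e F (\<lambda>i. g (0, Poly_Mapping.single i 1))"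
  unfolding realizes_def
proof (intro ballI allI)
  fix v a assume v: "v \<in> span F"
  let ?x = "(v, \<Sum>i\<in>I. a i *\<^sub>R Poly_Mapping.single i (1::real))"
  have "(1 - e) * N ?x \<le> norm (g ?x) \<and> norm (g ?x) \<le> (1 + e) * N ?x"
  proof (cases "?x = 0")
    case True
    have "(0, 0) \<in> base F" by (auto simp: base_eq intro: span_zero image_eqI[of _ _ 0])
    then have "g 0 = 0" using g(2)[of "(0, 0)"] by (simp add: zero_prod_def)
    moreover have "N 0 = 0" using N_base[of 0] by (simp add: zero_prod_def)
    ultimately show ?thesis by (simp add: True)
  next
    case False
    then show ?thesis
      using g(1) amalgam_mem[OF v, of a] unfolding eps_isometric_embedding_on_def by (simp add: less_imp_le)
  qed
  then show "(1 - e) * q v a \<le> norm (v + (\<Sum>i\<in>I. a i *\<^sub>R g (0, Poly_Mapping.single i 1))) \<and>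
      norm (v + (\<Sum>i\<in>I. a i *\<^sub>R g (0, Poly_Mapping.single i 1))) \<le> (1 + e) * q v a"
    by (simp add: N_amalgam embedding_apply[OF g v])
qed

end

section \<open>Embedding amalgams by the Gurarii properties\<close>

lemma gurarii_space_realizes:
  fixes u :: "'k \<Rightarrow> 'g::banach"
  assumes g: "gurarii_space TYPE('g)" and "gluing I K u \<mu> \<rho>" and F: "finite F" and e: "0 < e"
  shows "\<exists>u'. gluing.realizes I K u \<mu> e F u'"
proof -
  interpret gluing I K u \<mu> \<rho> by fact
  obtain g :: "'g \<times> ('a \<Rightarrow>\<^sub>0 real) \<Rightarrow> 'g" where
    "eps_isometric_embedding_on e (amalgam F) N g" "\<forall>x\<in>base F. g x = fst x"
    using gurarii_space_extend[OF g fd_amalgam[OF F] subspace_base base_subset e fst_isometric_base] by blast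
  then show ?thesis using embedding_realizes by blast
qed

text \<open>The map between the amalgams is \<open>G\<close> on the old part and the identity on
  coefficients; \<open>le\<close> makes it nonexpansive. The old parts are embedded by inclusion,
  which commutes with \<open>G\<close>, and the Gurarii property extends this square to the new
  vectors.\<close>

lemma gurarii_operator_realizes:
  fixes G :: "'x::banach \<Rightarrow>\<^sub>L 'y::banach"
  assumes G: "gurarii_operator G" and A: "gluing I K u \<mu> \<rho>" and B: "gluing J L w \<nu> \<sigma>"
    and IJ: "I \<subseteq> J" and F: "finite F" and F': "finite F'" and GF: "\<And>v. v \<in> F \<Longrightarrow> blinfun_apply G v \<in> span F'"
    and le: "\<And>v a. (\<And>i. i \<notin> I \<Longrightarrow> a i = 0) \<Longrightarrow> gluing.q L w \<nu> (blinfun_apply G v) a \<le> gluing.q K u \<mu> v a"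
    and e: "0 < e"
  shows "\<exists>x' w'. gluing.realizes I K u \<mu> e F x' \<and> gluing.realizes J L w \<nu> e F' w' \<and>
    (\<forall>i\<in>I. blinfun_apply G (x' i) = w' i)"
proof -
  interpret A: gluing I K u \<mu> \<rho> by fact
  interpret B: gluing J L w \<nu> \<sigma> by fact
  define T :: "'x \<times> ('a \<Rightarrow>\<^sub>0 real) \<Rightarrow> 'y \<times> ('a \<Rightarrow>\<^sub>0 real)" where "T x = (blinfun_apply G (fst x), snd x)" for x
  have span: "blinfun_apply G v \<in> span F'" if "v \<in> span F" for v
  proof -
    have "blinfun_apply G ` span F = span (blinfun_apply G ` F)"
      by (intro linear_span_image[symmetric] bounded_linear.linear blinfun.bounded_linear_right)
    also have "\<dots> \<subseteq> span F'" using GF by (intro span_minimal) auto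
    finally show ?thesis using that by blast
  qed
  have T: "T x \<in> B.amalgam F' \<and> B.N (T x) \<le> A.N x" if x: "x \<in> A.amalgam F" for x
  proof -
    obtain v a where v: "v \<in> span F" "x = (v, \<Sum>i\<in>I. a i *\<^sub>R Poly_Mapping.single i 1)"
      "\<And>i. i \<notin> I \<Longrightarrow> a i = 0" by (rule A.amalgam_cases[OF x]) blast
    have "(\<Sum>i\<in>I. a i *\<^sub>R Poly_Mapping.single i (1::real)) = (\<Sum>i\<in>J. a i *\<^sub>R Poly_Mapping.single i 1)"
      using IJ B.finite_I v(3) by (intro sum.mono_neutral_left) auto
    then have *: "T x = (blinfun_apply G v, \<Sum>i\<in>J. a i *\<^sub>R Poly_Mapping.single i 1)" by (simp add: T_def v(2))
    have "A.N x = gluing.q K u \<mu> v a" unfolding v(2) by (rule A.N_amalgam)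
    moreover have "gluing.q L w \<nu> (blinfun_apply G v) a \<le> gluing.q K u \<mu> v a" by (rule le) (rule v(3))
    ultimately show ?thesis
      unfolding * B.N_amalgam by (simp add: B.amalgam_mem[OF span[OF v(1)]])
  qed
  have op: "operator_on (A.amalgam F) A.N (B.amalgam F') B.N T"
    unfolding operator_on_def using T
    by (auto simp: T_def blinfun.add_right blinfun.scaleR_right intro!: exI[of _ 1])
  have "T ` A.base F \<subseteq> B.base F'"
    using span by (auto simp: A.base_eq B.base_eq T_def)
  note ext = gurarii_operator_extend[OF G A.fd_amalgam[OF F] B.fd_amalgam[OF F'] op conjunct2[OF T]
      A.subspace_base A.base_subset B.subspace_base B.base_subset this A.fst_isometric_base B.fst_isometric_base _ e]
  have "blinfun_apply G (fst v) = fst (T v)" for v by (simp add: T_def)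
  then obtain i j where ij: "eps_isometric_embedding_on e (A.amalgam F) A.N i"
    "eps_isometric_embedding_on e (B.amalgam F') B.N j"
    "\<forall>x\<in>A.base F. i x = fst x" "\<forall>x\<in>B.base F'. j x = fst x" "\<forall>x\<in>A.amalgam F. blinfun_apply G (i x) = j (T x)"
    using ext by metis
  have "blinfun_apply G (i (0, Poly_Mapping.single k 1)) = j (0, Poly_Mapping.single k 1)" if "k \<in> I" for k
  proof -
    have "(0, Poly_Mapping.single k 1) \<in> A.amalgam F"
      unfolding A.amalgam_def using that by (auto intro: span_base)
    then show ?thesis using ij(5) by (simp add: T_def)
  qed
  then have "\<forall>k\<in>I. blinfun_apply G (i (0, Poly_Mapping.single k 1)) = j (0, Poly_Mapping.single k 1)"
    by blast
  moreover have "A.realizes e F (\<lambda>k. i (0, Poly_Mapping.single k 1))"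
    by (rule A.embedding_realizes[OF ij(1)]) (use ij(3) in blast)
  moreover have "B.realizes e F' (\<lambda>k. j (0, Poly_Mapping.single k 1))"
    by (rule B.embedding_realizes[OF ij(2)]) (use ij(4) in blast)
  ultimately show ?thesis
    by (intro exI[of _ "\<lambda>k. i (0, Poly_Mapping.single k 1)"] exI[of _ "\<lambda>k. j (0, Poly_Mapping.single k 1)"] conjI)
qed

section \<open>Extending operators to the whole space\<close>

lemma span_insertE:
  assumes "z \<in> span (insert y P)"
  obtains t z0 where "z0 \<in> span P" "z = z0 + t *\<^sub>R y"
proof -
  from assms obtain t where "z - t *\<^sub>R y \<in> span P" by (auto simp: span_breakdown_eq)
  then show thesis by (rule that[where t = t]) simp
qed

text \<open>\<open>D\<close> bounds the coordinate functional of \<open>v\<close>, so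
  \<open>1 / D\<close> is a lower bound for the distance from \<open>v\<close> to
  \<open>span F\<close>. It comes from \<open>coefficient_bound\<close> for a basis of
  \<open>span F\<close> together with \<open>v\<close>.\<close>

lemma outside_span_bound:
  fixes v :: "'v::real_normed_vector"
  assumes F: "finite F" and v: "v \<notin> span F"
  shows "\<exists>D>0. \<forall>x\<in>span F. \<forall>t. \<bar>t\<bar> \<le> D * norm (x + t *\<^sub>R v)"
proof -
  obtain B where B: "B \<subseteq> F" "independent B" "F \<subseteq> span B"
    using maximal_independent_subset[of F] by blast
  have fB: "finite B" using B(1) F by (rule finite_subset)
  have sp: "span B = span F"
    using B span_mono[OF B(1)] span_minimal[OF B(3) subspace_span] by blast
  have vB: "v \<notin> B" using v sp span_base by metis
  have ind: "independent (insert v B)"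
    using v sp B(2) by (simp add: independent_insert)
  have "\<exists>D>0. \<forall>a. (\<Sum>w\<in>insert v B. \<bar>a w\<bar>) \<le> D * norm (\<Sum>w\<in>insert v B. a w *\<^sub>R w)"
    using fB ind by (intro coefficient_bound) (auto dest: independentD)
  then obtain D where D: "D > 0" "\<And>a. (\<Sum>w\<in>insert v B. \<bar>a w\<bar>) \<le> D * norm (\<Sum>w\<in>insert v B. a w *\<^sub>R w)"
    by blast
  have "\<bar>t\<bar> \<le> D * norm (x + t *\<^sub>R v)" if x: "x \<in> span F" for x t
  proof -
    have "x \<in> range (\<lambda>a. \<Sum>w\<in>B. a w *\<^sub>R w)" using x by (simp only: sp[symmetric] span_finite[OF fB])
    then obtain a where a: "x = (\<Sum>w\<in>B. a w *\<^sub>R w)" by blast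
    define a' where "a' = a(v := t)"
    have "(\<Sum>w\<in>B. a' w *\<^sub>R w) = x" unfolding a
      using vB by (intro sum.cong) (auto simp: a'_def)
    moreover have "a' v = t" by (simp add: a'_def)
    ultimately have "(\<Sum>w\<in>insert v B. a' w *\<^sub>R w) = x + t *\<^sub>R v"
      using fB vB by simp
    moreover have "\<bar>t\<bar> \<le> (\<Sum>w\<in>insert v B. \<bar>a' w\<bar>)"
      using member_le_sum[of v "insert v B" "\<lambda>w. \<bar>a' w\<bar>"] fB by (simp add: a'_def)
    ultimately show ?thesis using D(2)[of a'] by simp
  qed
  then show ?thesis using D(1) by blast
qed

lemma sum_scaleR_pair:
  "(\<Sum>p\<in>P. b p *\<^sub>R p) = (\<Sum>p\<in>P. b p *\<^sub>R fst p, \<Sum>p\<in>P. b p *\<^sub>R snd p)"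
  for b :: "'a::real_vector \<times> 'b::real_vector \<Rightarrow> real"
  by (simp add: prod_eq_iff fst_sum snd_sum)

text \<open>
  The operator with graph \<open>span P\<close> is extended to one new vector \<open>v\<close> by pushing out: its image is
  glued to a new vector along the graph, and the amalgam is embedded back over the old image.
\<close>

lemma extend_graph_step:
  fixes P :: "('x::real_normed_vector \<times> 'g::banach) set"
  assumes g: "gurarii_space TYPE('g)" and P: "finite P"
    and le: "\<And>z. z \<in> span P \<Longrightarrow> norm (snd z) \<le> c * norm (fst z)" and c: "0 \<le> c" "c < c'"
  shows "\<exists>w. \<forall>z\<in>span (insert (v, w) P). norm (snd z) \<le> c' * norm (fst z)"
proof (cases "v \<in> fst ` span P")
  case True
  then obtain w where w: "(v, w) \<in> span P" by force
  have "norm (snd z) \<le> c' * norm (fst z)" if "z \<in> span (insert (v, w) P)" for z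
  proof -
    have "norm (snd z) \<le> c * norm (fst z)" using that w by (intro le) (simp add: span_redundant)
    also have "\<dots> \<le> c' * norm (fst z)" using c by (intro mult_right_mono) auto
    finally show ?thesis .
  qed
  then show ?thesis by blast
next
  case False
  have span_fst: "fst ` span P = span (fst ` P)"
    by (rule linear_span_image[OF linear_fst, symmetric])
  have span_snd: "snd ` span P = span (snd ` P)"
    by (rule linear_span_image[OF linear_snd, symmetric])
  obtain D where D: "D > 0" "\<And>z t. z \<in> span P \<Longrightarrow> \<bar>t\<bar> \<le> D * norm (fst z + t *\<^sub>R v)"
    using outside_span_bound[of "fst ` P" v] P False span_fst by (metis finite_imageI imageI)
  \<comment> \<open>The penalty \<open>\<rho>\<close> makes the amalgam norm definite. As
    \<open>D\<close> controls the coefficient of \<open>v\<close>, it raises the bound only from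
    \<open>c\<close> to \<open>(c + c') / 2\<close>; the factor \<open>1 + e\<close> of the
    embedding then leads exactly to \<open>c'\<close>.\<close>
  define \<rho> where "\<rho> = (c' - c) / (2 * D)"
  have rho: "0 < \<rho>" using c D by (simp add: \<rho>_def)
  have half: "c + \<rho> * D = (c + c') / 2" using D by (simp add: \<rho>_def field_simps)
  define e where "e = (c' - c) / (c + c')"
  have e: "0 < e" "(1 + e) * ((c + c') / 2) = c'" using c by (auto simp: e_def field_simps)
  define \<mu> where "\<mu> a b = c * norm (a 0 *\<^sub>R v + (\<Sum>p\<in>P. b p *\<^sub>R fst p)) + \<rho> * \<bar>a 0\<bar>"
    for a :: "nat \<Rightarrow> real" and b
  \<comment> \<open>The minus sign lets a shift by the coefficients of a graph element subtract its
    second component from the old part while its first component is added to the multiple of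
    \<open>v\<close>.\<close>
  have "gluing {0::nat} P (\<lambda>p. - snd p) \<mu> \<rho>"
  proof
    fix a a' :: "nat \<Rightarrow> real" and b b' :: "'x \<times> 'g \<Rightarrow> real" and r :: real
    show "\<mu> a b = \<mu> a' b" if "\<And>i. i \<in> {0} \<Longrightarrow> a i = a' i"
      using that by (simp add: \<mu>_def)
    have eq: "(a 0 + a' 0) *\<^sub>R v + (\<Sum>p\<in>P. (b p + b' p) *\<^sub>R fst p) =
        (a 0 *\<^sub>R v + (\<Sum>p\<in>P. b p *\<^sub>R fst p)) + (a' 0 *\<^sub>R v + (\<Sum>p\<in>P. b' p *\<^sub>R fst p))"
      by (simp add: scaleR_add_left sum.distrib)
    have "norm ((a 0 + a' 0) *\<^sub>R v + (\<Sum>p\<in>P. (b p + b' p) *\<^sub>R fst p)) \<le>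
        norm (a 0 *\<^sub>R v + (\<Sum>p\<in>P. b p *\<^sub>R fst p)) + norm (a' 0 *\<^sub>R v + (\<Sum>p\<in>P. b' p *\<^sub>R fst p))"
      unfolding eq by (rule norm_triangle_ineq)
    from mult_left_mono[OF this c(1)] mult_left_mono[OF abs_triangle_ineq[of "a 0" "a' 0"], of \<rho>] rho
    show "\<mu> (\<lambda>i. a i + a' i) (\<lambda>k. b k + b' k) \<le> \<mu> a b + \<mu> a' b'"
      by (simp add: \<mu>_def distrib_left)
    have "(r * a 0) *\<^sub>R v + (\<Sum>p\<in>P. (r * b p) *\<^sub>R fst p) = r *\<^sub>R (a 0 *\<^sub>R v + (\<Sum>p\<in>P. b p *\<^sub>R fst p))"
      by (simp add: scaleR_add_right scaleR_sum_right)
    then have "norm ((r * a 0) *\<^sub>R v + (\<Sum>p\<in>P. (r * b p) *\<^sub>R fst p)) =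
        \<bar>r\<bar> * norm (a 0 *\<^sub>R v + (\<Sum>p\<in>P. b p *\<^sub>R fst p))" by simp
    then show "\<mu> (\<lambda>i. r * a i) (\<lambda>k. r * b k) = \<bar>r\<bar> * \<mu> a b"
      by (simp add: \<mu>_def abs_mult algebra_simps)
    have "(\<Sum>p\<in>P. b p *\<^sub>R p) \<in> span P" by (intro span_sum span_scale span_base)
    from le[OF this] show "norm (\<Sum>p\<in>P. b p *\<^sub>R - snd p) \<le> \<mu> (\<lambda>_. 0) b"
      by (simp add: \<mu>_def sum_scaleR_pair sum_negf)
    show "\<rho> * (\<Sum>i\<in>{0}. \<bar>a i\<bar>) \<le> \<mu> a b" using c by (simp add: \<mu>_def)
  qed (use rho in auto)
  then interpret gluing "{0::nat}" P "\<lambda>p. - snd p" \<mu> \<rho> .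
  obtain w' where w': "realizes e (snd ` P) w'"
    using gurarii_space_realizes[OF g gluing_axioms _ e(1), of "snd ` P"] P by blast
  have "norm (snd z) \<le> c' * norm (fst z)" if z: "z \<in> span (insert (v, w' 0) P)" for z
  proof -
    obtain t z0 where z0: "z0 \<in> span P" "z = z0 + t *\<^sub>R (v, w' 0)"
      using z by (rule span_insertE)
    have "z0 \<in> range (\<lambda>b. \<Sum>p\<in>P. b p *\<^sub>R p)" using z0(1) by (simp only: span_finite[OF P])
    then obtain b where b: "z0 = (\<Sum>p\<in>P. b p *\<^sub>R p)" by blast
    have "snd z0 \<in> span (snd ` P)" using z0(1) span_snd by blast
    then have "norm (snd z0 + (\<Sum>i\<in>{0}. t *\<^sub>R w' i)) \<le> (1 + e) * q (snd z0) (\<lambda>_. t)"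
      by (rule realizes_upper[OF w'])
    \<comment> \<open>Shifting by the coefficients of \<open>z0\<close> itself cancels the old part,
      so that only the cost \<open>\<mu>\<close> of the vector \<open>fst z\<close> remains.\<close>
    also have "\<dots> \<le> (1 + e) * (norm (snd z0 + (\<Sum>p\<in>P. b p *\<^sub>R - snd p)) + \<mu> (\<lambda>_. t) b)"
      using e by (intro mult_left_mono q_le) auto
    also have "norm (snd z0 + (\<Sum>p\<in>P. b p *\<^sub>R - snd p)) + \<mu> (\<lambda>_. t) b =
        c * norm (fst z) + \<rho> * \<bar>t\<bar>"
      by (simp add: z0(2) b \<mu>_def sum_scaleR_pair sum_negf add.commute)
    also have "\<dots> \<le> c * norm (fst z) + \<rho> * (D * norm (fst z))"
      using D(2)[OF z0(1), of t] rho by (simp add: z0(2))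
    also have "\<dots> = (c + c') / 2 * norm (fst z)" by (simp add: half[symmetric] algebra_simps)
    finally show ?thesis
      using e(1,2) by (simp add: z0(2) mult.assoc[symmetric])
  qed
  then show ?thesis by blast
qed

lemma extend_operator:
  fixes P :: "('x::real_normed_vector \<times> 'g::banach) set" and d :: "nat \<Rightarrow> 'x"
  assumes d: "closure (range d) = UNIV" and g: "gurarii_space TYPE('g)" and P: "finite P"
    and le: "\<And>z. z \<in> span P \<Longrightarrow> norm (snd z) \<le> c * norm (fst z)" and c: "0 \<le> c" "c < c'"
  shows "\<exists>G :: 'x \<Rightarrow>\<^sub>L 'g. norm G \<le> c' \<and> (\<forall>z\<in>P. blinfun_apply G (fst z) = snd z)"
proof -
  \<comment> \<open>Every one-vector step needs a strictly larger bound, so each step spends half of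
    the remaining gap and all graphs stay below \<open>c'\<close>.\<close>
  define C where "C n = c' - (c' - c) / 2 ^ n" for n :: nat
  have C: "0 \<le> C n" "C n < C (Suc n)" "C n \<le> c'" for n
  proof -
    have "(c' - c) / 2 ^ n \<le> (c' - c) / 1" using c by (intro divide_left_mono) auto
    then show "0 \<le> C n" using c by (simp add: C_def)
    have "(c' - c) / 2 ^ Suc n < (c' - c) / 2 ^ n" using c by (intro divide_strict_left_mono) auto
    then show "C n < C (Suc n)" by (simp add: C_def)
    show "C n \<le> c'" using c by (simp add: C_def)
  qed
  have "\<exists>S. \<forall>n. (finite (S n) \<and> P \<subseteq> S n \<and> (\<forall>z\<in>span (S n). norm (snd z) \<le> C n * norm (fst z))) \<and>
     (S n \<subseteq> S (Suc n) \<and> d n \<in> fst ` S (Suc n))"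
  proof (rule dependent_nat_choice)
    show "\<exists>S. finite S \<and> P \<subseteq> S \<and> (\<forall>z\<in>span S. norm (snd z) \<le> C 0 * norm (fst z))"
      using P le by (intro exI[of _ P]) (simp add: C_def)
  next
    fix S n assume S: "finite S \<and> P \<subseteq> S \<and> (\<forall>z\<in>span S. norm (snd z) \<le> C n * norm (fst z))"
    then obtain w where "\<forall>z\<in>span (insert (d n, w) S). norm (snd z) \<le> C (Suc n) * norm (fst z)"
      using extend_graph_step[OF g, of S "C n" "C (Suc n)" "d n"] C by blast
    then show "\<exists>S'. (finite S' \<and> P \<subseteq> S' \<and> (\<forall>z\<in>span S'. norm (snd z) \<le> C (Suc n) * norm (fst z))) \<and>
        S \<subseteq> S' \<and> d n \<in> fst ` S'"
      using S by (intro exI[of _ "insert (d n, w) S"]) auto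
  qed
  then obtain S where S: "\<And>n. P \<subseteq> S n" "\<And>n z. z \<in> span (S n) \<Longrightarrow> norm (snd z) \<le> C n * norm (fst z)"
    "\<And>n. S n \<subseteq> S (Suc n)" "\<And>n. d n \<in> fst ` S (Suc n)"
    by blast
  define Z where "Z = (\<Union>n. span (S n))"
  have mono: "span (S m) \<subseteq> span (S n)" if "m \<le> n" for m n
    using lift_Suc_mono_le[of S, OF S(3) that] by (rule span_mono)
  have "subspace Z"
  proof (rule subspaceI)
    show "0 \<in> Z" by (auto simp: Z_def span_zero)
    fix x y assume "x \<in> Z" "y \<in> Z"
    then obtain m n where "x \<in> span (S m)" "y \<in> span (S n)" by (auto simp: Z_def)
    then have "x \<in> span (S (max m n))" "y \<in> span (S (max m n))"
      using mono[of m "max m n"] mono[of n "max m n"] by auto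
    then show "x + y \<in> Z" unfolding Z_def by (auto intro: span_add)
  qed (auto simp: Z_def intro: span_scale)
  moreover have "norm (snd z) \<le> c' * norm (fst z)" if z: "z \<in> Z" for z
  proof -
    obtain n where "z \<in> span (S n)" using z by (auto simp: Z_def)
    then have "norm (snd z) \<le> C n * norm (fst z)" by (rule S(2))
    also have "\<dots> \<le> c' * norm (fst z)" using C(3) by (intro mult_right_mono) auto
    finally show ?thesis .
  qed
  moreover have "closure (fst ` Z) = UNIV"
  proof -
    have "d n \<in> fst ` Z" for n using S(4)[of n] by (auto simp: Z_def image_iff intro: span_base)
    then have "range d \<subseteq> fst ` Z" by blast
    from closure_mono[OF this] show ?thesis using d by blast
  qed
  moreover have "0 \<le> c'" using c by linarith
  ultimately obtain G where G: "norm G \<le> c'" "\<forall>z\<in>Z. blinfun_apply G (fst z) = snd z"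
    using graph_blinfun by blast
  moreover have "P \<subseteq> Z" using S(1)[of 0] by (auto simp: Z_def intro: span_base)
  ultimately show ?thesis by blast
qed

section \<open>Approximate extension problems for finite families\<close>

text \<open>An additive error weighted by the l1 norm of the coefficients survives small
  perturbations of the vectors, by \<open>norm_sum_perturb\<close>, even if the family is linearly
  dependent; a relative error would not.\<close>

definition almost_nonexpansive ::
  "real \<Rightarrow> 'i set \<Rightarrow> ('i \<Rightarrow> 'x::real_normed_vector) \<Rightarrow> ('i \<Rightarrow> 'y::real_normed_vector) \<Rightarrow> bool" where
  "almost_nonexpansive \<eta> I x w \<longleftrightarrow>
     (\<forall>a. norm (\<Sum>i\<in>I. a i *\<^sub>R w i) \<le> norm (\<Sum>i\<in>I. a i *\<^sub>R x i) + \<eta> * (\<Sum>i\<in>I. \<bar>a i\<bar>))"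

lemma almost_nonexpansiveD:
  "almost_nonexpansive \<eta> I x w \<Longrightarrow>
    norm (\<Sum>i\<in>I. a i *\<^sub>R w i) \<le> norm (\<Sum>i\<in>I. a i *\<^sub>R x i) + \<eta> * (\<Sum>i\<in>I. \<bar>a i\<bar>)"
  by (simp add: almost_nonexpansive_def)

definition almost_isometric :: "real \<Rightarrow> 'i set \<Rightarrow> ('i \<Rightarrow> 'x::real_normed_vector) \<Rightarrow> ('i \<Rightarrow> 'x) \<Rightarrow> bool" where
  "almost_isometric \<delta> I x x' \<longleftrightarrow>
     (\<forall>a. \<bar>norm (\<Sum>i\<in>I. a i *\<^sub>R x' i) - norm (\<Sum>i\<in>I. a i *\<^sub>R x i)\<bar> \<le> \<delta> * (\<Sum>i\<in>I. \<bar>a i\<bar>))"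

definition compatible where
  "compatible \<eta> G I K x w \<longleftrightarrow>
     almost_nonexpansive \<eta> I x w \<and> (\<forall>i\<in>K. norm (blinfun_apply G (x i) - w i) \<le> \<eta>)"

text \<open>
  Indices in \<open>K\<close> and \<open>L\<close> mark the vectors that play the role of the subspaces \<open>A\<^sub>0\<close> and \<open>B\<^sub>0\<close> in
  the definition of a Gurarii operator; \<open>w i\<close> is the image of \<open>x i\<close> for \<open>i \<in> I\<close>.
\<close>

definition solvable where
  "solvable \<delta> G I J K L x w \<longleftrightarrow>
     (\<exists>x' w'. (\<forall>i\<in>I. w' i = blinfun_apply G (x' i)) \<and> almost_isometric \<delta> I x x' \<and> almost_isometric \<delta> J w w' \<and>
        (\<forall>i\<in>K. norm (x' i - x i) \<le> \<delta>) \<and> (\<forall>j\<in>L. norm (w' j - w j) \<le> \<delta>))"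

lemma norm_sum_perturb:
  fixes x x' :: "'i \<Rightarrow> 'x::real_normed_vector"
  assumes "\<And>i. i \<in> I \<Longrightarrow> norm (x' i - x i) \<le> \<theta>"
  shows "norm ((\<Sum>i\<in>I. a i *\<^sub>R x' i) - (\<Sum>i\<in>I. a i *\<^sub>R x i)) \<le> \<theta> * (\<Sum>i\<in>I. \<bar>a i\<bar>)"
proof -
  have "(\<Sum>i\<in>I. a i *\<^sub>R x' i) - (\<Sum>i\<in>I. a i *\<^sub>R x i) = (\<Sum>i\<in>I. a i *\<^sub>R (x' i - x i))"
    by (simp add: scaleR_diff_right sum_subtractf)
  also have "norm \<dots> \<le> (\<Sum>i\<in>I. \<bar>a i\<bar> * \<theta>)"
    using assms by (intro sum_norm_le) (simp add: mult_left_mono)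
  finally show ?thesis by (simp add: sum_distrib_left mult.commute)
qed

lemma norm_sum_scaleR_le:
  fixes x :: "'i \<Rightarrow> 'x::real_normed_vector"
  assumes "finite I"
  shows "norm (\<Sum>i\<in>I. a i *\<^sub>R x i) \<le> (\<Sum>i\<in>I. norm (x i)) * (\<Sum>i\<in>I. \<bar>a i\<bar>)"
  using norm_sum_perturb[of I x "\<lambda>_. 0" "\<Sum>i\<in>I. norm (x i)" a] member_le_sum[of _ I "\<lambda>i. norm (x i)"] assms
  by simp

lemma almost_isometric_trans:
  assumes "almost_isometric \<delta> I x y" "\<And>i. i \<in> I \<Longrightarrow> norm (z i - y i) \<le> \<theta>"
  shows "almost_isometric (\<delta> + \<theta>) I x z"
  unfolding almost_isometric_def
proof
  fix a
  have "\<bar>norm (\<Sum>i\<in>I. a i *\<^sub>R y i) - norm (\<Sum>i\<in>I. a i *\<^sub>R x i)\<bar> \<le> \<delta> * (\<Sum>i\<in>I. \<bar>a i\<bar>)"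
    using assms(1) by (simp add: almost_isometric_def)
  moreover have "norm ((\<Sum>i\<in>I. a i *\<^sub>R z i) - (\<Sum>i\<in>I. a i *\<^sub>R y i)) \<le> \<theta> * (\<Sum>i\<in>I. \<bar>a i\<bar>)"
    by (rule norm_sum_perturb[OF assms(2)])
  then have "\<bar>norm (\<Sum>i\<in>I. a i *\<^sub>R z i) - norm (\<Sum>i\<in>I. a i *\<^sub>R y i)\<bar> \<le> \<theta> * (\<Sum>i\<in>I. \<bar>a i\<bar>)"
    using norm_triangle_ineq3 order_trans by blast
  ultimately show "\<bar>norm (\<Sum>i\<in>I. a i *\<^sub>R z i) - norm (\<Sum>i\<in>I. a i *\<^sub>R x i)\<bar> \<le> (\<delta> + \<theta>) * (\<Sum>i\<in>I. \<bar>a i\<bar>)"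
    unfolding distrib_right by linarith
qed

lemma almost_isometric_mono: "almost_isometric \<delta> I x x' \<Longrightarrow> \<delta> \<le> \<delta>' \<Longrightarrow> almost_isometric \<delta>' I x x'"
  using almost_isometric_trans[of \<delta> I x x' x' "\<delta>' - \<delta>"] by simp

lemma almost_isometric_sym: "almost_isometric \<delta> I x x' \<Longrightarrow> almost_isometric \<delta> I x' x"
  by (simp add: almost_isometric_def abs_minus_commute)

text \<open>Commutation up to \<open>\<theta>\<close> is enough: for \<open>i \<in> I\<close> the
  vector \<open>w' i\<close> is replaced by the exact image of \<open>x' i\<close>, and the triangle
  inequality charges \<open>\<theta>\<close> to the conditions on \<open>w'\<close>.\<close>

lemma solvableI:
  assumes x: "almost_isometric \<delta> I x x'" and w: "almost_isometric \<delta> J w w'"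
    and K: "\<And>i. i \<in> K \<Longrightarrow> norm (x' i - x i) \<le> \<delta>" and L: "\<And>j. j \<in> L \<Longrightarrow> norm (w' j - w j) \<le> \<delta>"
    and G: "\<And>i. i \<in> I \<Longrightarrow> norm (blinfun_apply G (x' i) - w' i) \<le> \<theta>" and \<theta>: "0 \<le> \<theta>"
  shows "solvable (\<delta> + \<theta>) G I J K L x w"
proof -
  define w'' where "w'' i = (if i \<in> I then blinfun_apply G (x' i) else w' i)" for i
  have w'': "norm (w'' i - w' i) \<le> \<theta>" for i
    using G \<theta> by (simp add: w''_def)
  have "norm (w'' j - w j) \<le> \<delta> + \<theta>" if "j \<in> L" for j
    using norm_triangle_ineq[of "w'' j - w' j" "w' j - w j"] w''[of j] L[OF that] by simp
  moreover have "norm (x' i - x i) \<le> \<delta> + \<theta>" if "i \<in> K" for i using K[OF that] \<theta> by simp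
  moreover have "almost_isometric (\<delta> + \<theta>) I x x'" using x by (rule almost_isometric_mono) (use \<theta> in simp)
  ultimately show ?thesis
    unfolding solvable_def
    by (intro exI[of _ x'] exI[of _ w'']) (simp add: w''_def[of i for i] almost_isometric_trans[OF w w''])
qed

lemma solvable_mono:
  assumes "solvable \<delta> G I J K L x w" "\<delta> \<le> \<delta>'"
  shows "solvable \<delta>' G I J K L x w"
proof -
  obtain x' w' where "\<forall>i\<in>I. w' i = blinfun_apply G (x' i)" "almost_isometric \<delta> I x x'" "almost_isometric \<delta> J w w'"
    "\<forall>i\<in>K. norm (x' i - x i) \<le> \<delta>" "\<forall>j\<in>L. norm (w' j - w j) \<le> \<delta>"
    using assms(1) unfolding solvable_def by (elim exE conjE) (rule that)
  then have "solvable (\<delta> + (\<delta>' - \<delta>)) G I J K L x w"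
    using assms(2) by (intro solvableI[of _ _ _ x' _ _ w']) auto
  then show ?thesis by simp
qed

text \<open>Let \<open>e i\<close> be a new copy of \<open>u i\<close>. With this cost,
  \<open>q\<close> splits \<open>v + (\<Sum>i\<in>I. a i *\<^sub>R e i)\<close> into an old vector,
  a combination of copies normed like the originals, and multiples of \<open>e k - u k\<close> for
  \<open>k \<in> K\<close> at price \<open>\<eta>\<close> per unit. Hence the copy of a marked
  vector stays near its original. The \<open>\<rho>\<close> term makes the norm definite.\<close>

definition family_cost :: "'i set \<Rightarrow> 'i set \<Rightarrow> ('i \<Rightarrow> 'x::real_normed_vector) \<Rightarrow> real \<Rightarrow> real \<Rightarrow>
    ('i \<Rightarrow> real) \<Rightarrow> ('i \<Rightarrow> real) \<Rightarrow> real" where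
  "family_cost I K u \<eta> \<rho> a b =
     norm ((\<Sum>i\<in>I. a i *\<^sub>R u i) - (\<Sum>k\<in>K. b k *\<^sub>R u k)) + \<eta> * (\<Sum>k\<in>K. \<bar>b k\<bar>) + \<rho> * (\<Sum>i\<in>I. \<bar>a i\<bar>)"

lemma gluing_family_cost:
  assumes I: "finite I" and \<eta>: "0 \<le> \<eta>" and \<rho>: "0 < \<rho>"
  shows "gluing I K u (family_cost I K u \<eta> \<rho>) \<rho>"
proof
  fix a a' b b' :: "'a \<Rightarrow> real" and r :: real
  show "family_cost I K u \<eta> \<rho> a b = family_cost I K u \<eta> \<rho> a' b" if "\<And>i. i \<in> I \<Longrightarrow> a i = a' i"
    using that by (simp add: family_cost_def)
  have eq: "(\<Sum>i\<in>I. (a i + a' i) *\<^sub>R u i) - (\<Sum>k\<in>K. (b k + b' k) *\<^sub>R u k) =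
      ((\<Sum>i\<in>I. a i *\<^sub>R u i) - (\<Sum>k\<in>K. b k *\<^sub>R u k)) + ((\<Sum>i\<in>I. a' i *\<^sub>R u i) - (\<Sum>k\<in>K. b' k *\<^sub>R u k))"
    by (simp add: scaleR_add_left sum.distrib)
  have tri: "(\<Sum>i\<in>S. \<bar>c i + c' i\<bar>) \<le> (\<Sum>i\<in>S. \<bar>c i\<bar>) + (\<Sum>i\<in>S. \<bar>c' i\<bar>)" for S and c c' :: "'a \<Rightarrow> real"
    unfolding sum.distrib[symmetric] by (intro sum_mono abs_triangle_ineq)
  have "norm ((\<Sum>i\<in>I. (a i + a' i) *\<^sub>R u i) - (\<Sum>k\<in>K. (b k + b' k) *\<^sub>R u k)) \<le>
      norm ((\<Sum>i\<in>I. a i *\<^sub>R u i) - (\<Sum>k\<in>K. b k *\<^sub>R u k)) + norm ((\<Sum>i\<in>I. a' i *\<^sub>R u i) - (\<Sum>k\<in>K. b' k *\<^sub>R u k))"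
    unfolding eq by (rule norm_triangle_ineq)
  moreover have "\<eta> * (\<Sum>k\<in>K. \<bar>b k + b' k\<bar>) \<le> \<eta> * (\<Sum>k\<in>K. \<bar>b k\<bar>) + \<eta> * (\<Sum>k\<in>K. \<bar>b' k\<bar>)"
    using mult_left_mono[OF tri \<eta>] by (simp add: distrib_left)
  moreover have "\<rho> * (\<Sum>i\<in>I. \<bar>a i + a' i\<bar>) \<le> \<rho> * (\<Sum>i\<in>I. \<bar>a i\<bar>) + \<rho> * (\<Sum>i\<in>I. \<bar>a' i\<bar>)"
    using mult_left_mono[OF tri less_imp_le[OF \<rho>]] by (simp add: distrib_left)
  ultimately show "family_cost I K u \<eta> \<rho> (\<lambda>i. a i + a' i) (\<lambda>k. b k + b' k) \<le>
      family_cost I K u \<eta> \<rho> a b + family_cost I K u \<eta> \<rho> a' b'"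
    unfolding family_cost_def by linarith
  have "(\<Sum>i\<in>I. (r * a i) *\<^sub>R u i) - (\<Sum>k\<in>K. (r * b k) *\<^sub>R u k) =
      r *\<^sub>R ((\<Sum>i\<in>I. a i *\<^sub>R u i) - (\<Sum>k\<in>K. b k *\<^sub>R u k))"
    by (simp add: scaleR_diff_right scaleR_sum_right)
  moreover have "(\<Sum>i\<in>S. \<bar>r * c i\<bar>) = \<bar>r\<bar> * (\<Sum>i\<in>S. \<bar>c i\<bar>)" for S and c :: "'a \<Rightarrow> real"
    by (simp add: abs_mult sum_distrib_left)
  ultimately show "family_cost I K u \<eta> \<rho> (\<lambda>i. r * a i) (\<lambda>k. r * b k) = \<bar>r\<bar> * family_cost I K u \<eta> \<rho> a b"
    by (simp add: family_cost_def distrib_left mult.left_commute)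
  show "norm (\<Sum>k\<in>K. b k *\<^sub>R u k) \<le> family_cost I K u \<eta> \<rho> (\<lambda>_. 0) b"
    using \<eta> by (simp add: family_cost_def sum_nonneg)
  show "\<rho> * (\<Sum>i\<in>I. \<bar>a i\<bar>) \<le> family_cost I K u \<eta> \<rho> a b"
    using \<eta> by (simp add: family_cost_def sum_nonneg)
qed (use assms in auto)

text \<open>By the triangle inequality \<open>q 0 a\<close> is at least the norm of the original
  combination, and it exceeds this norm by at most the \<open>\<rho>\<close> penalty. The bound
  \<open>\<sigma>\<close> converts the relative error \<open>e\<close> of the embedding into an
  additive one.\<close>

lemma realizes_family:
  fixes u u' :: "'i \<Rightarrow> 'x::real_normed_vector"
  assumes I: "finite I" "K \<subseteq> I" and \<eta>: "0 \<le> \<eta>" and \<rho>: "0 < \<rho>"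
    and e: "0 < e" "e \<le> 1" "e * (\<Sum>i\<in>I. norm (u i)) \<le> \<sigma>"
    and u': "gluing.realizes I K u (family_cost I K u \<eta> \<rho>) e F u'" and uF: "\<And>i. i \<in> K \<Longrightarrow> u i \<in> span F"
  shows "almost_isometric (\<sigma> + 2 * \<rho>) I u u'" "\<And>i. i \<in> K \<Longrightarrow> norm (u' i - u i) \<le> 2 * (\<eta> + \<rho>)"
proof -
  interpret gluing I K u "family_cost I K u \<eta> \<rho>" \<rho>
    by (rule gluing_family_cost[OF I(1) \<eta> \<rho>])
  show "almost_isometric (\<sigma> + 2 * \<rho>) I u u'"
    unfolding almost_isometric_def
  proof
    fix a :: "'i \<Rightarrow> real"
    define S where "S = (\<Sum>i\<in>I. \<bar>a i\<bar>)"
    define n where "n = norm (\<Sum>i\<in>I. a i *\<^sub>R u i)"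
    have S: "0 \<le> S" by (simp add: S_def sum_nonneg)
    have "e * n \<le> e * ((\<Sum>i\<in>I. norm (u i)) * S)"
      unfolding n_def S_def by (intro mult_left_mono norm_sum_scaleR_le I) (use e in simp)
    also have "\<dots> \<le> \<sigma> * S"
      using mult_right_mono[OF e(3) S] by (simp add: mult.assoc)
    finally have en: "e * n \<le> \<sigma> * S" .
    have "q 0 a \<le> n + \<rho> * S"
      using q_le[of 0 a "\<lambda>_. 0"] by (simp add: family_cost_def n_def S_def)
    moreover have "n \<le> q 0 a"
    proof (rule q_greatest)
      fix b
      have "n \<le> norm ((\<Sum>i\<in>I. a i *\<^sub>R u i) - (\<Sum>k\<in>K. b k *\<^sub>R u k)) + norm (\<Sum>k\<in>K. b k *\<^sub>R u k)"
        unfolding n_def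
        using norm_triangle_ineq[of "(\<Sum>i\<in>I. a i *\<^sub>R u i) - (\<Sum>k\<in>K. b k *\<^sub>R u k)" "\<Sum>k\<in>K. b k *\<^sub>R u k"] by simp
      moreover have "0 \<le> \<eta> * (\<Sum>k\<in>K. \<bar>b k\<bar>)" "0 \<le> \<rho> * (\<Sum>i\<in>I. \<bar>a i\<bar>)"
        using \<eta> \<rho> by (simp_all add: sum_nonneg)
      ultimately show "n \<le> norm (0 + (\<Sum>k\<in>K. b k *\<^sub>R u k)) + family_cost I K u \<eta> \<rho> a b"
        unfolding family_cost_def add_0_left by linarith
    qed
    ultimately have q: "n \<le> q 0 a" "q 0 a \<le> n + \<rho> * S" by auto
    have "norm (\<Sum>i\<in>I. a i *\<^sub>R u' i) \<le> (1 + e) * q 0 a"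
      using realizes_upper[OF u' span_zero, of a] by simp
    also have "\<dots> \<le> (1 + e) * (n + \<rho> * S)"
      using q(2) e by (intro mult_left_mono) auto
    also have "\<dots> = n + e * n + (1 + e) * (\<rho> * S)" by (simp add: algebra_simps)
    also have "\<dots> \<le> n + \<sigma> * S + 2 * (\<rho> * S)"
      using en e \<rho> S by (intro add_mono mult_right_mono) auto
    finally have up: "norm (\<Sum>i\<in>I. a i *\<^sub>R u' i) - n \<le> (\<sigma> + 2 * \<rho>) * S" by (simp add: algebra_simps)
    have "n - \<sigma> * S \<le> (1 - e) * n" using en by (simp add: algebra_simps)
    also have "\<dots> \<le> (1 - e) * q 0 a" using q(1) e by (intro mult_left_mono) auto
    also have "\<dots> \<le> norm (\<Sum>i\<in>I. a i *\<^sub>R u' i)"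
      using realizes_lower[OF u' span_zero, of a] by simp
    finally have "n - norm (\<Sum>i\<in>I. a i *\<^sub>R u' i) \<le> \<sigma> * S" by simp
    also have "\<dots> \<le> (\<sigma> + 2 * \<rho>) * S" using \<rho> S by (intro mult_right_mono) auto
    finally have "n - norm (\<Sum>i\<in>I. a i *\<^sub>R u' i) \<le> (\<sigma> + 2 * \<rho>) * S" .
    with up show "\<bar>norm (\<Sum>i\<in>I. a i *\<^sub>R u' i) - norm (\<Sum>i\<in>I. a i *\<^sub>R u i)\<bar> \<le> (\<sigma> + 2 * \<rho>) * (\<Sum>i\<in>I. \<bar>a i\<bar>)"
      unfolding n_def S_def by linarith
  qed
  show "norm (u' i - u i) \<le> 2 * (\<eta> + \<rho>)" if i: "i \<in> K" for i
  proof -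
    define d where "d = (\<lambda>j. if j = i then 1 else 0 :: real)"
    have fK: "finite K" using I finite_subset by blast
    have iI: "i \<in> I" using i I by blast
    have d: "(\<Sum>j\<in>S. d j *\<^sub>R y j) = y i" "(\<Sum>j\<in>S. \<bar>d j\<bar>) = 1" if "finite S" "i \<in> S"
      for S and y :: "'i \<Rightarrow> 'x"
    proof -
      show "(\<Sum>j\<in>S. d j *\<^sub>R y j) = y i" unfolding d_def using sum_scaleR_if[OF that, of 1 y] by simp
      have "(\<Sum>j\<in>S. \<bar>d j\<bar>) = (\<Sum>j\<in>S. if j = i then 1 else 0)" by (rule sum.cong) (auto simp: d_def)
      then show "(\<Sum>j\<in>S. \<bar>d j\<bar>) = 1" using that by simp
    qed
    \<comment> \<open>The difference of a copy and its original costs at most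
      \<open>\<eta> + \<rho>\<close>: with the unit coefficients \<open>d\<close> for both
      parameters of the cost, both norms vanish and only the penalties remain.\<close>
    have "norm (u' i - u i) = norm (- u i + (\<Sum>j\<in>I. d j *\<^sub>R u' j))"
      by (simp add: d I iI)
    also have "\<dots> \<le> (1 + e) * q (- u i) d"
      by (rule realizes_upper[OF u']) (use uF[OF i] in \<open>rule span_neg\<close>)
    also have "\<dots> \<le> (1 + e) * (\<eta> + \<rho>)"
      using q_le[of "- u i" d d] e(1) i iI I fK by (intro mult_left_mono) (simp_all add: family_cost_def d)
    also have "\<dots> \<le> 2 * (\<eta> + \<rho>)" using e \<eta> \<rho> by (intro mult_right_mono) auto
    finally show ?thesis .
  qed
qed

text \<open>
  Beyond the penalties on the left, the constants on the right absorb the defect of \<open>G (x i) = w i\<close>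
  for \<open>i \<in> K\<close> and the defect of nonexpansiveness of \<open>x i \<mapsto> w i\<close> on the coefficients \<open>a - b\<close>.
\<close>

lemma family_cost_nonexpansive:
  fixes G :: "'x::real_normed_vector \<Rightarrow>\<^sub>L 'y::real_normed_vector" and I :: "'i set"
  assumes G: "norm G \<le> 1" and comp: "compatible \<eta> G I K x w" and \<eta>: "0 < \<eta>"
    and J: "finite J" "K \<subseteq> I" "I \<subseteq> J" "K \<subseteq> L" "L \<subseteq> J" and a: "\<And>i. i \<notin> I \<Longrightarrow> a i = 0"
  shows "gluing.q L w (family_cost J L w \<eta> \<eta>) (blinfun_apply G v) a \<le>
    gluing.q K x (family_cost I K x (3 * \<eta>) (2 * \<eta>)) v a"
proof -
  have fI: "finite I" using J(3,1) by (rule finite_subset)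
  have fL: "finite L" using J(5,1) by (rule finite_subset)
  interpret A: gluing I K x "family_cost I K x (3 * \<eta>) (2 * \<eta>)" "2 * \<eta>"
    using \<eta> fI by (intro gluing_family_cost) auto
  interpret B: gluing J L w "family_cost J L w \<eta> \<eta>" \<eta>
    using \<eta> J by (intro gluing_family_cost) auto
  show ?thesis
  proof (rule A.q_greatest)
    fix b :: "'i \<Rightarrow> real"
    \<comment> \<open>Extended by 0 from \<open>K\<close> to \<open>L\<close>, the shift of the
      source amalgam becomes a shift of the target amalgam.\<close>
    define b' :: "'i \<Rightarrow> real" where "b' k = (if k \<in> K then b k else 0)" for k
    have b': "(\<Sum>k\<in>S. b' k *\<^sub>R y k) = (\<Sum>k\<in>K. b k *\<^sub>R y k)" "(\<Sum>k\<in>S. \<bar>b' k\<bar>) = (\<Sum>k\<in>K. \<bar>b k\<bar>)"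
      if "finite S" "K \<subseteq> S" for S and y :: "'i \<Rightarrow> 'z::real_vector"
      using that by (intro sum.mono_neutral_cong_right; auto simp: b'_def)+
    have aJ: "(\<Sum>i\<in>J. a i *\<^sub>R w i) = (\<Sum>i\<in>I. a i *\<^sub>R w i)" "(\<Sum>i\<in>J. \<bar>a i\<bar>) = (\<Sum>i\<in>I. \<bar>a i\<bar>)"
      using J a by (intro sum.mono_neutral_right; auto)+
    define s where "s = (\<Sum>k\<in>K. \<bar>b k\<bar>)"
    define t where "t = (\<Sum>i\<in>I. \<bar>a i\<bar>)"
    have 1: "norm (blinfun_apply G v + (\<Sum>k\<in>K. b k *\<^sub>R w k)) \<le> norm (v + (\<Sum>k\<in>K. b k *\<^sub>R x k)) + \<eta> * s"
    proof -
      have "norm ((\<Sum>k\<in>K. b k *\<^sub>R w k) - (\<Sum>k\<in>K. b k *\<^sub>R blinfun_apply G (x k))) \<le> \<eta> * s"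
        unfolding s_def using comp by (intro norm_sum_perturb) (simp add: compatible_def norm_minus_commute)
      moreover have "blinfun_apply G (v + (\<Sum>k\<in>K. b k *\<^sub>R x k)) =
          blinfun_apply G v + (\<Sum>k\<in>K. b k *\<^sub>R blinfun_apply G (x k))"
        by (simp add: blinfun.add_right blinfun.sum_right blinfun.scaleR_right)
      moreover have "norm (blinfun_apply G (v + (\<Sum>k\<in>K. b k *\<^sub>R x k))) \<le> 1 * norm (v + (\<Sum>k\<in>K. b k *\<^sub>R x k))"
        by (rule order_trans[OF norm_blinfun]) (use G in \<open>rule mult_right_mono\<close>, simp)
      ultimately show ?thesis
        using norm_triangle_ineq[of "blinfun_apply G v + (\<Sum>k\<in>K. b k *\<^sub>R blinfun_apply G (x k))"
          "(\<Sum>k\<in>K. b k *\<^sub>R w k) - (\<Sum>k\<in>K. b k *\<^sub>R blinfun_apply G (x k))"] by simp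
    qed
    have 2: "norm ((\<Sum>i\<in>I. a i *\<^sub>R w i) - (\<Sum>k\<in>K. b k *\<^sub>R w k)) \<le>
        norm ((\<Sum>i\<in>I. a i *\<^sub>R x i) - (\<Sum>k\<in>K. b k *\<^sub>R x k)) + \<eta> * t + \<eta> * s"
    proof -
      have diff: "(\<Sum>i\<in>I. (a i - b' i) *\<^sub>R y i) = (\<Sum>i\<in>I. a i *\<^sub>R y i) - (\<Sum>k\<in>K. b k *\<^sub>R y k)"
        for y :: "'i \<Rightarrow> 'z::real_vector"
        using b'(1)[OF fI J(2), of y] by (simp add: scaleR_diff_left sum_subtractf)
      have "(\<Sum>i\<in>I. \<bar>a i - b' i\<bar>) \<le> t + s"
      proof -
        have "(\<Sum>i\<in>I. \<bar>a i - b' i\<bar>) \<le> (\<Sum>i\<in>I. \<bar>a i\<bar> + \<bar>b' i\<bar>)" by (intro sum_mono abs_triangle_ineq4)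
        also have "\<dots> = t + s" using b'(2)[OF fI J(2)] by (simp add: sum.distrib s_def t_def)
        finally show ?thesis .
      qed
      from mult_left_mono[OF this less_imp_le[OF \<eta>]]
      have "\<eta> * (\<Sum>i\<in>I. \<bar>a i - b' i\<bar>) \<le> \<eta> * t + \<eta> * s" by (simp add: distrib_left)
      moreover have "norm (\<Sum>i\<in>I. (a i - b' i) *\<^sub>R w i) \<le>
          norm (\<Sum>i\<in>I. (a i - b' i) *\<^sub>R x i) + \<eta> * (\<Sum>i\<in>I. \<bar>a i - b' i\<bar>)"
        using comp by (intro almost_nonexpansiveD) (simp add: compatible_def)
      ultimately show ?thesis unfolding diff by linarith
    qed
    have "B.q (blinfun_apply G v) a \<le>
        norm (blinfun_apply G v + (\<Sum>k\<in>L. b' k *\<^sub>R w k)) + family_cost J L w \<eta> \<eta> a b'"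
      by (rule B.q_le)
    also have "\<dots> = norm (blinfun_apply G v + (\<Sum>k\<in>K. b k *\<^sub>R w k)) +
        norm ((\<Sum>i\<in>I. a i *\<^sub>R w i) - (\<Sum>k\<in>K. b k *\<^sub>R w k)) + \<eta> * s + \<eta> * t"
      by (simp add: family_cost_def b'(1)[OF fL J(4)] b'(2)[OF fL J(4)] aJ s_def t_def)
    \<comment> \<open>To the target penalties \<open>\<eta> * s + \<eta> * t\<close>, fact 1 adds
      \<open>\<eta> * s\<close> and fact 2 adds \<open>\<eta> * t + \<eta> * s\<close>. The total is
      the source penalty, which explains the constants 3 and 2.\<close>
    also have "\<dots> \<le> norm (v + (\<Sum>k\<in>K. b k *\<^sub>R x k)) + family_cost I K x (3 * \<eta>) (2 * \<eta>) a b"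
      using 1 2 unfolding family_cost_def s_def[symmetric] t_def[symmetric] by linarith
    finally show "B.q (blinfun_apply G v) a \<le>
        norm (v + (\<Sum>k\<in>K. b k *\<^sub>R x k)) + family_cost I K x (3 * \<eta>) (2 * \<eta>) a b" .
  qed
qed

section \<open>Solving approximate extension problems by amalgams\<close>

lemma small_factor:
  assumes "0 < \<eta>" "0 \<le> s"
  shows "\<exists>e::real>0. e \<le> 1 / 2 \<and> e * s \<le> \<eta>"
proof (intro exI conjI)
  show "0 < min (1 / 2) (\<eta> / (1 + s))" "min (1 / 2) (\<eta> / (1 + s)) \<le> 1 / 2"
    using assms by simp (rule min.cobounded1)
  have "min (1 / 2) (\<eta> / (1 + s)) * s \<le> \<eta> / (1 + s) * s" using assms by (intro mult_right_mono) auto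
  also have "\<dots> \<le> \<eta>" using assms by (simp add: field_simps)
  finally show "min (1 / 2) (\<eta> / (1 + s)) * s \<le> \<eta>" .
qed

text \<open>The constant 10 comes from the marked source vectors, which move by at most
  \<open>2 * (3 * \<eta> + 2 * \<eta>)\<close>. The other three errors are
  \<open>5 * \<eta>\<close>, \<open>3 * \<eta>\<close> and \<open>4 * \<eta>\<close>.\<close>

lemma realizes_family_pair:
  fixes I :: "'i set" and x x' :: "'i \<Rightarrow> 'x::real_normed_vector" and w w' :: "'i \<Rightarrow> 'y::real_normed_vector"
  assumes \<eta>: "0 < \<eta>" and J: "finite J" "K \<subseteq> I" "I \<subseteq> J" "L \<subseteq> J"
    and e: "0 < e" "e \<le> 1 / 2" "e * ((\<Sum>i\<in>I. norm (x i)) + (\<Sum>j\<in>J. norm (w j))) \<le> \<eta>"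
    and F: "\<And>i. i \<in> I \<Longrightarrow> x i \<in> span F" "\<And>j. j \<in> J \<Longrightarrow> w j \<in> span F'"
    and x': "gluing.realizes I K x (family_cost I K x (3 * \<eta>) (2 * \<eta>)) e F x'"
    and w': "gluing.realizes J L w (family_cost J L w \<eta> \<eta>) e F' w'"
  shows "almost_isometric (10 * \<eta>) I x x'" "almost_isometric (10 * \<eta>) J w w'"
    "\<And>i. i \<in> K \<Longrightarrow> norm (x' i - x i) \<le> 10 * \<eta>" "\<And>j. j \<in> L \<Longrightarrow> norm (w' j - w j) \<le> 10 * \<eta>"
proof -
  have "e * (\<Sum>i\<in>I. norm (x i)) \<le> e * ((\<Sum>i\<in>I. norm (x i)) + (\<Sum>j\<in>J. norm (w j)))"
    "e * (\<Sum>j\<in>J. norm (w j)) \<le> e * ((\<Sum>i\<in>I. norm (x i)) + (\<Sum>j\<in>J. norm (w j)))"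
    using e(1) by (auto intro!: mult_left_mono sum_nonneg)
  then have eI: "e * (\<Sum>i\<in>I. norm (x i)) \<le> \<eta>" and eJ: "e * (\<Sum>j\<in>J. norm (w j)) \<le> \<eta>"
    using e(3) by linarith+
  have fI: "finite I" using J(3,1) by (rule finite_subset)
  have "almost_isometric (\<eta> + 2 * (2 * \<eta>)) I x x'"
    by (rule realizes_family(1)[OF fI J(2) _ _ e(1) _ eI x']) (use \<eta> e F J in auto)
  then show "almost_isometric (10 * \<eta>) I x x'" by (rule almost_isometric_mono) (use \<eta> in simp)
  have "almost_isometric (\<eta> + 2 * \<eta>) J w w'"
    by (rule realizes_family(1)[OF J(1,4) _ _ e(1) _ eJ w']) (use \<eta> e F J in auto)
  then show "almost_isometric (10 * \<eta>) J w w'" by (rule almost_isometric_mono) (use \<eta> in simp)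
  show "norm (x' i - x i) \<le> 10 * \<eta>" if "i \<in> K" for i
  proof -
    have "norm (x' i - x i) \<le> 2 * (3 * \<eta> + 2 * \<eta>)"
      by (rule realizes_family(2)[OF fI J(2) _ _ e(1) _ eI x' _ that]) (use \<eta> e F J in auto)
    then show ?thesis by simp
  qed
  show "norm (w' j - w j) \<le> 10 * \<eta>" if "j \<in> L" for j
  proof -
    have "norm (w' j - w j) \<le> 2 * (\<eta> + \<eta>)"
      by (rule realizes_family(2)[OF J(1,4) _ _ e(1) _ eJ w' _ that]) (use \<eta> e F J in auto)
    then show ?thesis using \<eta> by simp
  qed
qed

text \<open>The square of amalgams over \<open>G\<close> embeds with exact commutation, so
  \<open>solvableI\<close> applies with \<open>\<theta> = 0\<close> and the error of the amalgams is
  the only one.\<close>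

lemma gurarii_operator_solvable:
  fixes G :: "'x::banach \<Rightarrow>\<^sub>L 'y::banach" and I :: "'i set"
  assumes G: "gurarii_operator G" and comp: "compatible \<eta> G I K x w" and \<eta>: "0 < \<eta>"
    and J: "finite J" "K \<subseteq> I" "I \<subseteq> J" "K \<subseteq> L" "L \<subseteq> J"
  shows "solvable (10 * \<eta>) G I J K L x w"
proof -
  have fI: "finite I" using J(3,1) by (rule finite_subset)
  have "0 \<le> (\<Sum>i\<in>I. norm (x i)) + (\<Sum>j\<in>J. norm (w j))" by (simp add: sum_nonneg)
  from small_factor[OF \<eta> this] obtain e where
    e: "0 < e" "e \<le> 1 / 2" "e * ((\<Sum>i\<in>I. norm (x i)) + (\<Sum>j\<in>J. norm (w j))) \<le> \<eta>" by blast
  define F where "F = x ` I"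
  define F' where "F' = blinfun_apply G ` F \<union> w ` J"
  have "\<exists>x' w'. gluing.realizes I K x (family_cost I K x (3 * \<eta>) (2 * \<eta>)) e F x' \<and>
      gluing.realizes J L w (family_cost J L w \<eta> \<eta>) e F' w' \<and> (\<forall>i\<in>I. blinfun_apply G (x' i) = w' i)"
  proof (rule gurarii_operator_realizes[OF G _ _ J(3) _ _ _ _ e(1)])
    show "gluing I K x (family_cost I K x (3 * \<eta>) (2 * \<eta>)) (2 * \<eta>)"
      "gluing J L w (family_cost J L w \<eta> \<eta>) \<eta>"
      using \<eta> fI J(1) by (auto intro!: gluing_family_cost)
    show "finite F" "finite F'" using fI J(1) by (auto simp: F_def F'_def)
    show "blinfun_apply G v \<in> span F'" if "v \<in> F" for v using that by (auto simp: F'_def intro!: span_base)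
    show "gluing.q L w (family_cost J L w \<eta> \<eta>) (blinfun_apply G v) a \<le>
        gluing.q K x (family_cost I K x (3 * \<eta>) (2 * \<eta>)) v a" if "\<And>i. i \<notin> I \<Longrightarrow> a i = 0" for v a
      using G by (intro family_cost_nonexpansive[OF _ comp \<eta> J that]) (auto simp: gurarii_operator_def)
  qed
  then obtain x' w' where x': "gluing.realizes I K x (family_cost I K x (3 * \<eta>) (2 * \<eta>)) e F x'"
    and w': "gluing.realizes J L w (family_cost J L w \<eta> \<eta>) e F' w'"
    and Gx': "\<forall>i\<in>I. blinfun_apply G (x' i) = w' i"
    by blast
  have F: "x i \<in> span F" if "i \<in> I" for i using that by (auto simp: F_def intro: span_base)
  have F': "w j \<in> span F'" if "j \<in> J" for j using that by (auto simp: F'_def intro: span_base)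
  note c = realizes_family_pair[OF \<eta> J(1,2,3,5) e F F' x' w']
  have "solvable (10 * \<eta> + 0) G I J K L x w"
    by (rule solvableI[OF c]) (use Gx' in auto)
  then show ?thesis by simp
qed

text \<open>\<open>G0\<close> is not assumed to be Gurarii, so the two amalgams are embedded
  independently. Commutation is achieved by prescription: the new operator agrees with
  \<open>G0\<close> on \<open>F\<close> and sends \<open>x' i\<close> to \<open>w' i\<close>. Its
  norm may slightly exceed 1; the extra \<open>\<eta> / 2\<close> pays for rescaling it.\<close>

lemma solvable_dense:
  fixes G0 :: "'x::banach \<Rightarrow>\<^sub>L 'y::banach" and I :: "'i set"
  assumes d: "closure (range (d :: nat \<Rightarrow> 'x)) = UNIV"
    and g: "gurarii_space TYPE('x)" "gurarii_space TYPE('y)"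
    and G0: "norm G0 \<le> 1" and comp: "compatible \<eta> G0 I K x w" and \<eta>: "0 < \<eta>"
    and J: "finite J" "K \<subseteq> I" "I \<subseteq> J" "K \<subseteq> L" "L \<subseteq> J"
    and V: "finite V" and r: "0 < r"
  shows "\<exists>G. norm G \<le> 1 \<and> (\<forall>v\<in>V. norm (blinfun_apply G v - blinfun_apply G0 v) < r) \<and>
    solvable (10 * \<eta> + \<eta> / 2) G I J K L x w"
proof -
  have fI: "finite I" using J(3,1) by (rule finite_subset)
  define S where "S = (\<Sum>i\<in>I. norm (x i)) + (\<Sum>j\<in>J. norm (w j))"
  \<comment> \<open>\<open>M\<close> bounds the norms of \<open>G0 v\<close> for
    \<open>v \<in> V\<close> and of \<open>w' i\<close> for \<open>i \<in> I\<close>, the values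
    that rescaling must hardly move; \<open>10 * \<eta>\<close> accounts for the passage from
    \<open>w i\<close> to \<open>w' i\<close>.\<close>
  define M where "M = (\<Sum>v\<in>V. norm v) + S + 10 * \<eta>"
  have S0: "0 \<le> S" and M0: "0 \<le> M" using \<eta> by (simp_all add: S_def M_def sum_nonneg)
  define \<theta> where "\<theta> = min (\<eta> / 2) (r / 2)"
  have \<theta>: "0 < \<theta>" "\<theta> \<le> \<eta> / 2" "\<theta> \<le> r / 2" using \<eta> r by (auto simp: \<theta>_def)
  have "0 \<le> S + 5 * M" using S0 M0 by simp
  \<comment> \<open>Through \<open>S\<close> this keeps the embedding errors on the families below
    \<open>\<eta>\<close>, and through \<open>5 * M\<close> the rescaling errors below
    \<open>\<theta>\<close>.\<close>
  from small_factor[OF \<theta>(1) this] obtain e where e: "0 < e" "e \<le> 1 / 2" "e * (S + 5 * M) \<le> \<theta>" by blast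
  have "0 \<le> e * S" "0 \<le> e * (5 * M)" using e S0 M0 by simp_all
  then have eS: "e * S \<le> \<eta>" and eM: "5 * e * M \<le> \<theta>"
    using e(3) \<theta> \<eta> unfolding distrib_left by linarith+
  define F where "F = V \<union> x ` I"
  define F' where "F' = blinfun_apply G0 ` F \<union> w ` J"
  have fF: "finite F" "finite F'" using fI J(1) V by (auto simp: F_def F'_def)
  interpret A: gluing I K x "family_cost I K x (3 * \<eta>) (2 * \<eta>)" "2 * \<eta>"
    using \<eta> fI by (intro gluing_family_cost) auto
  interpret B: gluing J L w "family_cost J L w \<eta> \<eta>" \<eta>
    using \<eta> J by (intro gluing_family_cost) auto
  obtain x' where x': "A.realizes e F x'"
    using gurarii_space_realizes[OF g(1) A.gluing_axioms fF(1) e(1)] by blast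
  obtain w' where w': "B.realizes e F' w'"
    using gurarii_space_realizes[OF g(2) B.gluing_axioms fF(2) e(1)] by blast
  have F: "x i \<in> span F" if "i \<in> I" for i using that by (auto simp: F_def intro: span_base)
  have F': "w j \<in> span F'" if "j \<in> J" for j using that by (auto simp: F'_def intro: span_base)
  note c = realizes_family_pair[OF \<eta> J(1,2,3,5) e(1,2) eS[unfolded S_def] F F' x' w']

  define P where "P = (\<lambda>v. (v, blinfun_apply G0 v)) ` F \<union> (\<lambda>i. (x' i, w' i)) ` I"
  \<comment> \<open>The numerator is the upper estimate in the target, the denominator the lower
    estimate in the source; between them stands the nonexpansive map of the amalgams.\<close>
  define C where "C = (1 + e) / (1 - e)"
  have P: "norm (snd z) \<le> C * norm (fst z)" if z: "z \<in> span P" for z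
  proof -
    obtain z1 z2 where z12: "z1 \<in> span ((\<lambda>v. (v, blinfun_apply G0 v)) ` F)"
      "z2 \<in> span ((\<lambda>i. (x' i, w' i)) ` I)" "z = z1 + z2"
      using z unfolding P_def span_Un by blast
    have "span ((\<lambda>v. (v, blinfun_apply G0 v)) ` F) = (\<lambda>v. (v, blinfun_apply G0 v)) ` span F"
      by (rule linear_span_image) (auto intro!: linearI simp: blinfun.add_right blinfun.scaleR_right)
    then obtain v where v: "v \<in> span F" "z1 = (v, blinfun_apply G0 v)" using z12(1) by blast
    obtain a0 where a0: "z2 = (\<Sum>i\<in>I. a0 i *\<^sub>R (x' i, w' i))"
      using z12(2) unfolding span_family[OF fI] by blast
    define a where "a i = (if i \<in> I then a0 i else 0)" for i
    have z2: "z2 = (\<Sum>i\<in>I. a i *\<^sub>R x' i, \<Sum>i\<in>I. a i *\<^sub>R w' i)"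
      by (simp add: a0 a_def prod_eq_iff fst_sum snd_sum)
    have aJ: "(\<Sum>j\<in>J. a j *\<^sub>R w' j) = (\<Sum>i\<in>I. a i *\<^sub>R w' i)"
      using J by (intro sum.mono_neutral_right) (auto simp: a_def)
    have "blinfun_apply G0 v \<in> span F'"
    proof -
      have "blinfun_apply G0 ` span F = span (blinfun_apply G0 ` F)"
        by (intro linear_span_image[symmetric] bounded_linear.linear blinfun.bounded_linear_right)
      also have "\<dots> \<subseteq> span F'" by (intro span_mono) (simp add: F'_def)
      finally show ?thesis using v(1) by blast
    qed
    from B.realizes_upper[OF w' this, of a]
    have "norm (snd z) \<le> (1 + e) * B.q (blinfun_apply G0 v) a"
      by (simp add: aJ z12(3) v(2) z2)
    also have "\<dots> \<le> (1 + e) * A.q v a"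
      using e by (intro mult_left_mono family_cost_nonexpansive[OF G0 comp \<eta> J]) (auto simp: a_def)
    also have "\<dots> = C * ((1 - e) * A.q v a)" using e by (simp add: C_def)
    also have "\<dots> \<le> C * norm (fst z)"
    proof (rule mult_left_mono)
      show "(1 - e) * A.q v a \<le> norm (fst z)"
        using A.realizes_lower[OF x' v(1), of a] by (simp add: z12(3) v(2) z2)
      show "0 \<le> C" using e by (simp add: C_def)
    qed
    finally show ?thesis .
  qed
  \<comment> \<open>\<open>extend_operator\<close> needs a bound strictly above \<open>C\<close>.
    For \<open>e \<le> 1 / 2\<close> this one suffices, and division by it has relative error at
    most \<open>5 * e\<close>.\<close>
  define C' where "C' = 1 + 5 * e"
  have "0 \<le> C" using e by (simp add: C_def)
  moreover have "C < C'"
  proof -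
    have "C' * (1 - e) - (1 + e) = e * (3 - 5 * e)" by (simp add: C'_def algebra_simps)
    moreover have "0 < e * (3 - 5 * e)" using e by simp
    ultimately have "1 + e < C' * (1 - e)" by linarith
    then show ?thesis using e by (simp add: C_def divide_less_eq)
  qed
  moreover have "finite P" using fF fI by (simp add: P_def)
  ultimately obtain H :: "'x \<Rightarrow>\<^sub>L 'y" where H: "norm H \<le> C'" "\<forall>z\<in>P. blinfun_apply H (fst z) = snd z"
    using extend_operator[OF d g(2) _ P] by blast
  have HF: "blinfun_apply H v = blinfun_apply G0 v" if "v \<in> F" for v
    using H(2)[rule_format, of "(v, blinfun_apply G0 v)"] that by (simp add: P_def)
  have HI: "blinfun_apply H (x' i) = w' i" if "i \<in> I" for i
    using H(2)[rule_format, of "(x' i, w' i)"] that by (simp add: P_def)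
  define G where "G = (1 / C') *\<^sub>R H"
  have C': "0 < C'" "1 \<le> C'" using e by (simp_all add: C'_def)
  have diff: "norm (blinfun_apply G v - blinfun_apply H v) \<le> 5 * e * norm (blinfun_apply H v)" for v
  proof -
    have "blinfun_apply G v - blinfun_apply H v = (1 / C' - 1) *\<^sub>R blinfun_apply H v"
      by (simp add: G_def blinfun.scaleR_left scaleR_diff_left)
    then have "norm (blinfun_apply G v - blinfun_apply H v) = \<bar>1 / C' - 1\<bar> * norm (blinfun_apply H v)" by simp
    also have "\<bar>1 / C' - 1\<bar> \<le> 5 * e"
    proof -
      have "1 - 1 / C' \<le> 5 * e"
      proof -
        have "1 - 1 / C' = (C' - 1) / C'" using C' by (simp add: field_simps)
        also have "\<dots> \<le> (C' - 1) / 1" using C' by (intro divide_left_mono) auto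
        finally show ?thesis by (simp add: C'_def)
      qed
      moreover have "1 / C' \<le> 1" using C' by simp
      ultimately show ?thesis by linarith
    qed
    finally show ?thesis by (simp add: mult_right_mono)
  qed
  have "norm G \<le> 1" using H(1) C' by (simp add: G_def divide_le_eq)
  moreover have "norm (blinfun_apply G v - blinfun_apply G0 v) < r" if v: "v \<in> V" for v
  proof -
    have eq: "blinfun_apply H v = blinfun_apply G0 v" using v by (intro HF) (simp add: F_def)
    have "norm (blinfun_apply G0 v) \<le> norm G0 * norm v" by (rule norm_blinfun)
    also have "\<dots> \<le> 1 * norm v" using G0 by (rule mult_right_mono) simp
    also have "\<dots> \<le> M"
      using member_le_sum[of v V norm] V v S0 \<eta> by (simp add: M_def)
    finally have "5 * e * norm (blinfun_apply G0 v) \<le> 5 * e * M" using e by (intro mult_left_mono) auto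
    with diff[of v] eM \<theta> r show ?thesis unfolding eq by linarith
  qed
  moreover have "solvable (10 * \<eta> + \<theta>) G I J K L x w"
  proof (rule solvableI[OF c])
    fix i assume i: "i \<in> I"
    then have iJ: "i \<in> J" using J by blast
    have "norm (w' i) \<le> norm (w i) + 10 * \<eta>"
    proof -
      define a where "a = (\<lambda>j. if j = i then 1 else 0 :: real)"
      have *: "(\<Sum>j\<in>J. a j *\<^sub>R y j) = y i" for y :: "'i \<Rightarrow> 'y"
        unfolding a_def using sum_scaleR_if[OF J(1) iJ, of 1 y] by simp
      have "(\<Sum>j\<in>J. \<bar>a j\<bar>) = (\<Sum>j\<in>J. if j = i then 1 else 0)" by (rule sum.cong) (auto simp: a_def)
      then have "(\<Sum>j\<in>J. \<bar>a j\<bar>) = 1" using J(1) iJ by simp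
      then have "\<bar>norm (w' i) - norm (w i)\<bar> \<le> 10 * \<eta>"
        using c(2)[unfolded almost_isometric_def, rule_format, of a] by (simp add: *)
      then show ?thesis by linarith
    qed
    also have "\<dots> \<le> M"
      using member_le_sum[of i J "\<lambda>j. norm (w j)"] iJ J(1) by (simp add: M_def S_def sum_nonneg add_increasing)
    finally have "5 * e * norm (w' i) \<le> 5 * e * M" using e by (intro mult_left_mono) auto
    with diff[of "x' i"] eM show "norm (blinfun_apply G (x' i) - w' i) \<le> \<theta>" unfolding HI[OF i] by linarith
  qed (use \<theta> in auto)
  then have "solvable (10 * \<eta> + \<eta> / 2) G I J K L x w" by (rule solvable_mono) (use \<theta> in simp)
  ultimately show ?thesis by blast
qed

section \<open>From approximate to exact extensions\<close>

text \<open>The tolerance \<open>\<eta>\<close> has to be known before the families: when an exact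
  problem is solved, the almost isometric embeddings that produce \<open>x\<close> and
  \<open>w\<close> are themselves chosen in terms of \<open>\<eta>\<close>.\<close>

definition approximately_gurarii :: "('x::real_normed_vector \<Rightarrow>\<^sub>L 'y::real_normed_vector) \<Rightarrow> bool" where
  "approximately_gurarii G \<longleftrightarrow> (\<forall>\<tau>>0. \<exists>\<eta>>0. \<forall>(I :: nat set) J K L x w.
     finite J \<and> K \<subseteq> I \<and> I \<subseteq> J \<and> K \<subseteq> L \<and> L \<subseteq> J \<and> compatible \<eta> G I K x w \<longrightarrow> solvable \<tau> G I J K L x w)"

text \<open>Successive approximation, as in the open mapping theorem.\<close>

lemma surjective_of_almost_surjective:
  fixes G :: "'x::banach \<Rightarrow>\<^sub>L 'y::banach"
  assumes "\<And>y. \<exists>x. norm x \<le> 2 * norm y \<and> norm (y - blinfun_apply G x) \<le> norm y / 2"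
  shows "\<exists>x. blinfun_apply G x = y \<and> norm x \<le> 4 * norm y"
proof -
  from assms obtain f where f: "\<And>y. norm (f y) \<le> 2 * norm y"
    "\<And>y. norm (y - blinfun_apply G (f y)) \<le> norm y / 2" by metis
  define r where "r n = ((\<lambda>z. z - blinfun_apply G (f z)) ^^ n) y" for n
  have r0: "r 0 = y" and rS: "r (Suc n) = r n - blinfun_apply G (f (r n))" for n by (simp_all add: r_def)
  have r: "norm (r n) \<le> norm y * (1 / 2) ^ n" for n
  proof (induction n)
    case 0 then show ?case by (simp add: r0)
  next
    case (Suc n)
    then show ?case using f(2)[of "r n"] by (simp add: rS)
  qed
  have fr: "norm (f (r n)) \<le> 2 * norm y * (1 / 2) ^ n" for n
    using f(1)[of "r n"] r[of n] by simp
  have sg: "(\<lambda>n. 2 * norm y * (1 / 2 :: real) ^ n) sums (2 * norm y * 2)"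
    using sums_mult[OF geometric_sums[of "1 / 2 :: real"], of "2 * norm y"] by simp
  have sum: "summable (\<lambda>n. f (r n))"
    by (rule summable_comparison_test'[OF sums_summable[OF sg], of 0]) (use fr in auto)
  have "norm (suminf (\<lambda>n. f (r n))) \<le> suminf (\<lambda>n. 2 * norm y * (1 / 2 :: real) ^ n)"
    by (rule norm_suminf_le[OF fr sums_summable[OF sg]])
  then have n: "norm (suminf (\<lambda>n. f (r n))) \<le> 4 * norm y" using sums_unique[OF sg] by simp
  have "r \<longlonglongrightarrow> 0"
  proof (rule Lim_null_comparison)
    show "\<forall>\<^sub>F n in sequentially. norm (r n) \<le> norm y * (1 / 2) ^ n" using r by simp
    show "(\<lambda>n. norm y * (1 / 2 :: real) ^ n) \<longlonglongrightarrow> 0"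
      by (intro tendsto_mult_right_zero LIMSEQ_realpow_zero) auto
  qed
  then have "(\<lambda>n. r n - r (Suc n)) sums (r 0 - 0)" by (rule telescope_sums')
  then have "(\<lambda>n. blinfun_apply G (f (r n))) sums y" by (simp add: rS r0)
  moreover have "(\<lambda>n. blinfun_apply G (f (r n))) sums blinfun_apply G (suminf (\<lambda>n. f (r n)))"
    by (intro bounded_linear.sums[OF blinfun.bounded_linear_right] summable_sums sum)
  ultimately have "blinfun_apply G (suminf (\<lambda>n. f (r n))) = y" by (rule sums_unique2[symmetric])
  with n show ?thesis by blast
qed

lemma gurarii_space_unit_vector:
  assumes "gurarii_space TYPE('g::banach)"
  shows "\<exists>x::'g. norm x = 1"
proof -
  have V: "fd_normed_space (UNIV :: real set) abs"
    unfolding fd_normed_space_def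
    by (auto intro!: exI[of _ "{1}"] simp: span_singleton abs_mult)
  have "isometric_embedding_on {0::real} abs (\<lambda>_. 0 :: 'g)"
    by (simp add: isometric_embedding_on_def operator_on_def)
  then obtain f :: "real \<Rightarrow> 'g" where "eps_isometric_embedding_on 1 UNIV abs f"
    using gurarii_space_extend[OF assms V, of "{0}" 1 "\<lambda>_. 0"] by auto
  then have "0 < norm (f 1)" unfolding eps_isometric_embedding_on_def by force
  then have "norm (f 1 /\<^sub>R norm (f 1)) = 1" by simp
  then show ?thesis by blast
qed

text \<open>A problem with a single vector gives almost preimages: \<open>x\<close> has the norm of
  \<open>y\<close>, so sending \<open>x\<close> to \<open>y\<close> is nonexpansive. As
  \<open>K\<close> is empty and \<open>L = {0}\<close>, the source vector may move freely while its
  image is held near \<open>y\<close>.\<close>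

lemma approximately_gurarii_surjective:
  fixes G :: "'x::banach \<Rightarrow>\<^sub>L 'y::banach"
  assumes gx: "gurarii_space TYPE('x)" and G: "approximately_gurarii G"
  shows "\<exists>x. blinfun_apply G x = y \<and> norm x \<le> 4 * norm y"
proof (rule surjective_of_almost_surjective)
  fix y
  show "\<exists>x. norm x \<le> 2 * norm y \<and> norm (y - blinfun_apply G x) \<le> norm y / 2"
  proof (cases "y = 0")
    case True
    then show ?thesis by (intro exI[of _ 0]) simp
  next
    case False
    then have "0 < norm y / 2" by simp
    then obtain \<eta> where \<eta>: "\<eta> > 0" "\<And>(I :: nat set) J K L x w. finite J \<Longrightarrow> K \<subseteq> I \<Longrightarrow> I \<subseteq> J \<Longrightarrow>
      K \<subseteq> L \<Longrightarrow> L \<subseteq> J \<Longrightarrow> compatible \<eta> G I K x w \<Longrightarrow> solvable (norm y / 2) G I J K L x w"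
      using G unfolding approximately_gurarii_def by (meson)
    obtain u :: 'x where u: "norm u = 1" using gurarii_space_unit_vector[OF gx] by blast
    define x where "x = norm y *\<^sub>R u"
    have x: "norm x = norm y" by (simp add: x_def u)
    have "solvable (norm y / 2) G {0::nat} {0} {} {0} (\<lambda>_. x) (\<lambda>_. y)"
      using \<eta>(1) by (intro \<eta>(2)) (auto simp: compatible_def almost_nonexpansive_def x)
    then obtain x' w' where *: "w' 0 = blinfun_apply G (x' 0)" "almost_isometric (norm y / 2) {0::nat} (\<lambda>_. x) x'"
      "norm (w' 0 - y) \<le> norm y / 2"
      unfolding solvable_def by auto
    have "norm (x' 0) \<le> 2 * norm y"
      using *(2)[unfolded almost_isometric_def, rule_format, of "\<lambda>_. 1"] x unfolding abs_le_iff by simp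
    then show ?thesis using * by (intro exI[of _ "x' 0"]) (simp add: norm_minus_commute)
  qed
qed

section \<open>Bases and almost isometric linear maps\<close>

lemma independent_family:
  fixes \<alpha> :: "'i \<Rightarrow> 'v::real_vector"
  assumes "independent (\<alpha> ` I)" "inj_on \<alpha> I" "finite I" "(\<Sum>i\<in>I. a i *\<^sub>R \<alpha> i) = 0"
  shows "\<forall>i\<in>I. a i = 0"
proof
  fix i assume i: "i \<in> I"
  have "(\<Sum>v\<in>\<alpha> ` I. a (inv_into I \<alpha> v) *\<^sub>R v) = (\<Sum>i\<in>I. a i *\<^sub>R \<alpha> i)"
    using assms(2) by (simp add: sum.reindex)
  then have "a (inv_into I \<alpha> (\<alpha> i)) = 0"
    using independentD[OF assms(1) finite_imageI[OF assms(3)] subset_refl, of "\<lambda>v. a (inv_into I \<alpha> v)" "\<alpha> i"] i assms(4) by simp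
  then show "a i = 0" using i assms(2) by simp
qed

lemma eps_isometric_bounds:
  assumes V: "fd_normed_space V N" and g: "eps_isometric_embedding_on e V N g" and x: "x \<in> V"
  shows "(1 - e) * N x \<le> norm (g x)" "norm (g x) \<le> (1 + e) * N x"
proof -
  have o: "operator_on V N UNIV norm g" using g by (simp add: eps_isometric_embedding_on_def)
  have "g 0 = 0" using operator_onD(3)[OF o subspace_0[OF fd_normed_spaceD(1)[OF V]], of 0] by simp
  moreover have "N 0 = 0" using fd_normed_spaceD(3)[OF V subspace_0[OF fd_normed_spaceD(1)[OF V]]] by simp
  ultimately show "(1 - e) * N x \<le> norm (g x)" "norm (g x) \<le> (1 + e) * N x"
    using g x unfolding eps_isometric_embedding_on_def by (cases "x = 0"; auto simp: less_imp_le)+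
qed

text \<open>The slack between \<open>e / 2\<close> and \<open>e\<close> yields the strict
  inequalities, and a relative error of at most one half excludes a kernel.\<close>

lemma eps_isometricI:
  assumes V: "fd_normed_space V N" and g: "linear g" and e: "0 < e" "e \<le> 1"
    and le: "\<And>x. x \<in> V \<Longrightarrow> \<bar>norm (g x) - N x\<bar> \<le> e / 2 * N x"
  shows "eps_isometric_embedding_on e V N g"
proof -
  note V' = fd_normed_spaceD[OF V]
  have pos: "0 < N x" if "x \<in> V" "x \<noteq> 0" for x
    using V'(2,3)[OF that(1)] that(2) by simp
  have "(1 - e) * N x < norm (g x) \<and> norm (g x) < (1 + e) * N x" if "x \<in> V" "x \<noteq> 0" for x
  proof -
    have "0 < e * N x" using pos[OF that] e by simp
    moreover have "norm (g x) - N x \<le> e * N x / 2" "N x - norm (g x) \<le> e * N x / 2"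
      using le[OF that(1)] by linarith+
    ultimately show ?thesis unfolding left_diff_distrib distrib_right by auto
  qed
  moreover have "inj_on g V"
  proof (rule inj_onI)
    fix x y assume xy: "x \<in> V" "y \<in> V" "g x = g y"
    show "x = y"
    proof (rule ccontr)
      assume "x \<noteq> y"
      then have d: "x - y \<in> V" "x - y \<noteq> 0" using xy V'(1) by (auto intro: subspace_diff)
      have "N (x - y) \<le> e / 2 * N (x - y)" using le[OF d(1)] xy(3) V'(2)[OF d(1)] by (simp add: linear_diff[OF g])
      moreover have "e / 2 * N (x - y) \<le> 1 / 2 * N (x - y)" using e V'(2)[OF d(1)] by (intro mult_right_mono) auto
      ultimately show False using pos[OF d] by simp
    qed
  qed
  moreover have "norm (g x) \<le> N x * 2" if "x \<in> V" for x
  proof -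
    have "e / 2 * N x \<le> 1 / 2 * N x" using e V'(2)[OF that] by (intro mult_right_mono) auto
    with le[OF that] V'(2)[OF that] show ?thesis by linarith
  qed
  ultimately show ?thesis
    unfolding eps_isometric_embedding_on_def operator_on_def
    by (auto simp: linear_add[OF g] linear_scale[OF g])
qed

lemma eps_isometric_mono:
  assumes V: "fd_normed_space V N" and g: "eps_isometric_embedding_on e V N g" and e: "e \<le> e'"
  shows "eps_isometric_embedding_on e' V N g"
proof -
  have "(1 - e') * N x < norm (g x) \<and> norm (g x) < (1 + e') * N x" if x: "x \<in> V" "x \<noteq> 0" for x
  proof -
    have "(1 - e') * N x \<le> (1 - e) * N x" "(1 + e) * N x \<le> (1 + e') * N x"
      using e fd_normed_spaceD(2)[OF V x(1)] by (auto intro: mult_right_mono)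
    then show ?thesis using g x unfolding eps_isometric_embedding_on_def by fastforce
  qed
  then show ?thesis using g by (simp add: eps_isometric_embedding_on_def)
qed

text \<open>\<open>coefficient_bound\<close> is about the norm of a type, so \<open>V\<close> is
  first embedded into the Gurarii space with \<open>e = 1\<close>. This embedding is injective and
  at most doubles norms, whence the factor 2.\<close>

lemma fd_basis_bound:
  fixes \<alpha> :: "'i \<Rightarrow> 'v::real_vector"
  assumes g: "gurarii_space TYPE('g::banach)" and V: "fd_normed_space V N"
    and \<alpha>: "independent (\<alpha> ` I)" "inj_on \<alpha> I" "finite I" "\<alpha> ` I \<subseteq> V"
  shows "\<exists>C>0. \<forall>a. (\<Sum>i\<in>I. \<bar>a i\<bar>) \<le> C * N (\<Sum>i\<in>I. a i *\<^sub>R \<alpha> i)"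
proof -
  note V' = fd_normed_spaceD[OF V]
  have "isometric_embedding_on {0} N (\<lambda>_. 0 :: 'g)"
    using V'(3)[OF subspace_0[OF V'(1)]] by (simp add: isometric_embedding_on_def operator_on_def)
  then obtain f :: "'v \<Rightarrow> 'g" where f: "eps_isometric_embedding_on 1 V N f"
    using gurarii_space_extend[OF g V, of "{0}" 1 "\<lambda>_. 0"] subspace_0[OF V'(1)] by auto
  have o: "operator_on V N UNIV norm f" and inj: "inj_on f V"
    using f by (auto simp: eps_isometric_embedding_on_def)
  have f0: "f 0 = 0" using operator_onD(3)[OF o subspace_0[OF V'(1)], of 0] by simp
  have fs: "f (\<Sum>i\<in>I. a i *\<^sub>R \<alpha> i) = (\<Sum>i\<in>I. a i *\<^sub>R f (\<alpha> i))" for a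
    using \<alpha>(4) by (intro operator_on_sum[OF o V'(1)]) auto
  have m: "(\<Sum>i\<in>I. a i *\<^sub>R \<alpha> i) \<in> V" for a
    using \<alpha>(4) by (intro subspace_sum[OF V'(1)] subspace_scale[OF V'(1)]) auto
  have "\<forall>i\<in>I. a i = 0" if "(\<Sum>i\<in>I. a i *\<^sub>R f (\<alpha> i)) = 0" for a
  proof -
    have "f (\<Sum>i\<in>I. a i *\<^sub>R \<alpha> i) = f 0" using that by (simp add: fs f0)
    then have "(\<Sum>i\<in>I. a i *\<^sub>R \<alpha> i) = 0" using inj m subspace_0[OF V'(1)] by (auto dest: inj_onD)
    then show ?thesis by (rule independent_family[OF \<alpha>(1-3)])
  qed
  then have "\<exists>C>0. \<forall>a. (\<Sum>i\<in>I. \<bar>a i\<bar>) \<le> C * norm (\<Sum>i\<in>I. a i *\<^sub>R f (\<alpha> i))"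
    by (intro coefficient_bound \<alpha>(3))
  then obtain C where
    C: "C > 0" "\<And>a. (\<Sum>i\<in>I. \<bar>a i\<bar>) \<le> C * norm (\<Sum>i\<in>I. a i *\<^sub>R f (\<alpha> i))" by blast
  have "(\<Sum>i\<in>I. \<bar>a i\<bar>) \<le> (C * 2) * N (\<Sum>i\<in>I. a i *\<^sub>R \<alpha> i)" for a
  proof -
    have "C * norm (\<Sum>i\<in>I. a i *\<^sub>R f (\<alpha> i)) \<le> C * (2 * N (\<Sum>i\<in>I. a i *\<^sub>R \<alpha> i))"
      using eps_isometric_bounds(2)[OF V f m, of a] C(1) by (intro mult_left_mono) (auto simp: fs)
    with C(2)[of a] show ?thesis by simp
  qed
  with C(1) show ?thesis by (intro exI[of _ "C * 2"]) simp
qed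

lemma fd_basis_extend:
  fixes V :: "'v::real_vector set"
  assumes V: "fd_normed_space V N" and V0: "subspace V0" "V0 \<subseteq> V"
  shows "\<exists>S S0. finite S \<and> independent S \<and> span S = V \<and> S0 \<subseteq> S \<and> span S0 = V0"
proof -
  note V' = fd_normed_spaceD[OF V]
  obtain F where F: "finite F" "V = span F" using V'(6) by blast
  obtain S0 where S0: "S0 \<subseteq> V0" "independent S0" "V0 \<subseteq> span S0"
    using maximal_independent_subset[of V0] by blast
  obtain S where S: "S0 \<subseteq> S" "S \<subseteq> V" "independent S" "V \<subseteq> span S"
    using maximal_independent_subset_extend[of S0 V] S0 V0 by blast
  have "finite S" using independent_span_bound[OF F(1) S(3)] S(2) F(2) by blast
  moreover have "span S = V" using S(2,4) V'(1) span_minimal by blast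
  moreover have "span S0 = V0" using S0 V0(1) span_minimal by blast
  ultimately show ?thesis using S by blast
qed

lemma linear_on_family:
  fixes \<alpha> :: "'i \<Rightarrow> 'v::real_vector" and y :: "'i \<Rightarrow> 'w::real_vector"
  assumes "independent (\<alpha> ` I)" "inj_on \<alpha> I"
  shows "\<exists>g. linear g \<and> (\<forall>i\<in>I. g (\<alpha> i) = y i)"
proof -
  obtain g where "linear g" "\<forall>v\<in>\<alpha> ` I. g v = y (inv_into I \<alpha> v)"
    using linear_independent_extend[OF assms(1), of "\<lambda>v. y (inv_into I \<alpha> v)"] by blast
  then show ?thesis using assms(2) by (intro exI[of _ g]) simp
qed

lemma linear_sum_scaleR: "linear g \<Longrightarrow> g (\<Sum>i\<in>I. a i *\<^sub>R x i) = (\<Sum>i\<in>I. a i *\<^sub>R g (x i))"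
  by (simp add: linear_sum linear_scale)


text \<open>
  An approximate solution is made exact on bases: on \<open>A\<^sub>0\<close> and \<open>B\<^sub>0\<close> it is replaced by the given
  embeddings, and the error of commutation at the remaining basis vectors of \<open>A\<close> is cancelled by
  small preimages \<open>h i\<close> under \<open>G\<close>, which exist because \<open>G\<close> is open.
\<close>

lemma approximately_gurarii_imp_gurarii:
  fixes G :: "'x::banach \<Rightarrow>\<^sub>L 'y::banach"
  assumes gx: "gurarii_space TYPE('x)" and gy: "gurarii_space TYPE('y)"
    and G1: "norm G \<le> 1" and G: "approximately_gurarii G"
  shows "gurarii_operator G"
  unfolding gurarii_operator_def
proof (intro conjI G1 allI impI, elim conjE)
  fix e0 :: real and A :: "fseq set" and N and B :: "fseq set" and M T A0 B0
    and i0 :: "fseq \<Rightarrow> 'x" and j0 :: "fseq \<Rightarrow> 'y"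
  assume e0: "0 < e0" and A: "fd_normed_space A N" and B: "fd_normed_space B M"
    and NE: "nonexpansive_on A N B M T"
    and A0: "subspace A0" "A0 \<subseteq> A" and B0: "subspace B0" "B0 \<subseteq> B" and TA0: "T ` A0 \<subseteq> B0"
    and i0: "isometric_embedding_on A0 N i0" and j0: "isometric_embedding_on B0 M j0"
    and comm: "\<forall>a\<in>A0. blinfun_apply G (i0 a) = j0 (T a)"
  from iffD1[OF nonexpansive_on_iff[OF A] NE]
  have T: "operator_on A N B M T" and TN: "\<And>x. x \<in> A \<Longrightarrow> M (T x) \<le> N x" by auto
  note A' = fd_normed_spaceD[OF A] and B' = fd_normed_spaceD[OF B]
  have oi0: "operator_on A0 N UNIV norm i0" and oj0: "operator_on B0 M UNIV norm j0"
    using i0 j0 by (simp_all add: isometric_embedding_on_def)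
  obtain SA SA0 where SA: "finite SA" "independent SA" "span SA = A" "SA0 \<subseteq> SA" "span SA0 = A0"
    using fd_basis_extend[OF A A0] by blast
  obtain SB SB0 where SB: "finite SB" "independent SB" "span SB = B" "SB0 \<subseteq> SB" "span SB0 = B0"
    using fd_basis_extend[OF B B0] by blast
  define n where "n = card SA"
  define I where "I = {..<n}"
  \<comment> \<open>Indices for the basis of \<open>B\<close> follow those for the basis of
    \<open>A\<close>, so that one family \<open>w\<close> over \<open>J\<close> can hold the images
    of the latter together with the former.\<close>
  define I' where "I' = {n..<n + card SB}"
  define J where "J = I \<union> I'"
  obtain \<alpha> where \<alpha>: "bij_betw \<alpha> I SA"
    using ex_bij_betw_nat_finite[OF SA(1)] by (auto simp: I_def n_def lessThan_atLeast0)
  obtain \<beta>0 where \<beta>0: "bij_betw \<beta>0 {0..<card SB} SB"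
    using ex_bij_betw_nat_finite[OF SB(1)] by blast
  have "bij_betw (\<lambda>k. k - n) I' {0..<card SB}"
    by (rule bij_betw_byWitness[where f' = "\<lambda>k. k + n"]) (auto simp: I'_def)
  then obtain \<beta> where \<beta>: "bij_betw \<beta> I' SB"
    using bij_betw_trans[OF _ \<beta>0] by blast
  have fin: "finite I" "finite I'" "finite J" by (auto simp: I_def I'_def J_def)
  have disj: "I \<inter> I' = {}" by (auto simp: I_def I'_def)
  have \<alpha>D: "\<alpha> ` I = SA" "inj_on \<alpha> I" and \<beta>D: "\<beta> ` I' = SB" "inj_on \<beta> I'"
    using \<alpha> \<beta> by (auto simp: bij_betw_def)
  have \<alpha>A: "\<alpha> i \<in> A" if "i \<in> I" for i using that span_base[of "\<alpha> i" SA] \<alpha>D(1) SA(3) by blast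
  have \<beta>B: "\<beta> j \<in> B" if "j \<in> I'" for j using that span_base[of "\<beta> j" SB] \<beta>D(1) SB(3) by blast
  have A_eq: "A = range (\<lambda>a. \<Sum>i\<in>I. a i *\<^sub>R \<alpha> i)"
    using span_family[OF fin(1), of \<alpha>] \<alpha>D(1) SA(3) by simp
  have B_eq: "B = range (\<lambda>a. \<Sum>i\<in>I'. a i *\<^sub>R \<beta> i)"
    using span_family[OF fin(2), of \<beta>] \<beta>D(1) SB(3) by simp
  obtain CA where CA: "CA > 0" "\<And>a. (\<Sum>i\<in>I. \<bar>a i\<bar>) \<le> CA * N (\<Sum>i\<in>I. a i *\<^sub>R \<alpha> i)"
    using fd_basis_bound[OF gx A, of \<alpha> I] SA \<alpha>D fin(1) \<alpha>A by blast
  obtain CB where CB: "CB > 0" "\<And>a. (\<Sum>i\<in>I'. \<bar>a i\<bar>) \<le> CB * M (\<Sum>i\<in>I'. a i *\<^sub>R \<beta> i)"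
    using fd_basis_bound[OF gy B, of \<beta> I'] SB \<beta>D fin(2) \<beta>B by blast
  have "\<exists>t. T (\<alpha> i) = (\<Sum>j\<in>I'. t j *\<^sub>R \<beta> j)" if "i \<in> I" for i
    using operator_onD(1)[OF T \<alpha>A[OF that]] unfolding B_eq by blast
  then obtain t where t: "\<And>i. i \<in> I \<Longrightarrow> T (\<alpha> i) = (\<Sum>j\<in>I'. t i j *\<^sub>R \<beta> j)" by metis
  \<comment> \<open>If \<open>s\<close> is the l1 norm of the coordinates of
    \<open>T (\<alpha> i)\<close>, the estimate \<open>E\<close> collects \<open>s + 1\<close> from
    almost isometry and \<open>s\<close> from replacing \<open>w'\<close> by
    \<open>y\<close>.\<close>
  define CT where "CT = 1 + 2 * (\<Sum>i\<in>I. \<Sum>j\<in>I'. \<bar>t i j\<bar>)"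
  have CT1: "1 \<le> CT" by (simp add: CT_def sum_nonneg)
  have CT: "1 + 2 * (\<Sum>j\<in>I'. \<bar>t i j\<bar>) \<le> CT" if "i \<in> I" for i
    using member_le_sum[of i I "\<lambda>i. \<Sum>j\<in>I'. \<bar>t i j\<bar>"] that fin by (simp add: CT_def sum_nonneg)

  define e where "e = min e0 (1 / 2)"
  have e: "0 < e" "e \<le> 1 / 2" "e \<le> e0" using e0 by (auto simp: e_def)
  \<comment> \<open>The corrected vectors \<open>z i\<close> lie within
    \<open>4 * CT * \<tau>\<close> of \<open>x' i\<close>, the 4 being the constant of the open map,
    and almost isometry adds one more \<open>\<tau>\<close>. The choice of \<open>\<tau>\<close>
    lets the basis constants \<open>CA\<close> and \<open>CB\<close> turn the errors into at most
    \<open>e / 4\<close>.\<close>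
  define \<kappa> where "\<kappa> = 1 + 4 * CT"
  define \<tau> where "\<tau> = e / (4 * \<kappa> * (CA + CB))"
  have \<kappa>: "2 \<le> \<kappa>" using CT1 by (simp add: \<kappa>_def)
  have \<tau>: "0 < \<tau>" using e \<kappa> CA(1) CB(1) by (simp add: \<tau>_def)
  have prod: "4 * \<kappa> * \<tau> * (CA + CB) = e" using e \<kappa> CA(1) CB(1) by (simp add: \<tau>_def)
  have \<tau>A: "\<kappa> * \<tau> * CA \<le> e / 4" and \<tau>B: "2 * \<tau> * CB \<le> e / 4"
  proof -
    have "0 \<le> \<kappa> * \<tau> * CA" "0 \<le> \<kappa> * \<tau> * CB" using \<kappa> \<tau> CA(1) CB(1) by simp_all
    moreover have "\<kappa> * \<tau> * CA + \<kappa> * \<tau> * CB = e / 4" using prod by (simp add: algebra_simps)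
    moreover have "2 * \<tau> * CB \<le> \<kappa> * \<tau> * CB" using \<kappa> \<tau> CB(1) by (intro mult_right_mono) auto
    ultimately show "\<kappa> * \<tau> * CA \<le> e / 4" "2 * \<tau> * CB \<le> e / 4" by linarith+
  qed
  obtain \<eta> where \<eta>: "\<eta> > 0" "\<And>(I :: nat set) J K L x w. finite J \<Longrightarrow> K \<subseteq> I \<Longrightarrow> I \<subseteq> J \<Longrightarrow>
      K \<subseteq> L \<Longrightarrow> L \<subseteq> J \<Longrightarrow> compatible \<eta> G I K x w \<Longrightarrow> solvable \<tau> G I J K L x w"
    using G \<tau> unfolding approximately_gurarii_def by meson
  define CN where "CN = (\<Sum>i\<in>I. N (\<alpha> i))"
  have CN0: "0 \<le> CN" using A'(2) \<alpha>A by (simp add: CN_def sum_nonneg)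
  \<comment> \<open>The given embeddings are first extended with distortion \<open>\<gamma>\<close>
    and without regard to \<open>G\<close>. The distortions of \<open>i1\<close> and
    \<open>j1\<close> together spoil nonexpansiveness by at most \<open>2 * \<gamma>\<close> times
    the norm, which the last bound turns into \<open>\<eta>\<close> per unit of coefficient.\<close>
  obtain \<gamma> where \<gamma>: "0 < \<gamma>" "\<gamma> \<le> e / 4" "2 * \<gamma> * CN \<le> \<eta>"
  proof
    show "0 < min (e / 4) (\<eta> / (2 * CN + 1))" using e \<eta>(1) CN0 by simp
    show "min (e / 4) (\<eta> / (2 * CN + 1)) \<le> e / 4" by (rule min.cobounded1)
    have "min (e / 4) (\<eta> / (2 * CN + 1)) * (2 * CN) \<le> \<eta> / (2 * CN + 1) * (2 * CN)"
      using CN0 by (intro mult_right_mono) auto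
    also have "\<dots> \<le> \<eta>" using CN0 \<eta>(1) by (simp add: field_simps)
    finally show "2 * min (e / 4) (\<eta> / (2 * CN + 1)) * CN \<le> \<eta>" by (simp add: mult_ac)
  qed
  obtain i1 where i1: "eps_isometric_embedding_on \<gamma> A N i1" "\<forall>a\<in>A0. i1 a = i0 a"
    using gurarii_space_extend[OF gx A A0 \<gamma>(1) i0] by blast
  obtain j1 where j1: "eps_isometric_embedding_on \<gamma> B M j1" "\<forall>b\<in>B0. j1 b = j0 b"
    using gurarii_space_extend[OF gy B B0 \<gamma>(1) j0] by blast
  have oi1: "operator_on A N UNIV norm i1" and oj1: "operator_on B M UNIV norm j1"
    using i1 j1 by (simp_all add: eps_isometric_embedding_on_def)
  define x where "x i = i1 (\<alpha> i)" for i
  define w where "w j = (if j \<in> I then j1 (T (\<alpha> j)) else j1 (\<beta> j))" for j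
  define K where "K = {i \<in> I. \<alpha> i \<in> SA0}"
  define L where "L = K \<union> {j \<in> I'. \<beta> j \<in> SB0}"
  have SA0: "v \<in> A0" if "v \<in> SA0" for v using that span_base[of v SA0] SA(5) by blast
  have SB0: "v \<in> B0" if "v \<in> SB0" for v using that span_base[of v SB0] SB(5) by blast
  have x_sum: "(\<Sum>i\<in>I. a i *\<^sub>R x i) = i1 (\<Sum>i\<in>I. a i *\<^sub>R \<alpha> i)" for a
    unfolding x_def using \<alpha>A by (rule operator_on_sum[OF oi1 A'(1), symmetric])
  have T_sum: "T (\<Sum>i\<in>I. a i *\<^sub>R \<alpha> i) = (\<Sum>i\<in>I. a i *\<^sub>R T (\<alpha> i))" for a
    using \<alpha>A by (rule operator_on_sum[OF T A'(1)])
  have w_sum: "(\<Sum>i\<in>I. a i *\<^sub>R w i) = j1 (T (\<Sum>i\<in>I. a i *\<^sub>R \<alpha> i))" for a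
  proof -
    have "(\<Sum>i\<in>I. a i *\<^sub>R w i) = (\<Sum>i\<in>I. a i *\<^sub>R j1 (T (\<alpha> i)))"
      by (rule sum.cong) (auto simp: w_def)
    also have "\<dots> = j1 (\<Sum>i\<in>I. a i *\<^sub>R T (\<alpha> i))"
      using operator_onD(1)[OF T \<alpha>A] by (rule operator_on_sum[OF oj1 B'(1), symmetric])
    finally show ?thesis by (simp add: T_sum)
  qed
  have w_sum': "(\<Sum>j\<in>I'. a j *\<^sub>R w j) = j1 (\<Sum>j\<in>I'. a j *\<^sub>R \<beta> j)" for a
  proof -
    have "(\<Sum>j\<in>I'. a j *\<^sub>R w j) = (\<Sum>j\<in>I'. a j *\<^sub>R j1 (\<beta> j))"
      using disj by (intro sum.cong) (auto simp: w_def)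
    also have "\<dots> = j1 (\<Sum>j\<in>I'. a j *\<^sub>R \<beta> j)"
      using \<beta>B by (rule operator_on_sum[OF oj1 B'(1), symmetric])
    finally show ?thesis .
  qed
  have A_mem: "(\<Sum>i\<in>I. a i *\<^sub>R \<alpha> i) \<in> A" for a unfolding A_eq by blast
  have B_mem: "(\<Sum>i\<in>I'. a i *\<^sub>R \<beta> i) \<in> B" for a unfolding B_eq by blast
  have "compatible \<eta> G I K x w"
    unfolding compatible_def almost_nonexpansive_def
  proof (intro conjI allI ballI)
    fix a :: "nat \<Rightarrow> real"
    let ?v = "\<Sum>i\<in>I. a i *\<^sub>R \<alpha> i"
    have "norm (\<Sum>i\<in>I. a i *\<^sub>R w i) \<le> (1 + \<gamma>) * M (T ?v)"
      unfolding w_sum by (rule eps_isometric_bounds(2)[OF B j1(1) operator_onD(1)[OF T A_mem]])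
    also have "\<dots> \<le> (1 + \<gamma>) * N ?v" using \<gamma>(1) TN[OF A_mem] by (intro mult_left_mono) auto
    also have "\<dots> = (1 - \<gamma>) * N ?v + 2 * \<gamma> * N ?v" by (simp add: algebra_simps)
    also have "\<dots> \<le> norm (\<Sum>i\<in>I. a i *\<^sub>R x i) + \<eta> * (\<Sum>i\<in>I. \<bar>a i\<bar>)"
    proof (rule add_mono)
      show "(1 - \<gamma>) * N ?v \<le> norm (\<Sum>i\<in>I. a i *\<^sub>R x i)"
        unfolding x_sum by (rule eps_isometric_bounds(1)[OF A i1(1) A_mem])
      have "N ?v \<le> (\<Sum>i\<in>I. \<bar>a i\<bar>) * CN"
      proof -
        have "N (\<Sum>i\<in>S. a i *\<^sub>R \<alpha> i) \<le> (\<Sum>i\<in>S. \<bar>a i\<bar> * N (\<alpha> i))" if "finite S" "S \<subseteq> I" for S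
          using that
        proof (induction S)
          case empty
          show ?case using A'(3)[OF subspace_0[OF A'(1)]] by simp
        next
          case (insert i S)
          have i: "\<alpha> i \<in> A" and S: "(\<Sum>i\<in>S. a i *\<^sub>R \<alpha> i) \<in> A"
            using insert.prems \<alpha>A by (auto intro!: subspace_sum[OF A'(1)] subspace_scale[OF A'(1)])
          have "N (a i *\<^sub>R \<alpha> i + (\<Sum>i\<in>S. a i *\<^sub>R \<alpha> i)) \<le> N (a i *\<^sub>R \<alpha> i) + N (\<Sum>i\<in>S. a i *\<^sub>R \<alpha> i)"
            using i S by (intro A'(5) subspace_scale[OF A'(1)])
          with insert show ?case by (simp add: A'(4)[OF i])
        qed
        then have "N ?v \<le> (\<Sum>i\<in>I. \<bar>a i\<bar> * N (\<alpha> i))" using fin by blast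
        also have "\<dots> \<le> (\<Sum>i\<in>I. \<bar>a i\<bar> * CN)"
          unfolding CN_def using fin A'(2)[OF \<alpha>A]
          by (intro sum_mono mult_left_mono member_le_sum) auto
        finally show ?thesis by (simp add: sum_distrib_right)
      qed
      then have "2 * \<gamma> * N ?v \<le> 2 * \<gamma> * ((\<Sum>i\<in>I. \<bar>a i\<bar>) * CN)" using \<gamma>(1) by (intro mult_left_mono) auto
      also have "\<dots> = 2 * \<gamma> * CN * (\<Sum>i\<in>I. \<bar>a i\<bar>)" by simp
      also have "\<dots> \<le> \<eta> * (\<Sum>i\<in>I. \<bar>a i\<bar>)" using \<gamma>(3) by (intro mult_right_mono) (auto simp: sum_nonneg)
      finally show "2 * \<gamma> * N ?v \<le> \<eta> * (\<Sum>i\<in>I. \<bar>a i\<bar>)" .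
    qed
    finally show "norm (\<Sum>i\<in>I. a i *\<^sub>R w i) \<le> norm (\<Sum>i\<in>I. a i *\<^sub>R x i) + \<eta> * (\<Sum>i\<in>I. \<bar>a i\<bar>)" .
  next
    fix i assume "i \<in> K"
    then have i: "i \<in> I" "\<alpha> i \<in> A0" using SA0 by (auto simp: K_def)
    then have "T (\<alpha> i) \<in> B0" using TA0 by blast
    then have "blinfun_apply G (x i) = w i" using i comm i1(2) j1(2) by (simp add: x_def w_def)
    then show "norm (blinfun_apply G (x i) - w i) \<le> \<eta>" using \<eta>(1) by simp
  qed
  then have "solvable \<tau> G I J K L x w"
    using fin by (intro \<eta>(2)) (auto simp: K_def L_def J_def)
  then obtain x' w' where Gx': "\<And>i. i \<in> I \<Longrightarrow> w' i = blinfun_apply G (x' i)"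
    and xx': "almost_isometric \<tau> I x x'" and ww': "almost_isometric \<tau> J w w'"
    and K: "\<And>i. i \<in> K \<Longrightarrow> norm (x' i - x i) \<le> \<tau>" and L: "\<And>j. j \<in> L \<Longrightarrow> norm (w' j - w j) \<le> \<tau>"
    unfolding solvable_def by blast

  define y where "y j = (if \<beta> j \<in> SB0 then j0 (\<beta> j) else w' j)" for j
  obtain jm where jm: "linear jm" "\<And>j. j \<in> I' \<Longrightarrow> jm (\<beta> j) = y j"
    using linear_on_family[of \<beta> I' y] \<beta>D SB(2) by auto
  have yw': "norm (y j - w' j) \<le> \<tau>" if j: "j \<in> I'" for j
  proof (cases "\<beta> j \<in> SB0")
    case True
    then have "w j = y j" using j disj SB0 j1(2) by (auto simp: w_def y_def)
    then show ?thesis using L[of j] j True by (simp add: L_def norm_minus_commute)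
  qed (use \<tau> in \<open>simp add: y_def\<close>)
  have jm_sum: "jm (\<Sum>j\<in>I'. a j *\<^sub>R \<beta> j) = (\<Sum>j\<in>I'. a j *\<^sub>R y j)" for a
    unfolding linear_sum_scaleR[OF jm(1)] using jm(2) by simp
  have jm0: "jm b = j0 b" if b: "b \<in> B0" for b
  proof -
    have fS: "finite SB0" using SB(4,1) by (rule finite_subset)
    have "b \<in> range (\<lambda>u. \<Sum>v\<in>SB0. u v *\<^sub>R v)" using b SB(5) span_finite[OF fS] by simp
    then obtain u where u: "b = (\<Sum>v\<in>SB0. u v *\<^sub>R v)" by blast
    have "jm v = j0 v" if v: "v \<in> SB0" for v
    proof -
      obtain j where "j \<in> I'" "v = \<beta> j" using v SB(4) \<beta>D(1) by blast
      then show ?thesis using jm(2) v by (simp add: y_def)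
    qed
    then show ?thesis
      unfolding u linear_sum_scaleR[OF jm(1)] using operator_on_sum[OF oj0 B0(1), of SB0 "\<lambda>v. v" u] SB0 by simp
  qed
  have E: "norm (jm (T (\<alpha> i)) - w' i) \<le> \<tau> * CT" if i: "i \<in> I" for i
  proof -
    define s where "s = (\<Sum>j\<in>I'. \<bar>t i j\<bar>)"
    \<comment> \<open>\<open>c\<close> encodes the linear relation that expresses
      \<open>T (\<alpha> i)\<close> in the basis of \<open>B\<close>. The corresponding combination
      of the \<open>w j\<close> is 0, so almost isometry on the joint index set \<open>J\<close>
      forces that of the \<open>w' j\<close> to be small: the solution nearly remembers
      \<open>T\<close>.\<close>
    define c where "c j = (if j \<in> I' then t i j else 0) + (if j = i then - 1 else 0)" for j
    have iJ: "i \<in> J" "i \<notin> I'" using i disj by (auto simp: J_def)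
    have c_sum: "(\<Sum>j\<in>J. c j *\<^sub>R u j) = (\<Sum>j\<in>I'. t i j *\<^sub>R u j) - u i" for u :: "nat \<Rightarrow> 'y"
    proof -
      have "(\<Sum>j\<in>J. c j *\<^sub>R u j) = (\<Sum>j\<in>J. (if j \<in> I' then t i j else 0) *\<^sub>R u j) + (\<Sum>j\<in>J. (if j = i then - 1 else 0) *\<^sub>R u j)"
        by (simp only: c_def scaleR_add_left sum.distrib)
      also have "(\<Sum>j\<in>J. (if j \<in> I' then t i j else 0) *\<^sub>R u j) = (\<Sum>j\<in>I'. t i j *\<^sub>R u j)"
        using fin by (intro sum.mono_neutral_cong_right) (auto simp: J_def)
      also have "(\<Sum>j\<in>J. (if j = i then - 1 else 0) *\<^sub>R u j) = (- 1) *\<^sub>R u i"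
        by (rule sum_scaleR_if[OF fin(3) iJ(1)])
      finally show ?thesis by simp
    qed
    have c_abs: "(\<Sum>j\<in>J. \<bar>c j\<bar>) = s + 1"
    proof -
      have "(\<Sum>j\<in>J. \<bar>c j\<bar>) = (\<Sum>j\<in>J. (if j \<in> I' then \<bar>t i j\<bar> else 0) + (if j = i then 1 else 0))"
        using iJ by (intro sum.cong) (auto simp: c_def)
      also have "\<dots> = (\<Sum>j\<in>J. if j \<in> I' then \<bar>t i j\<bar> else 0) + 1"
        using fin iJ by (simp add: sum.distrib)
      also have "(\<Sum>j\<in>J. if j \<in> I' then \<bar>t i j\<bar> else 0) = s"
        unfolding s_def using fin by (intro sum.mono_neutral_cong_right) (auto simp: J_def)
      finally show ?thesis .
    qed
    have "(\<Sum>j\<in>J. c j *\<^sub>R w j) = 0"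
      unfolding c_sum w_sum' using i by (simp add: t[symmetric] w_def)
    then have 1: "norm ((\<Sum>j\<in>I'. t i j *\<^sub>R w' j) - w' i) \<le> \<tau> * (s + 1)"
      using ww'[unfolded almost_isometric_def, rule_format, of c] by (simp add: c_sum c_abs)
    have 2: "norm ((\<Sum>j\<in>I'. t i j *\<^sub>R y j) - (\<Sum>j\<in>I'. t i j *\<^sub>R w' j)) \<le> \<tau> * s"
      unfolding s_def by (rule norm_sum_perturb[OF yw'])
    have "norm (jm (T (\<alpha> i)) - w' i) \<le> \<tau> * s + \<tau> * (s + 1)"
      using norm_triangle_le[OF add_mono[OF 2 1]] by (simp add: t[OF i] jm_sum)
    also have "\<dots> = \<tau> * (1 + 2 * s)" by (simp add: algebra_simps)
    also have "\<dots> \<le> \<tau> * CT" using CT[OF i] \<tau> by (intro mult_left_mono) (auto simp: s_def)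
    finally show ?thesis .
  qed
  have "\<exists>h. blinfun_apply G h = jm (T (\<alpha> i)) - w' i \<and> norm h \<le> 4 * norm (jm (T (\<alpha> i)) - w' i)" for i
    by (rule approximately_gurarii_surjective[OF gx G])
  then obtain h where Gh: "\<And>i. blinfun_apply G (h i) = jm (T (\<alpha> i)) - w' i"
    and h_le: "\<And>i. norm (h i) \<le> 4 * norm (jm (T (\<alpha> i)) - w' i)" by metis
  define z where "z i = (if \<alpha> i \<in> SA0 then i0 (\<alpha> i) else x' i + h i)" for i
  obtain im where im: "linear im" "\<And>i. i \<in> I \<Longrightarrow> im (\<alpha> i) = z i"
    using linear_on_family[of \<alpha> I z] \<alpha>D SA(2) by auto
  have zx': "norm (z i - x' i) \<le> 4 * CT * \<tau>" if i: "i \<in> I" for i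
  proof (cases "\<alpha> i \<in> SA0")
    case True
    then have "x i = z i" using SA0 i1(2) by (simp add: x_def z_def)
    then have "norm (z i - x' i) \<le> \<tau>" using K[of i] i True by (simp add: K_def norm_minus_commute)
    also have "\<dots> \<le> 4 * CT * \<tau>" using CT1 \<tau> mult_right_mono[of 1 "4 * CT" \<tau>] by simp
    finally show ?thesis .
  next
    case False
    have "norm (h i) \<le> 4 * (\<tau> * CT)" using h_le[of i] E[OF i] by linarith
    then show ?thesis using False by (simp add: z_def mult_ac)
  qed
  have im_sum: "im (\<Sum>i\<in>I. a i *\<^sub>R \<alpha> i) = (\<Sum>i\<in>I. a i *\<^sub>R z i)" for a
    unfolding linear_sum_scaleR[OF im(1)] using im(2) by simp
  have im0: "im b = i0 b" if b: "b \<in> A0" for b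
  proof -
    have fS: "finite SA0" using SA(4,1) by (rule finite_subset)
    have "b \<in> range (\<lambda>u. \<Sum>v\<in>SA0. u v *\<^sub>R v)" using b SA(5) span_finite[OF fS] by simp
    then obtain u where u: "b = (\<Sum>v\<in>SA0. u v *\<^sub>R v)" by blast
    have "im v = i0 v" if v: "v \<in> SA0" for v
    proof -
      obtain i where "i \<in> I" "v = \<alpha> i" using v SA(4) \<alpha>D(1) by blast
      then show ?thesis using im(2) v by (simp add: z_def)
    qed
    then show ?thesis
      unfolding u linear_sum_scaleR[OF im(1)] using operator_on_sum[OF oi0 A0(1), of SA0 "\<lambda>v. v" u] SA0 by simp
  qed
  have Gz: "blinfun_apply G (z i) = jm (T (\<alpha> i))" if i: "i \<in> I" for i
  proof (cases "\<alpha> i \<in> SA0")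
    case True
    then have "\<alpha> i \<in> A0" "T (\<alpha> i) \<in> B0" using SA0 TA0 by auto
    then show ?thesis using True comm jm0 by (simp add: z_def)
  next
    case False
    then show ?thesis using Gh[of i] Gx'[OF i] by (simp add: z_def blinfun.add_right)
  qed
  have "blinfun_apply G (im a) = jm (T a)" if a: "a \<in> A" for a
  proof -
    obtain c where c: "a = (\<Sum>i\<in>I. c i *\<^sub>R \<alpha> i)" using a unfolding A_eq by blast
    have "blinfun_apply G (im a) = (\<Sum>i\<in>I. c i *\<^sub>R jm (T (\<alpha> i)))"
      unfolding c im_sum by (simp add: blinfun.sum_right blinfun.scaleR_right Gz)
    also have "\<dots> = jm (T a)" unfolding c T_sum by (rule linear_sum_scaleR[OF jm(1), symmetric])
    finally show ?thesis .
  qed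
  moreover have "eps_isometric_embedding_on e0 A N im"
  proof (rule eps_isometric_mono[OF A _ e(3)], rule eps_isometricI[OF A im(1) e(1)])
    fix a assume "a \<in> A"
    then obtain c where c: "a = (\<Sum>i\<in>I. c i *\<^sub>R \<alpha> i)" unfolding A_eq by blast
    have "almost_isometric (\<tau> + 4 * CT * \<tau>) I x z" by (rule almost_isometric_trans[OF xx' zx'])
    then have "\<bar>norm (im a) - norm (i1 a)\<bar> \<le> (\<tau> + 4 * CT * \<tau>) * (\<Sum>i\<in>I. \<bar>c i\<bar>)"
      unfolding almost_isometric_def c im_sum x_sum[symmetric] by (rule spec)
    also have "\<tau> + 4 * CT * \<tau> = \<kappa> * \<tau>" by (simp add: \<kappa>_def algebra_simps)
    also have "\<kappa> * \<tau> * (\<Sum>i\<in>I. \<bar>c i\<bar>) \<le> \<kappa> * \<tau> * (CA * N a)"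
      unfolding c using CA(2) \<kappa> \<tau> by (intro mult_left_mono) auto
    also have "\<dots> \<le> e / 4 * N a"
      using mult_right_mono[OF \<tau>A A'(2)[OF \<open>a \<in> A\<close>]] by (simp add: mult.assoc)
    finally have 1: "\<bar>norm (im a) - norm (i1 a)\<bar> \<le> e / 4 * N a" .
    have "\<gamma> * N a \<le> e / 4 * N a" by (rule mult_right_mono[OF \<gamma>(2) A'(2)[OF \<open>a \<in> A\<close>]])
    then have "\<bar>norm (i1 a) - N a\<bar> \<le> e / 4 * N a"
      using eps_isometric_bounds[OF A i1(1) \<open>a \<in> A\<close>] unfolding left_diff_distrib distrib_right by linarith
    with 1 show "\<bar>norm (im a) - N a\<bar> \<le> e / 2 * N a" by linarith
  qed (use e in auto)
  moreover have "eps_isometric_embedding_on e0 B M jm"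
  proof (rule eps_isometric_mono[OF B _ e(3)], rule eps_isometricI[OF B jm(1) e(1)])
    fix b assume "b \<in> B"
    then obtain c0 where c0: "b = (\<Sum>j\<in>I'. c0 j *\<^sub>R \<beta> j)" unfolding B_eq by blast
    define c where "c j = (if j \<in> I' then c0 j else 0)" for j
    have c: "(\<Sum>j\<in>J. c j *\<^sub>R u j) = (\<Sum>j\<in>I'. c0 j *\<^sub>R u j)" "(\<Sum>j\<in>J. \<bar>c j\<bar>) = (\<Sum>j\<in>I'. \<bar>c0 j\<bar>)" for u :: "nat \<Rightarrow> 'y"
      using fin by (intro sum.mono_neutral_cong_right; auto simp: J_def c_def)+
    have "\<bar>norm (\<Sum>j\<in>I'. c0 j *\<^sub>R w' j) - norm (j1 b)\<bar> \<le> \<tau> * (\<Sum>j\<in>I'. \<bar>c0 j\<bar>)"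
      using ww'[unfolded almost_isometric_def, rule_format, of c] by (simp add: c c0 w_sum')
    moreover have "norm (jm b - (\<Sum>j\<in>I'. c0 j *\<^sub>R w' j)) \<le> \<tau> * (\<Sum>j\<in>I'. \<bar>c0 j\<bar>)"
      unfolding c0 jm_sum by (rule norm_sum_perturb[OF yw'])
    moreover have "\<tau> * (\<Sum>j\<in>I'. \<bar>c0 j\<bar>) \<le> \<tau> * (CB * M b)"
      unfolding c0 using CB(2) \<tau> by (intro mult_left_mono) auto
    moreover have "2 * (\<tau> * (CB * M b)) \<le> e / 4 * M b"
      using mult_right_mono[OF \<tau>B B'(2)[OF \<open>b \<in> B\<close>]] by (simp add: mult.assoc)
    ultimately have 1: "\<bar>norm (jm b) - norm (j1 b)\<bar> \<le> e / 4 * M b"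
      using norm_triangle_ineq3[of "jm b" "\<Sum>j\<in>I'. c0 j *\<^sub>R w' j"] by linarith
    have "\<gamma> * M b \<le> e / 4 * M b" by (rule mult_right_mono[OF \<gamma>(2) B'(2)[OF \<open>b \<in> B\<close>]])
    then have "\<bar>norm (j1 b) - M b\<bar> \<le> e / 4 * M b"
      using eps_isometric_bounds[OF B j1(1) \<open>b \<in> B\<close>] unfolding left_diff_distrib distrib_right by linarith
    with 1 show "\<bar>norm (jm b) - M b\<bar> \<le> e / 2 * M b" by linarith
  qed (use e in auto)
  ultimately show "\<exists>i j. eps_isometric_embedding_on e0 A N i \<and> eps_isometric_embedding_on e0 B M j \<and>
      (\<forall>a\<in>A0. i a = i0 a) \<and> (\<forall>b\<in>B0. j b = j0 b) \<and> (\<forall>a\<in>A. blinfun_apply G (i a) = j (T a))"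
    using im0 jm0 by blast
qed

section \<open>The space of nonexpansive operators\<close>

lemma topspace_nonexpansive_sot: "topspace nonexpansive_sot = {T. norm T \<le> 1}"
  by (simp add: nonexpansive_sot_def strong_operator_topology_topspace)

lemma openin_nonexpansive_sot_basic:
  assumes "finite V"
  shows "openin nonexpansive_sot {G. norm G \<le> 1 \<and> (\<forall>v\<in>V. norm (blinfun_apply G v - blinfun_apply G0 v) < r)}"
proof -
  have "openin strong_operator_topology {f. \<forall>v\<in>V. blinfun_apply f v \<in> ball (blinfun_apply G0 v) r}"
    using assms by (intro strong_operator_topology_basis) auto
  then have "openin nonexpansive_sot ({f. \<forall>v\<in>V. blinfun_apply f v \<in> ball (blinfun_apply G0 v) r} \<inter> {T. norm T \<le> 1})"
    unfolding nonexpansive_sot_def openin_subtopology by blast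
  also have "{f. \<forall>v\<in>V. blinfun_apply f v \<in> ball (blinfun_apply G0 v) r} \<inter> {T. norm T \<le> 1} =
      {G. norm G \<le> 1 \<and> (\<forall>v\<in>V. norm (blinfun_apply G v - blinfun_apply G0 v) < r)}"
    by (auto simp: dist_norm norm_minus_commute)
  finally show ?thesis .
qed

lemma nonexpansive_sot_neighbourhood:
  fixes T :: "('x::real_normed_vector \<Rightarrow>\<^sub>L 'x) set"
  assumes "openin nonexpansive_sot T" "G0 \<in> T"
  shows "\<exists>V r. finite V \<and> 0 < r \<and>
    {G. norm G \<le> 1 \<and> (\<forall>v\<in>V. norm (blinfun_apply G v - blinfun_apply G0 v) < r)} \<subseteq> T"
proof -
  obtain W where W: "openin strong_operator_topology W" "T = W \<inter> {T. norm T \<le> 1}"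
    using assms(1) unfolding nonexpansive_sot_def openin_subtopology by blast
  obtain U :: "('x \<Rightarrow> 'x) set" where U: "open U" "W = blinfun_apply -` U"
    using W(1) unfolding strong_operator_topology_def openin_pullback_topology by auto
  have "blinfun_apply G0 \<in> U" using assms(2) W(2) U(2) by blast
  then have "\<exists>X. blinfun_apply G0 \<in> PiE UNIV X \<and> (\<forall>v. openin euclidean (X v)) \<and>
      finite {v. X v \<noteq> topspace euclidean} \<and> PiE UNIV X \<subseteq> U"
    by (rule product_topology_open_contains_basis[OF U(1)[unfolded open_fun_def]])
  then obtain X where X: "blinfun_apply G0 \<in> PiE UNIV X" "\<And>v. open (X v)" "finite {v. X v \<noteq> UNIV}" "PiE UNIV X \<subseteq> U"
    by (elim exE conjE) simp
  define V where "V = {v. X v \<noteq> UNIV}"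
  have "\<exists>e>0. ball (blinfun_apply G0 v) e \<subseteq> X v" for v
    using X(1,2) by (auto simp: open_contains_ball PiE_iff)
  then obtain e where e: "\<And>v. e v > 0" "\<And>v. ball (blinfun_apply G0 v) (e v) \<subseteq> X v" by metis
  define r where "r = Min (insert 1 (e ` V))"
  have fV: "finite V" using X(3) by (simp add: V_def)
  have r: "0 < r" "\<And>v. v \<in> V \<Longrightarrow> r \<le> e v" using fV e(1) by (auto simp: r_def)
  have "G \<in> T" if G: "norm G \<le> 1" "\<forall>v\<in>V. norm (blinfun_apply G v - blinfun_apply G0 v) < r" for G
  proof -
    have "blinfun_apply G v \<in> X v" for v
    proof (cases "v \<in> V")
      case True
      then have "dist (blinfun_apply G0 v) (blinfun_apply G v) < e v"
        using G(2) r(2)[OF True] by (fastforce simp: dist_norm norm_minus_commute)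
      then show ?thesis using e(2)[of v] by (auto simp: subset_iff)
    qed (simp add: V_def)
    then have "blinfun_apply G \<in> U" using X(4) by auto
    then show ?thesis using G(1) by (simp add: W(2) U(2))
  qed
  then show ?thesis using fV r(1) by blast
qed

section \<open>Complete metrizability through evaluations\<close>

lemma span_range_nat:
  fixes f :: "nat \<Rightarrow> 'v::real_vector"
  assumes "z \<in> span (range f)"
  shows "\<exists>n. z \<in> span (f ` {..<n})"
  using assms
proof (induction rule: span_induct)
  have mono: "span (f ` {..<m}) \<subseteq> span (f ` {..<n})" if "m \<le> n" for m n :: nat
    using that by (intro span_mono image_mono) auto
  show "subspace {z. \<exists>n. z \<in> span (f ` {..<n})}"
  proof (rule subspaceI)
    show "0 \<in> {z. \<exists>n. z \<in> span (f ` {..<n})}" by (simp add: span_zero)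
  next
    fix x y assume "x \<in> {z. \<exists>n. z \<in> span (f ` {..<n})}" "y \<in> {z. \<exists>n. z \<in> span (f ` {..<n})}"
    then obtain m n where "x \<in> span (f ` {..<m})" "y \<in> span (f ` {..<n})" by blast
    then have "x \<in> span (f ` {..<max m n})" "y \<in> span (f ` {..<max m n})"
      using mono[of m "max m n"] mono[of n "max m n"] by auto
    then show "x + y \<in> {z. \<exists>n. z \<in> span (f ` {..<n})}" by (auto intro: span_add)
  qed (auto intro: span_scale)
next
  fix x assume "x \<in> range f"
  then obtain k where "x = f k" by blast
  then have "x \<in> span (f ` {..<Suc k})" by (auto intro: span_base)
  then show "\<exists>n. x \<in> span (f ` {..<n})" by blast
qed

text \<open>Evaluation along a dense sequence identifies the nonexpansive operators with a closed set of
  sequences.\<close>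

lemma completely_metrizable_nonexpansive_sot:
  fixes d :: "nat \<Rightarrow> 'x::banach"
  assumes d: "closure (range d) = UNIV"
  shows "completely_metrizable_space (nonexpansive_sot :: ('x \<Rightarrow>\<^sub>L 'x) topology)"
proof -
  define \<Phi> :: "('x \<Rightarrow>\<^sub>L 'x) \<Rightarrow> nat \<Rightarrow> 'x" where "\<Phi> T n = blinfun_apply T (d n)" for T n
  define R where "R = \<Phi> ` {T. norm T \<le> 1}"
  define \<Psi> where "\<Psi> = inv_into {T. norm T \<le> 1} \<Phi>"
  have inj: "inj_on \<Phi> {T. norm T \<le> 1}"
  proof (rule inj_onI)
    fix S T assume "\<Phi> S = \<Phi> T"
    then have "blinfun_apply S (d n) = blinfun_apply T (d n)" for n by (simp add: \<Phi>_def fun_eq_iff)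
    then have "range d \<subseteq> {x. blinfun_apply S x = blinfun_apply T x}" by blast
    moreover have "closed {x. blinfun_apply S x = blinfun_apply T x}"
      by (intro closed_Collect_eq continuous_intros)
    ultimately have "closure (range d) \<subseteq> {x. blinfun_apply S x = blinfun_apply T x}"
      by (rule closure_minimal)
    then show "S = T" unfolding d by (intro blinfun_eqI) blast
  qed
  have \<Psi>: "norm (\<Psi> y) \<le> 1" "\<Phi> (\<Psi> y) = y" if "y \<in> R" for y
    using that inv_into_into[of y \<Phi> "{T. norm T \<le> 1}"] f_inv_into_f[of y \<Phi> "{T. norm T \<le> 1}"]
    by (auto simp: R_def \<Psi>_def)
  have \<Psi>_\<Phi>: "\<Psi> (\<Phi> T) = T" if "norm T \<le> 1" for T
    using inj that by (simp add: \<Psi>_def)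

  \<comment> \<open>The inequalities say that sending \<open>d i\<close> to \<open>y i\<close>
    extends to a nonexpansive operator. Each of them involves finitely many coordinates and so is
    closed in the product topology.\<close>
  have R_eq: "R = {y. \<forall>n a. norm (\<Sum>i<n. a i *\<^sub>R y i) \<le> norm (\<Sum>i<n. a i *\<^sub>R d i)}"
  proof (rule set_eqI, rule iffI)
    fix y :: "nat \<Rightarrow> 'x" assume "y \<in> R"
    then obtain T where T: "norm T \<le> 1" "y = \<Phi> T" by (auto simp: R_def)
    have "norm (\<Sum>i<n. a i *\<^sub>R y i) \<le> norm (\<Sum>i<n. a i *\<^sub>R d i)" for n and a :: "nat \<Rightarrow> real"
    proof -
      have "(\<Sum>i<n. a i *\<^sub>R y i) = blinfun_apply T (\<Sum>i<n. a i *\<^sub>R d i)"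
        by (simp add: T(2) \<Phi>_def blinfun.sum_right blinfun.scaleR_right)
      also have "norm \<dots> \<le> norm T * norm (\<Sum>i<n. a i *\<^sub>R d i)" by (rule norm_blinfun)
      also have "\<dots> \<le> 1 * norm (\<Sum>i<n. a i *\<^sub>R d i)" using T(1) by (rule mult_right_mono) simp
      finally show ?thesis by simp
    qed
    then show "y \<in> {y. \<forall>n a. norm (\<Sum>i<n. a i *\<^sub>R y i) \<le> norm (\<Sum>i<n. a i *\<^sub>R d i)}" by blast
  next
    fix y :: "nat \<Rightarrow> 'x" assume y: "y \<in> {y. \<forall>n a. norm (\<Sum>i<n. a i *\<^sub>R y i) \<le> norm (\<Sum>i<n. a i *\<^sub>R d i)}"
    let ?f = "\<lambda>i. (d i, y i)"
    have "\<exists>G :: 'x \<Rightarrow>\<^sub>L 'x. norm G \<le> 1 \<and> (\<forall>z\<in>span (range ?f). blinfun_apply G (fst z) = snd z)"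
    proof (rule graph_blinfun)
      fix z assume "z \<in> span (range ?f)"
      then obtain n where "z \<in> span (?f ` {..<n})" using span_range_nat by blast
      then obtain a where "z = (\<Sum>i<n. a i *\<^sub>R ?f i)" unfolding span_family[OF finite_lessThan] by blast
      then have "z = (\<Sum>i<n. a i *\<^sub>R d i, \<Sum>i<n. a i *\<^sub>R y i)" by (simp add: prod_eq_iff fst_sum snd_sum)
      then show "norm (snd z) \<le> 1 * norm (fst z)" using y by simp
    next
      have "range d \<subseteq> fst ` span (range ?f)"
      proof
        fix v assume "v \<in> range d"
        then obtain n where "v = fst (?f n)" by auto
        then show "v \<in> fst ` span (range ?f)" by (blast intro: span_base)
      qed
      from closure_mono[OF this] show "closure (fst ` span (range ?f)) = UNIV" using d by blast
    qed auto
    then obtain G :: "'x \<Rightarrow>\<^sub>L 'x" where G: "norm G \<le> 1" "\<forall>z\<in>span (range ?f). blinfun_apply G (fst z) = snd z"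
      by blast
    have "\<Phi> G n = y n" for n using G(2)[rule_format, of "?f n"] by (simp add: \<Phi>_def span_base)
    then have "y = \<Phi> G" by (simp add: fun_eq_iff)
    then show "y \<in> R" using G(1) by (simp add: R_def)
  qed
  have "closed R"
    unfolding R_eq
    by (intro closed_Collect_all closed_Collect_le continuous_on_norm continuous_on_sum continuous_on_scaleR
        continuous_on_const continuous_on_product_coordinates)
  then have "completely_metrizable_space (top_of_set R)"
    unfolding closed_closedin by (rule completely_metrizable_space_closedin[OF completely_metrizable_space_euclidean])
  moreover have "homeomorphic_maps nonexpansive_sot (top_of_set R) \<Phi> \<Psi>"
    unfolding homeomorphic_maps_def
  proof (intro conjI ballI)
    have "continuous_map nonexpansive_sot euclidean (\<lambda>T. \<Phi> T n)" for n
      unfolding nonexpansive_sot_def \<Phi>_def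
      by (intro continuous_map_from_subtopology strong_operator_topology_continuous_evaluation)
    then have "continuous_map nonexpansive_sot euclidean \<Phi>"
      by (subst euclidean_product_topology[symmetric]) (simp add: continuous_map_componentwise_UNIV)
    then show "continuous_map nonexpansive_sot (top_of_set R) \<Phi>"
      by (simp add: continuous_map_in_subtopology topspace_nonexpansive_sot R_def)
  next
    have "continuous_on R (\<lambda>y. blinfun_apply (\<Psi> y) x)" for x
    proof -
      obtain s where s: "\<And>k. s k \<in> range d" "s \<longlonglongrightarrow> x"
        using d closure_sequential[of x "range d"] by auto
      have "\<forall>k. \<exists>n. s k = d n" using s(1) by blast
      then obtain p where p: "\<And>k. s k = d (p k)" by metis
      \<comment> \<open>Replacing \<open>x\<close> by \<open>s k\<close> changes the value by at
        most \<open>norm (s k - x)\<close> for all \<open>y \<in> R\<close> at once; thus evaluation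
        at \<open>x\<close> is a uniform limit of coordinates.\<close>
      have "uniform_limit R (\<lambda>k y. y (p k)) (\<lambda>y. blinfun_apply (\<Psi> y) x) sequentially"
      proof (rule uniform_limitI)
        fix e :: real assume "0 < e"
        with s(2) have "\<forall>\<^sub>F k in sequentially. dist (s k) x < e" by (rule tendstoD)
        then show "\<forall>\<^sub>F k in sequentially. \<forall>y\<in>R. dist (y (p k)) (blinfun_apply (\<Psi> y) x) < e"
        proof eventually_elim
          case (elim k)
          have "dist (y (p k)) (blinfun_apply (\<Psi> y) x) < e" if y: "y \<in> R" for y
          proof -
            have "y (p k) = blinfun_apply (\<Psi> y) (s k)" using \<Psi>(2)[OF y] by (metis \<Phi>_def p)
            then have "dist (y (p k)) (blinfun_apply (\<Psi> y) x) = norm (blinfun_apply (\<Psi> y) (s k - x))"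
              by (simp add: dist_norm blinfun.diff_right)
            also have "\<dots> \<le> norm (\<Psi> y) * norm (s k - x)" by (rule norm_blinfun)
            also have "\<dots> \<le> 1 * norm (s k - x)" using \<Psi>(1)[OF y] by (rule mult_right_mono) simp
            finally show ?thesis using elim by (simp add: dist_norm)
          qed
          then show ?case by blast
        qed
      qed
      then show ?thesis
        by (rule uniform_limit_theorem[rotated])
          (auto intro!: continuous_on_subset[OF continuous_on_product_coordinates] always_eventually)
    qed
    then show "continuous_map (top_of_set R) nonexpansive_sot \<Psi>"
      unfolding nonexpansive_sot_def continuous_map_in_subtopology continuous_on_strong_operator_topo_iff_coordinatewise
      using \<Psi>(1) by auto
  qed (auto simp: topspace_nonexpansive_sot \<Psi> \<Psi>_\<Phi>)
  then have "(nonexpansive_sot :: ('x \<Rightarrow>\<^sub>L 'x) topology) homeomorphic_space top_of_set R"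
    unfolding homeomorphic_space_def by blast
  ultimately show ?thesis using homeomorphic_completely_metrizable_space by blast
qed

section \<open>Gurarii operators form a countable intersection of dense open sets\<close>

definition extension_condition where
  "extension_condition \<eta> I J K L x w = {G. norm G \<le> 1 \<and>
     (K \<subseteq> I \<and> I \<subseteq> J \<and> K \<subseteq> L \<and> L \<subseteq> J \<and> compatible \<eta> G I K x w \<longrightarrow> (\<exists>\<delta><11 * \<eta>. solvable \<delta> G I J K L x w))}"

lemma openin_extension_condition:
  fixes x w :: "'i \<Rightarrow> 'x::banach"
  assumes J: "finite J"
  shows "openin nonexpansive_sot (extension_condition \<eta> I J K L x w)"
proof (subst openin_subopen, intro ballI)
  fix G0 assume G0: "G0 \<in> extension_condition \<eta> I J K L x w"
  then have G0_1: "norm G0 \<le> 1" by (simp add: extension_condition_def)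
  let ?B = "\<lambda>V r. {G. norm G \<le> 1 \<and> (\<forall>v\<in>V. norm (blinfun_apply G v - blinfun_apply G0 v) < r)}"
  have *: "\<exists>T. openin nonexpansive_sot T \<and> G0 \<in> T \<and> T \<subseteq> extension_condition \<eta> I J K L x w" if "finite V" "0 < r" "?B V r \<subseteq> extension_condition \<eta> I J K L x w" for V r
    using that G0_1 openin_nonexpansive_sot_basic[OF that(1), of G0 r] by (intro exI[of _ "?B V r"]) simp
  have "\<not> (K \<subseteq> I \<and> I \<subseteq> J \<and> K \<subseteq> L \<and> L \<subseteq> J \<and> almost_nonexpansive \<eta> I x w) \<or>
      (\<exists>i\<in>K. \<not> norm (blinfun_apply G0 (x i) - w i) \<le> \<eta>) \<or> I \<subseteq> J \<and> (\<exists>\<delta><11 * \<eta>. solvable \<delta> G0 I J K L x w)"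
    using G0 unfolding extension_condition_def compatible_def by blast
  then consider "\<not> (K \<subseteq> I \<and> I \<subseteq> J \<and> K \<subseteq> L \<and> L \<subseteq> J \<and> almost_nonexpansive \<eta> I x w)"
    | i where "i \<in> K" "norm (blinfun_apply G0 (x i) - w i) > \<eta>"
    | \<delta> where "I \<subseteq> J" "\<delta> < 11 * \<eta>" "solvable \<delta> G0 I J K L x w"
    unfolding not_le by blast
  then show "\<exists>T. openin nonexpansive_sot T \<and> G0 \<in> T \<and> T \<subseteq> extension_condition \<eta> I J K L x w"
  proof cases
    case 1
    then show ?thesis by (intro *[of "{}" 1]) (auto simp: extension_condition_def compatible_def)
  next
    case 2
    have "?B {x i} (norm (blinfun_apply G0 (x i) - w i) - \<eta>) \<subseteq> extension_condition \<eta> I J K L x w"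
    proof
      fix G assume G: "G \<in> ?B {x i} (norm (blinfun_apply G0 (x i) - w i) - \<eta>)"
      have "norm (blinfun_apply G0 (x i) - w i) \<le>
          norm (blinfun_apply G (x i) - w i) + norm (blinfun_apply G (x i) - blinfun_apply G0 (x i))"
        using norm_triangle_ineq4[of "blinfun_apply G (x i) - w i" "blinfun_apply G (x i) - blinfun_apply G0 (x i)"]
        by simp
      then have "norm (blinfun_apply G (x i) - w i) > \<eta>" using G by auto
      then have "\<not> compatible \<eta> G I K x w" using 2(1) unfolding compatible_def by fastforce
      then show "G \<in> extension_condition \<eta> I J K L x w" using G by (simp add: extension_condition_def)
    qed
    then show ?thesis using 2(2) by (intro *[of "{x i}"]) auto
  next
    case 3
    obtain x' w' where x': "\<And>i. i \<in> I \<Longrightarrow> w' i = blinfun_apply G0 (x' i)"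
      "almost_isometric \<delta> I x x'" "almost_isometric \<delta> J w w'"
      "\<And>i. i \<in> K \<Longrightarrow> norm (x' i - x i) \<le> \<delta>" "\<And>j. j \<in> L \<Longrightarrow> norm (w' j - w j) \<le> \<delta>"
      using 3(3) unfolding solvable_def by blast
    \<comment> \<open>The vectors \<open>x'\<close> and \<open>w'\<close> remain a solution for
      every operator close to \<open>G0\<close> on the finitely many \<open>x' i\<close>; half of
      the spare room is spent on their commutation error.\<close>
    define r where "r = (11 * \<eta> - \<delta>) / 2"
    have r: "0 < r" "\<delta> + r < 11 * \<eta>" using 3(2) by (auto simp: r_def field_simps)
    have "?B (x' ` I) r \<subseteq> extension_condition \<eta> I J K L x w"
    proof
      fix G assume G: "G \<in> ?B (x' ` I) r"
      have "solvable (\<delta> + r) G I J K L x w"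
        by (rule solvableI[OF x'(2-5)]) (use G r x'(1) in \<open>auto simp: less_imp_le\<close>)
      then show "G \<in> extension_condition \<eta> I J K L x w" using G r(2) by (auto simp: extension_condition_def)
    qed
    moreover have "finite (x' ` I)" using 3(1) J finite_subset by blast
    ultimately show ?thesis using r(1) by (intro *)
  qed
qed

lemma dense_extension_condition:
  fixes x w :: "'i \<Rightarrow> 'x::banach" and d :: "nat \<Rightarrow> 'x"
  assumes d: "closure (range d) = UNIV" and g: "gurarii_space TYPE('x)" and J: "finite J" and \<eta>: "0 < \<eta>"
  shows "nonexpansive_sot closure_of extension_condition \<eta> I J K L x w = topspace nonexpansive_sot"
  unfolding dense_intersects_open
proof (intro allI impI, elim conjE)
  fix T :: "('x \<Rightarrow>\<^sub>L 'x) set" assume T: "openin nonexpansive_sot T" "T \<noteq> {}"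
  then obtain G0 where G0: "G0 \<in> T" by blast
  have G0_1: "norm G0 \<le> 1" using openin_subset[OF T(1)] G0 by (auto simp: topspace_nonexpansive_sot)
  obtain V r where V: "finite V" "0 < r"
    "{G. norm G \<le> 1 \<and> (\<forall>v\<in>V. norm (blinfun_apply G v - blinfun_apply G0 v) < r)} \<subseteq> T"
    using nonexpansive_sot_neighbourhood[OF T(1) G0] by blast
  show "extension_condition \<eta> I J K L x w \<inter> T \<noteq> {}"
  proof (cases "K \<subseteq> I \<and> I \<subseteq> J \<and> K \<subseteq> L \<and> L \<subseteq> J \<and> compatible \<eta> G0 I K x w")
    case True
    then obtain G where G: "norm G \<le> 1" "\<forall>v\<in>V. norm (blinfun_apply G v - blinfun_apply G0 v) < r"
      "solvable (10 * \<eta> + \<eta> / 2) G I J K L x w"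
      using solvable_dense[OF d g g G0_1 _ \<eta> J _ _ _ _ V(1,2)] by blast
    have "10 * \<eta> + \<eta> / 2 < 11 * \<eta>" using \<eta> by simp
    then have "G \<in> extension_condition \<eta> I J K L x w" using G(1,3) unfolding extension_condition_def by blast
    moreover have "G \<in> T" using G V(3) by blast
    ultimately show ?thesis by blast
  next
    case False
    then have "G0 \<in> extension_condition \<eta> I J K L x w" using G0_1 by (auto simp: extension_condition_def)
    then show ?thesis using G0 by blast
  qed
qed

section \<open>Reduction to countably many conditions\<close>

lemma solvable_perturb:
  assumes s: "solvable \<delta> G I J K L y v" and KL: "K \<subseteq> I" "L \<subseteq> J"
    and x: "\<And>i. i \<in> I \<Longrightarrow> norm (x i - y i) \<le> \<theta>" and w: "\<And>j. j \<in> J \<Longrightarrow> norm (w j - v j) \<le> \<theta>"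
  shows "solvable (\<delta> + \<theta>) G I J K L x w"
proof -
  obtain x' w' where x': "\<forall>i\<in>I. w' i = blinfun_apply G (x' i)"
    "almost_isometric \<delta> I y x'" "almost_isometric \<delta> J v w'"
    "\<And>i. i \<in> K \<Longrightarrow> norm (x' i - y i) \<le> \<delta>" "\<And>j. j \<in> L \<Longrightarrow> norm (w' j - v j) \<le> \<delta>"
    using s unfolding solvable_def by blast
  have "almost_isometric (\<delta> + \<theta>) I x x'"
    by (rule almost_isometric_sym, rule almost_isometric_trans[OF almost_isometric_sym[OF x'(2)]]) (rule x)
  moreover have "almost_isometric (\<delta> + \<theta>) J w w'"
    by (rule almost_isometric_sym, rule almost_isometric_trans[OF almost_isometric_sym[OF x'(3)]]) (rule w)
  moreover have "norm (x' i - x i) \<le> \<delta> + \<theta>" if "i \<in> K" for i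
    using norm_triangle_ineq4[of "x' i - y i" "x i - y i"] x'(4)[OF that] x[of i] that KL by fastforce
  moreover have "norm (w' j - w j) \<le> \<delta> + \<theta>" if "j \<in> L" for j
    using norm_triangle_ineq4[of "w' j - v j" "w j - v j"] x'(5)[OF that] w[of j] that KL by fastforce
  ultimately show ?thesis using x'(1) unfolding solvable_def by blast
qed

text \<open>One \<open>\<theta>\<close> is due to the source vectors and one to the target vectors;
  in the commutation estimate \<open>norm G \<le> 1\<close> transports the former.\<close>

lemma compatible_perturb:
  fixes G :: "'x::real_normed_vector \<Rightarrow>\<^sub>L 'y::real_normed_vector"
  assumes G: "norm G \<le> 1" and c: "compatible \<eta> G I K x w" and K: "K \<subseteq> I"
    and y: "\<And>i. i \<in> I \<Longrightarrow> norm (x i - y i) \<le> \<theta>" and v: "\<And>i. i \<in> I \<Longrightarrow> norm (w i - v i) \<le> \<theta>"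
  shows "compatible (\<eta> + 2 * \<theta>) G I K y v"
  unfolding compatible_def almost_nonexpansive_def
proof (intro conjI allI ballI)
  fix a :: "'a \<Rightarrow> real"
  have "norm (\<Sum>i\<in>I. a i *\<^sub>R w i) \<le> norm (\<Sum>i\<in>I. a i *\<^sub>R x i) + \<eta> * (\<Sum>i\<in>I. \<bar>a i\<bar>)"
    using c by (intro almost_nonexpansiveD) (simp add: compatible_def)
  moreover have "norm ((\<Sum>i\<in>I. a i *\<^sub>R x i) - (\<Sum>i\<in>I. a i *\<^sub>R y i)) \<le> \<theta> * (\<Sum>i\<in>I. \<bar>a i\<bar>)"
    by (rule norm_sum_perturb[OF y])
  moreover have "norm ((\<Sum>i\<in>I. a i *\<^sub>R w i) - (\<Sum>i\<in>I. a i *\<^sub>R v i)) \<le> \<theta> * (\<Sum>i\<in>I. \<bar>a i\<bar>)"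
    by (rule norm_sum_perturb[OF v])
  ultimately show "norm (\<Sum>i\<in>I. a i *\<^sub>R v i) \<le> norm (\<Sum>i\<in>I. a i *\<^sub>R y i) + (\<eta> + 2 * \<theta>) * (\<Sum>i\<in>I. \<bar>a i\<bar>)"
    using norm_triangle_ineq3[of "\<Sum>i\<in>I. a i *\<^sub>R x i" "\<Sum>i\<in>I. a i *\<^sub>R y i"]
      norm_triangle_ineq3[of "\<Sum>i\<in>I. a i *\<^sub>R w i" "\<Sum>i\<in>I. a i *\<^sub>R v i"]
    unfolding distrib_right by linarith
next
  fix i assume i: "i \<in> K"
  have "norm (blinfun_apply G (x i - y i)) \<le> norm G * norm (x i - y i)" by (rule norm_blinfun)
  also have "\<dots> \<le> 1 * norm (x i - y i)" using G by (rule mult_right_mono) simp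
  also have "\<dots> \<le> \<theta>" using y i K by auto
  finally have "norm (blinfun_apply G (x i - y i)) \<le> \<theta>" .
  moreover have "norm (w i - v i) \<le> \<theta>" using v i K by auto
  moreover have "norm (blinfun_apply G (x i) - w i) \<le> \<eta>" using c i by (simp add: compatible_def)
  moreover have "blinfun_apply G (y i) - v i =
      (blinfun_apply G (x i) - w i) - blinfun_apply G (x i - y i) + (w i - v i)"
    by (simp add: blinfun.diff_right)
  ultimately show "norm (blinfun_apply G (y i) - v i) \<le> \<eta> + 2 * \<theta>"
    using norm_triangle_ineq[of "(blinfun_apply G (x i) - w i) - blinfun_apply G (x i - y i)" "w i - v i"]
      norm_triangle_ineq4[of "blinfun_apply G (x i) - w i" "blinfun_apply G (x i - y i)"] by simp
qed

definition coded_condition ::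
  "(nat \<Rightarrow> 'x::banach) \<Rightarrow> nat list \<times> nat list \<times> nat list \<times> nat list \<times> nat list \<times> nat list \<times> nat \<Rightarrow> ('x \<Rightarrow>\<^sub>L 'x) set" where
  "coded_condition d = (\<lambda>(ps, qs, I, J, K, L, r).
     extension_condition (1 / real (Suc r)) (set I) (set J) (set K) (set L) (\<lambda>i. d (ps ! i)) (\<lambda>i. d (qs ! i)))"

lemma dense_sequence_list:
  fixes d :: "nat \<Rightarrow> 'x::real_normed_vector" and x :: "nat \<Rightarrow> 'x"
  assumes d: "closure (range d) = UNIV" and J: "finite J" and \<theta>: "0 < \<theta>"
  shows "\<exists>ps. \<forall>j\<in>J. norm (x j - d (ps ! j)) \<le> \<theta>"
proof -
  obtain m where m: "J \<subseteq> {..<m}" using J finite_nat_iff_bounded by blast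
  have "\<exists>p. dist (d p) (x j) < \<theta>" for j
    using d closure_approachable[of "x j" "range d"] \<theta> by auto
  then obtain p where p: "\<And>j. dist (d (p j)) (x j) < \<theta>" by metis
  have "norm (x j - d (map p [0..<m] ! j)) \<le> \<theta>" if "j \<in> J" for j
    using p[of j] that m by (auto simp: dist_norm norm_minus_commute)
  then show ?thesis by blast
qed

lemma approximately_gurarii_of_coded:
  fixes d :: "nat \<Rightarrow> 'x::banach"
  assumes d: "closure (range d) = UNIV" and G: "norm G \<le> 1" and cond: "\<And>c. G \<in> coded_condition d c"
  shows "approximately_gurarii G"
  unfolding approximately_gurarii_def
proof (intro allI impI)
  fix \<tau> :: real assume "0 < \<tau>"
  \<comment> \<open>12 covers the error below \<open>11 * \<eta>\<close> of a coded solution and the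
    \<open>\<eta> / 4\<close> for returning to the given vectors. On the way in,
    \<open>\<eta>\<close> splits into the defect \<open>\<eta> / 2\<close> of the given data and
    twice the approximation error \<open>\<eta> / 4\<close>.\<close>
  then have "0 < \<tau> / 12" by simp
  then obtain r where r: "inverse (real (Suc r)) < \<tau> / 12" using reals_Archimedean by blast
  define \<eta> where "\<eta> = 1 / real (Suc r)"
  have \<eta>: "0 < \<eta>" "12 * \<eta> \<le> \<tau>" using r by (auto simp: \<eta>_def inverse_eq_divide field_simps)
  have "solvable \<tau> G I J K L x w"
    if J: "finite J" "K \<subseteq> I" "I \<subseteq> J" "K \<subseteq> L" "L \<subseteq> J" and c: "compatible (\<eta> / 2) G I K x w"
    for I J K L :: "nat set" and x w :: "nat \<Rightarrow> 'x"
  proof -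
    have "0 < \<eta> / 4" using \<eta>(1) by simp
    note list = dense_sequence_list[OF d J(1) this]
    obtain ps where ps: "\<And>j. j \<in> J \<Longrightarrow> norm (x j - d (ps ! j)) \<le> \<eta> / 4" using list[of x] by blast
    obtain qs where qs: "\<And>j. j \<in> J \<Longrightarrow> norm (w j - d (qs ! j)) \<le> \<eta> / 4" using list[of w] by blast
    have "compatible (\<eta> / 2 + 2 * (\<eta> / 4)) G I K (\<lambda>i. d (ps ! i)) (\<lambda>i. d (qs ! i))"
      using J(3) ps qs by (intro compatible_perturb[OF G c J(2)]) auto
    then have c': "compatible \<eta> G I K (\<lambda>i. d (ps ! i)) (\<lambda>i. d (qs ! i))" by simp
    have "finite I" "finite K" "finite L" using J by (meson finite_subset)+
    then obtain Is Js Ks Ls where "set Is = I" "set Js = J" "set Ks = K" "set Ls = L"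
      using J(1) finite_list by metis
    then have "G \<in> extension_condition \<eta> I J K L (\<lambda>i. d (ps ! i)) (\<lambda>i. d (qs ! i))"
      using cond[of "(ps, qs, Is, Js, Ks, Ls, r)"] by (simp add: coded_condition_def \<eta>_def)
    then obtain \<delta> where \<delta>: "\<delta> < 11 * \<eta>" "solvable \<delta> G I J K L (\<lambda>i. d (ps ! i)) (\<lambda>i. d (qs ! i))"
      using c' J unfolding extension_condition_def by blast
    have "solvable (\<delta> + \<eta> / 4) G I J K L x w"
      using J ps qs by (intro solvable_perturb[OF \<delta>(2)]) auto
    then show ?thesis by (rule solvable_mono) (use \<delta> \<eta> in linarith)
  qed
  then show "\<exists>\<eta>>0. \<forall>(I :: nat set) J K L x w.
      finite J \<and> K \<subseteq> I \<and> I \<subseteq> J \<and> K \<subseteq> L \<and> L \<subseteq> J \<and> compatible \<eta> G I K x w \<longrightarrow> solvable \<tau> G I J K L x w"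
    using \<eta>(1) by (intro exI[of _ "\<eta> / 2"]) auto
qed

text \<open>A Gurarii operator attains the error \<open>10 * \<eta>\<close>, strictly within the
  tolerance. Conversely, the conditions for all \<open>r\<close> yield solutions of arbitrarily
  small error, which are corrected to exact ones.\<close>

lemma gurarii_operators_eq_Inter:
  fixes d :: "nat \<Rightarrow> 'x::banach"
  assumes d: "closure (range d) = UNIV" and g: "gurarii_space TYPE('x)"
  shows "{G :: 'x \<Rightarrow>\<^sub>L 'x. gurarii_operator G} = \<Inter> (range (coded_condition d))"
proof (intro subset_antisym subsetI INT_I CollectI)
  fix G :: "'x \<Rightarrow>\<^sub>L 'x" and c assume "G \<in> {G. gurarii_operator G}"
  then have G: "gurarii_operator G" by simp
  have "G \<in> extension_condition \<eta> I J K L x w" if "0 < \<eta>" "finite J" for \<eta> and I J K L :: "nat set" and x w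
  proof -
    have "norm G \<le> 1" using G by (simp add: gurarii_operator_def)
    moreover have "solvable (10 * \<eta>) G I J K L x w"
      if "K \<subseteq> I \<and> I \<subseteq> J \<and> K \<subseteq> L \<and> L \<subseteq> J \<and> compatible \<eta> G I K x w"
      using that \<open>0 < \<eta>\<close> \<open>finite J\<close> by (intro gurarii_operator_solvable[OF G]) auto
    moreover have "10 * \<eta> < 11 * \<eta>" using \<open>0 < \<eta>\<close> by simp
    ultimately show ?thesis unfolding extension_condition_def by blast
  qed
  then show "G \<in> coded_condition d c" by (cases c) (simp add: coded_condition_def)
next
  fix G assume "G \<in> \<Inter> (range (coded_condition d))"
  then have G: "G \<in> coded_condition d c" for c by blast
  have "norm G \<le> 1" using G[of "([], [], [], [], [], [], 0)"] by (simp add: coded_condition_def extension_condition_def)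
  then show "gurarii_operator G"
    using approximately_gurarii_imp_gurarii[OF g g] approximately_gurarii_of_coded[OF d] G by blast
qed

theorem theorem1:
  assumes "separable_space (euclidean :: 'g::banach topology)"
    and "gurarii_space TYPE('g)"
  shows "gdelta_in nonexpansive_sot {G :: 'g \<Rightarrow>\<^sub>L 'g. gurarii_operator G} \<and>
         nonexpansive_sot closure_of {G :: 'g \<Rightarrow>\<^sub>L 'g. gurarii_operator G} = topspace nonexpansive_sot"
proof -
  obtain C :: "'g set" where C: "countable C" "closure C = UNIV"
    using assms(1) unfolding separable_space_def by auto
  have "C \<noteq> {}" using C(2) by auto
  then have d: "closure (range (from_nat_into C)) = UNIV" using C by (simp add: range_from_nat_into)
  let ?\<G> = "range (coded_condition (from_nat_into C))"
  have op: "openin nonexpansive_sot T \<and> nonexpansive_sot closure_of T = topspace nonexpansive_sot" if T: "T \<in> ?\<G>" for T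
  proof -
    obtain ps qs I J K L r where "T = extension_condition (1 / real (Suc r)) (set I) (set J) (set K) (set L)
        (\<lambda>i. from_nat_into C (ps ! i)) (\<lambda>i. from_nat_into C (qs ! i))"
      using T unfolding coded_condition_def by auto
    then show ?thesis
      by (simp add: openin_extension_condition dense_extension_condition[OF d assms(2)])
  qed
  have cnt: "countable ?\<G>" by simp
  have "gdelta_in nonexpansive_sot (\<Inter>?\<G>)"
    using op by (intro gdelta_in_Inter cnt) (auto intro: open_imp_gdelta_in)
  moreover have "nonexpansive_sot closure_of \<Inter>?\<G> = topspace nonexpansive_sot"
    by (rule Baire_category[OF _ cnt op]) (simp add: completely_metrizable_nonexpansive_sot[OF d])
  ultimately show ?thesis unfolding gurarii_operators_eq_Inter[OF d assms(2)] by blast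
qed

end
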